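(* Let $\lambda/\mu$ be a skew shape and $n$ a positive integer, and write $\mathbf{x}_n=(x_1,\ldots,x_n)$. Then $$G_{\lambda/\mu}(\mathbf{x}_n;\mathbf{t};\mathbf{w})=\sum_{\gamma}\sum_{\theta}\mathbf{t}^{\gamma}\mathbf{w}^{\theta}\sum_{\nu}H^{\nu,\gamma,\theta}_{\lambda/\mu,n}\,s_\nu(\mathbf{x}_n),$$ where $\gamma,\theta$ range over weak compositions, $\nu$ ranges over partitions, $s_\nu(\mathbf{x}_n)$ is the Schur polynomial, and $H^{\nu,\gamma,\theta}_{\lambda/\mu,n}$ is the number of $T\in\mathrm{SVRPP}^n(\lambda/\mu)$ with $\mathrm{ircont}(T)=\nu$, $\mathrm{ceq}(T)=\gamma$, $\mathrm{ex}(T)=\theta$, such that $\mathrm{read}(T)$ is a reverse lattice word.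
   Context: Boxes are $(i,j)$ (row $i$, column $j$, matrix coordinates); $\lambda/\mu$ is the set of boxes of the Young diagram of $\lambda$ not in that of $\mu$. For nonempty finite sets of positive integers, $A\le B$ means $\max A\le\min B$. An SVRPP of shape $\lambda/\mu$ is a filling $T$ assigning a nonempty finite set $T(i,j)$ of positive integers to each box, weakly increasing (w.r.t. $\le$) along rows left to right and down columns. $\mathrm{SVRPP}^n(\lambda/\mu)$ is the set of SVRPPs all of whose sets are subsets of $[n]=\{1,\ldots,n\}$. Statistics: $\mathrm{ircont}(T)=(r_1,r_2,\ldots)$, $r_k$ = number of columns of $T$ containing a box whose set contains $k$; $\mathrm{ceq}(T)=(c_1,c_2,\ldots)$, $c_i$ = number of boxes $(i,j)\in\lambda/\mu$ with $(i+1,j)\in\lambda/\mu$ and $\max T(i,j)=\min T(i+1,j)$; $\mathrm{ex}(T)=(e_1,e_2,\ldots)$, $e_i=\sum_{(i,j)\in\lambda/\mu}(|T(i,j)|-1)$. The hybrid Grothendieck polynomial is $G_{\lambda/\mu}(\mathbf{x};\mathbf{t};\mathbf{w})=\sum_{T\in\mathrm{SVRPP}(\lambda/\mu)}\mathbf{x}^{\mathrm{ircont}(T)}\mathbf{t}^{\mathrm{ceq}(T)}\mathbf{w}^{\mathrm{ex}(T)}$ (with $\mathbf{y}^\alpha=\prod_k y_k^{\alpha_k}$), and $G_{\lambda/\mu}(\mathbf{x}_n;\mathbf{t};\mathbf{w})$ is obtained by setting $x_k=0$ for $k>n$ (equivalently, summing over $\mathrm{SVRPP}^n(\lambda/\mu)$).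 Reading word: the minimum of each set $T(i,j)$ is the pivot of box $(i,j)$. $\mathrm{read}(T)=w^{(N)}w^{(N-1)}\cdots w^{(1)}$, where $N$ is the number of rows and $w^{(i)}$ is the word of row $i$ (so rows are read bottom to top), formed as follows: first list all non-pivot entries of the boxes of row $i$, taking the boxes from right to left and, within each box, the entries from largest to smallest; then list the pivots of the boxes of row $i$ from left to right, except that the pivot of box $(i,j)$ is omitted whenever $(i-1,j)\in\lambda/\mu$ and this pivot equals $\max T(i-1,j)$. A word $w_1\cdots w_r$ is a reverse lattice word if for every $k$ and all $a<b$, the suffix $w_k\cdots w_r$ contains at least as many letters $a$ as letters $b$. *)

theory Defs
  imports "HOL-Library.Poly_Mapping"
begin

section \<open>Partitions, weak compositions, skew shapes\<close>

text \<open>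
  All indices (rows, columns, entries, variables) start at 1. A sequence
  \<open>(a\<^sub>1, a\<^sub>2, \<dots>)\<close> is a function on \<open>nat\<close> whose unused value at \<open>0\<close> is fixed to be \<open>0\<close>,
  so that distinct sequences are distinct functions.
\<close>

definition weak_composition :: "(nat \<Rightarrow> nat) \<Rightarrow> bool" where
  "weak_composition \<alpha> \<longleftrightarrow> \<alpha> 0 = 0 \<and> finite {k. \<alpha> k \<noteq> 0}"

definition is_partition :: "(nat \<Rightarrow> nat) \<Rightarrow> bool" where
  "is_partition lam \<longleftrightarrow> weak_composition lam \<and> (\<forall>i j. 1 \<le> i \<and> i \<le> j \<longrightarrow> lam j \<le> lam i)"

definition num_rows :: "(nat \<Rightarrow> nat) \<Rightarrow> nat" where
  "num_rows lam = card {i. lam i \<noteq> 0}"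

type_synonym box = "nat \<times> nat"

definition young_diagram :: "(nat \<Rightarrow> nat) \<Rightarrow> box set" where
  "young_diagram lam = {(i, j). 1 \<le> i \<and> 1 \<le> j \<and> j \<le> lam i}"

definition skew_boxes :: "(nat \<Rightarrow> nat) \<Rightarrow> (nat \<Rightarrow> nat) \<Rightarrow> box set" where
  "skew_boxes lam mu = young_diagram lam - young_diagram mu"

definition is_skew_shape :: "(nat \<Rightarrow> nat) \<Rightarrow> (nat \<Rightarrow> nat) \<Rightarrow> bool" where
  "is_skew_shape lam mu \<longleftrightarrow>
     is_partition lam \<and> is_partition mu \<and> young_diagram mu \<subseteq> young_diagram lam"


section \<open>Set-valued reverse plane partitions and their statistics\<close>

definition set_le :: "nat set \<Rightarrow> nat set \<Rightarrow> bool" where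
  "set_le A B \<longleftrightarrow> Max A \<le> Min B"

text \<open>Fillings are total functions, normalised to \<open>{}\<close> outside the shape.\<close>

definition SVRPP :: "(nat \<Rightarrow> nat) \<Rightarrow> (nat \<Rightarrow> nat) \<Rightarrow> (box \<Rightarrow> nat set) set" where
  "SVRPP lam mu = {T.
     (\<forall>b. b \<notin> skew_boxes lam mu \<longrightarrow> T b = {}) \<and>
     (\<forall>b \<in> skew_boxes lam mu. T b \<noteq> {} \<and> finite (T b) \<and> (\<forall>k \<in> T b. 1 \<le> k)) \<and>
     (\<forall>i j j'. (i, j) \<in> skew_boxes lam mu \<and> (i, j') \<in> skew_boxes lam mu \<and> j < j'
        \<longrightarrow> set_le (T (i, j)) (T (i, j'))) \<and>
     (\<forall>i i' j. (i, j) \<in> skew_boxes lam mu \<and> (i', j) \<in> skew_boxes lam mu \<and> i < i'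
        \<longrightarrow> set_le (T (i, j)) (T (i', j)))}"

definition SVRPP_upto :: "nat \<Rightarrow> (nat \<Rightarrow> nat) \<Rightarrow> (nat \<Rightarrow> nat) \<Rightarrow> (box \<Rightarrow> nat set) set" where
  "SVRPP_upto n lam mu = {T \<in> SVRPP lam mu. \<forall>b \<in> skew_boxes lam mu. T b \<subseteq> {1..n}}"

definition ircont :: "(nat \<Rightarrow> nat) \<Rightarrow> (nat \<Rightarrow> nat) \<Rightarrow> (box \<Rightarrow> nat set) \<Rightarrow> nat \<Rightarrow> nat" where
  "ircont lam mu T k = card {j. \<exists>i. (i, j) \<in> skew_boxes lam mu \<and> k \<in> T (i, j)}"

definition ceq :: "(nat \<Rightarrow> nat) \<Rightarrow> (nat \<Rightarrow> nat) \<Rightarrow> (box \<Rightarrow> nat set) \<Rightarrow> nat \<Rightarrow> nat" where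
  "ceq lam mu T i = card {j. (i, j) \<in> skew_boxes lam mu \<and> (i + 1, j) \<in> skew_boxes lam mu \<and>
                          Max (T (i, j)) = Min (T (i + 1, j))}"

definition ex :: "(nat \<Rightarrow> nat) \<Rightarrow> (nat \<Rightarrow> nat) \<Rightarrow> (box \<Rightarrow> nat set) \<Rightarrow> nat \<Rightarrow> nat" where
  "ex lam mu T i = (\<Sum>j \<in> {j. (i, j) \<in> skew_boxes lam mu}. card (T (i, j)) - 1)"


section \<open>The polynomial ring and the polynomials\<close>

text \<open>
  Integer polynomials in the three families of indeterminates \<open>x\<^sub>k\<close>, \<open>t\<^sub>k\<close>, \<open>w\<^sub>k\<close>, as
  finitely supported coefficient functions on finitely supported exponent functions.
\<close>

datatype indet = XVar nat | TVar nat | WVar nat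

type_synonym monom = "indet \<Rightarrow>\<^sub>0 nat"
type_synonym poly = "monom \<Rightarrow>\<^sub>0 int"

definition var :: "indet \<Rightarrow> poly" where
  "var v = Poly_Mapping.single (Poly_Mapping.single v 1) 1"

definition multi_power :: "(nat \<Rightarrow> indet) \<Rightarrow> (nat \<Rightarrow> nat) \<Rightarrow> poly" where
  "multi_power Y \<alpha> = (\<Prod>k. var (Y k) ^ \<alpha> k)"

definition svrpp_weight ::
    "(nat \<Rightarrow> nat) \<Rightarrow> (nat \<Rightarrow> nat) \<Rightarrow> (box \<Rightarrow> nat set) \<Rightarrow> poly" where
  "svrpp_weight lam mu T =
     multi_power XVar (ircont lam mu T) * multi_power TVar (ceq lam mu T) * multi_power WVar (ex lam mu T)"

text \<open>
  \<open>G\<^bsub>lam/mu\<^esub>(\<^bold>x; \<^bold>t; \<^bold>w)\<close> in infinitely many variables \<open>x\<^sub>k\<close> is a formal power series, given by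
  its coefficients; \<open>hybrid_grothendieck n lam mu\<close> is \<open>G\<^bsub>lam/mu\<^esub>(\<^bold>x\<^sub>n; \<^bold>t; \<^bold>w)\<close>. The lemma
  \<open>lookup_hybrid_grothendieck\<close> below shows that the latter is the former at
  \<open>x\<^sub>k = 0\<close> for \<open>k > n\<close>.
\<close>

definition hybrid_grothendieck_series ::
    "(nat \<Rightarrow> nat) \<Rightarrow> (nat \<Rightarrow> nat) \<Rightarrow> monom \<Rightarrow> int" where
  "hybrid_grothendieck_series lam mu m =
     int (card {T \<in> SVRPP lam mu. svrpp_weight lam mu T = Poly_Mapping.single m 1})"

definition hybrid_grothendieck :: "nat \<Rightarrow> (nat \<Rightarrow> nat) \<Rightarrow> (nat \<Rightarrow> nat) \<Rightarrow> poly" where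
  "hybrid_grothendieck n lam mu = (\<Sum>T \<in> SVRPP_upto n lam mu. svrpp_weight lam mu T)"

text \<open>Semistandard Young tableaux with entries in \<open>{1..n}\<close>, normalised to \<open>0\<close> outside the shape.\<close>

definition SSYT_upto :: "nat \<Rightarrow> (nat \<Rightarrow> nat) \<Rightarrow> (box \<Rightarrow> nat) set" where
  "SSYT_upto n \<nu> = {S.
     (\<forall>b. b \<notin> young_diagram \<nu> \<longrightarrow> S b = 0) \<and>
     (\<forall>b \<in> young_diagram \<nu>. S b \<in> {1..n}) \<and>
     (\<forall>i j j'. (i, j) \<in> young_diagram \<nu> \<and> (i, j') \<in> young_diagram \<nu> \<and> j < j'
        \<longrightarrow> S (i, j) \<le> S (i, j')) \<and>
     (\<forall>i i' j. (i, j) \<in> young_diagram \<nu> \<and> (i', j) \<in> young_diagram \<nu> \<and> i < i'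
        \<longrightarrow> S (i, j) < S (i', j))}"

definition schur_poly :: "nat \<Rightarrow> (nat \<Rightarrow> nat) \<Rightarrow> poly" where
  "schur_poly n \<nu> = (\<Sum>S \<in> SSYT_upto n \<nu>. \<Prod>b \<in> young_diagram \<nu>. var (XVar (S b)))"


section \<open>Reading words\<close>

text \<open>
  The columns of row \<open>i\<close> of \<open>lam/mu\<close> are \<open>mu i + 1, \<dots>, lam i\<close>. For \<open>i = 1\<close> the box
  \<open>(i - 1, j)\<close> has row index 0 and hence is never in the shape.
\<close>

definition row_cols :: "(nat \<Rightarrow> nat) \<Rightarrow> (nat \<Rightarrow> nat) \<Rightarrow> nat \<Rightarrow> nat list" where
  "row_cols lam mu i = [mu i + 1 ..< lam i + 1]"

definition pivot :: "(box \<Rightarrow> nat set) \<Rightarrow> box \<Rightarrow> nat" where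
  "pivot T b = Min (T b)"

definition row_word ::
    "(nat \<Rightarrow> nat) \<Rightarrow> (nat \<Rightarrow> nat) \<Rightarrow> (box \<Rightarrow> nat set) \<Rightarrow> nat \<Rightarrow> nat list" where
  "row_word lam mu T i =
     concat (map (\<lambda>j. rev (sorted_list_of_set (T (i, j) - {pivot T (i, j)})))
                 (rev (row_cols lam mu i))) @
     map (\<lambda>j. pivot T (i, j))
         (filter (\<lambda>j. \<not> ((i - 1, j) \<in> skew_boxes lam mu \<and> pivot T (i, j) = Max (T (i - 1, j))))
                 (row_cols lam mu i))"

definition reading_word ::
    "(nat \<Rightarrow> nat) \<Rightarrow> (nat \<Rightarrow> nat) \<Rightarrow> (box \<Rightarrow> nat set) \<Rightarrow> nat list" where
  "reading_word lam mu T = concat (map (row_word lam mu T) (rev [1 ..< num_rows lam + 1]))"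

text \<open>Letters are positive, whence the bound \<open>1 \<le> a\<close>: 0 is not a letter.\<close>

definition reverse_lattice_word :: "nat list \<Rightarrow> bool" where
  "reverse_lattice_word u \<longleftrightarrow>
     (\<forall>k a b. 1 \<le> a \<and> a < b \<longrightarrow> count_list (drop k u) b \<le> count_list (drop k u) a)"

definition H_coeff ::
    "(nat \<Rightarrow> nat) \<Rightarrow> (nat \<Rightarrow> nat) \<Rightarrow> nat \<Rightarrow> (nat \<Rightarrow> nat) \<Rightarrow> (nat \<Rightarrow> nat) \<Rightarrow> (nat \<Rightarrow> nat) \<Rightarrow> nat" where
  "H_coeff lam mu n \<nu> \<gamma> \<theta> =
     card {T \<in> SVRPP_upto n lam mu. ircont lam mu T = \<nu> \<and> ceq lam mu T = \<gamma> \<and> ex lam mu T = \<theta> \<and>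
             reverse_lattice_word (reading_word lam mu T)}"


section \<open>Finiteness\<close>

text \<open>
  \<open>sum\<close>, \<open>card\<close>, \<open>Sum_any\<close> and \<open>Prod_any\<close> take a default value on infinite (supports of)
  families. The following facts show that this never happens here.
\<close>

lemma finite_young_diagram:
  assumes "is_partition lam"
  shows "finite (young_diagram lam)"
proof -
  have "young_diagram lam \<subseteq> (SIGMA i:{i. lam i \<noteq> 0}. {1..lam i})"
    by (auto simp: young_diagram_def)
  moreover have "finite (SIGMA i:{i. lam i \<noteq> 0}. {1..lam i})"
    using assms by (auto simp: is_partition_def weak_composition_def intro!: finite_SigmaI)
  ultimately show ?thesis by (rule finite_subset)
qed

lemma finite_skew_boxes: "is_skew_shape lam mu \<Longrightarrow> finite (skew_boxes lam mu)"
  by (simp add: is_skew_shape_def skew_boxes_def finite_young_diagram)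

lemma finite_SVRPP_upto:
  assumes "is_skew_shape lam mu"
  shows "finite (SVRPP_upto n lam mu)"
proof -
  have "SVRPP_upto n lam mu \<subseteq>
      {T. \<forall>b. (b \<in> skew_boxes lam mu \<longrightarrow> T b \<in> Pow {1..n}) \<and> (b \<notin> skew_boxes lam mu \<longrightarrow> T b = {})}"
    by (auto simp: SVRPP_upto_def SVRPP_def)
  moreover have "finite \<dots>"
    by (rule finite_set_of_finite_funs) (use finite_skew_boxes[OF assms] in auto)
  ultimately show ?thesis by (rule finite_subset)
qed

lemma finite_SSYT_upto:
  assumes "is_partition \<nu>"
  shows "finite (SSYT_upto n \<nu>)"
proof -
  have "SSYT_upto n \<nu> \<subseteq>
      {S. \<forall>b. (b \<in> young_diagram \<nu> \<longrightarrow> S b \<in> {1..n}) \<and> (b \<notin> young_diagram \<nu> \<longrightarrow> S b = 0)}"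
    unfolding SSYT_upto_def by blast
  moreover have "finite \<dots>"
    by (rule finite_set_of_finite_funs) (use finite_young_diagram[OF assms] in auto)
  ultimately show ?thesis by (rule finite_subset)
qed

lemma finite_H_coeff_support:
  assumes "is_skew_shape lam mu"
  shows "finite {(\<nu>, \<gamma>, \<theta>). H_coeff lam mu n \<nu> \<gamma> \<theta> \<noteq> 0}"
proof -
  have "{(\<nu>, \<gamma>, \<theta>). H_coeff lam mu n \<nu> \<gamma> \<theta> \<noteq> 0} \<subseteq>
        (\<lambda>T. (ircont lam mu T, ceq lam mu T, ex lam mu T)) ` SVRPP_upto n lam mu"
    by (auto simp: H_coeff_def card_eq_0_iff image_iff)
  with finite_SVRPP_upto[OF assms] show ?thesis
    by (meson finite_imageI finite_subset)
qed

lemma weak_composition_ceq: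
  assumes "is_skew_shape lam mu"
  shows "weak_composition (ceq lam mu T)"
proof -
  have "{i. ceq lam mu T i \<noteq> 0} \<subseteq> fst ` skew_boxes lam mu"
  proof
    fix i assume "i \<in> {i. ceq lam mu T i \<noteq> 0}"
    then have "{j. (i, j) \<in> skew_boxes lam mu \<and> (i + 1, j) \<in> skew_boxes lam mu \<and>
                   Max (T (i, j)) = Min (T (i + 1, j))} \<noteq> {}"
      unfolding ceq_def by (metis (mono_tags, lifting) card.empty mem_Collect_eq)
    then show "i \<in> fst ` skew_boxes lam mu" by force
  qed
  then have "finite {i. ceq lam mu T i \<noteq> 0}"
    using finite_skew_boxes[OF assms] by (meson finite_imageI finite_subset)
  then show ?thesis
    by (simp add: weak_composition_def ceq_def skew_boxes_def young_diagram_def)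
qed

lemma weak_composition_ex:
  assumes "is_skew_shape lam mu"
  shows "weak_composition (ex lam mu T)"
proof -
  have "{i. ex lam mu T i \<noteq> 0} \<subseteq> fst ` skew_boxes lam mu"
  proof
    fix i assume "i \<in> {i. ex lam mu T i \<noteq> 0}"
    then have "{j. (i, j) \<in> skew_boxes lam mu} \<noteq> {}"
      unfolding ex_def by (metis (mono_tags, lifting) mem_Collect_eq sum.empty)
    then show "i \<in> fst ` skew_boxes lam mu" by force
  qed
  then have "finite {i. ex lam mu T i \<noteq> 0}"
    using finite_skew_boxes[OF assms] by (meson finite_imageI finite_subset)
  then show ?thesis
    by (simp add: weak_composition_def ex_def skew_boxes_def young_diagram_def)
qed

lemma ircont_nonzero_iff:
  assumes "is_skew_shape lam mu"
  shows "ircont lam mu T k \<noteq> 0 \<longleftrightarrow> (\<exists>b \<in> skew_boxes lam mu. k \<in> T b)"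
proof -
  have "{j. \<exists>i. (i, j) \<in> skew_boxes lam mu \<and> k \<in> T (i, j)} \<subseteq> snd ` skew_boxes lam mu"
    by force
  then have "finite {j. \<exists>i. (i, j) \<in> skew_boxes lam mu \<and> k \<in> T (i, j)}"
    using finite_skew_boxes[OF assms] by (meson finite_imageI finite_subset)
  then show ?thesis by (auto simp: ircont_def)
qed

lemma weak_composition_ircont:
  assumes "is_skew_shape lam mu" "T \<in> SVRPP lam mu"
  shows "weak_composition (ircont lam mu T)"
proof -
  have "{k. ircont lam mu T k \<noteq> 0} = (\<Union>b \<in> skew_boxes lam mu. T b)"
    using ircont_nonzero_iff[OF assms(1)] by auto
  moreover have "finite (\<Union>b \<in> skew_boxes lam mu. T b)"
    using assms finite_skew_boxes[OF assms(1)] by (auto simp: SVRPP_def)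
  moreover have "ircont lam mu T 0 = 0"
    using ircont_nonzero_iff[OF assms(1), of T 0] assms(2) by (force simp: SVRPP_def)
  ultimately show ?thesis by (simp add: weak_composition_def)
qed


section \<open>Truncation to finitely many variables\<close>

lemma var_power: "var v ^ e = Poly_Mapping.single (Poly_Mapping.single v e) 1"
  by (induction e) (simp_all add: var_def mult_single flip: single_add single_one)

lemma multi_power_eq_single:
  assumes "weak_composition \<alpha>"
  shows "multi_power Y \<alpha> =
         Poly_Mapping.single (\<Sum>k | \<alpha> k \<noteq> 0. Poly_Mapping.single (Y k) (\<alpha> k)) 1"
proof -
  have fin: "finite {k. \<alpha> k \<noteq> 0}" using assms by (simp add: weak_composition_def)
  have "multi_power Y \<alpha> = (\<Prod>k | \<alpha> k \<noteq> 0. var (Y k) ^ \<alpha> k)"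
    unfolding multi_power_def by (rule Prod_any.expand_superset[OF fin]) (auto intro: gr0I)
  also have "\<dots> = (\<Prod>k | \<alpha> k \<noteq> 0. Poly_Mapping.single (Poly_Mapping.single (Y k) (\<alpha> k)) 1)"
    by (simp add: var_power)
  also have "\<dots> = Poly_Mapping.single (\<Sum>k | \<alpha> k \<noteq> 0. Poly_Mapping.single (Y k) (\<alpha> k)) 1"
    using fin by (induction rule: finite_induct) (simp_all add: mult_single)
  finally show ?thesis .
qed

lemma lookup_exponent:
  assumes "weak_composition \<alpha>" "inj Y"
  shows "Poly_Mapping.lookup (\<Sum>k | \<alpha> k \<noteq> 0. Poly_Mapping.single (Y k) (\<alpha> k)) (Y l) = \<alpha> l"
proof -
  have fin: "finite {k. \<alpha> k \<noteq> 0}" using assms by (simp add: weak_composition_def)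
  have "Poly_Mapping.lookup (\<Sum>k | \<alpha> k \<noteq> 0. Poly_Mapping.single (Y k) (\<alpha> k)) (Y l) =
        (\<Sum>k | \<alpha> k \<noteq> 0. if k = l then \<alpha> k else 0)"
    using assms(2) by (simp add: lookup_sum lookup_single when_def inj_eq)
  also have "\<dots> = \<alpha> l" using fin by simp
  finally show ?thesis .
qed

lemma svrpp_weight_eq_single:
  assumes "is_skew_shape lam mu" "T \<in> SVRPP lam mu"
  obtains m where "svrpp_weight lam mu T = Poly_Mapping.single m 1"
    and "\<And>k. Poly_Mapping.lookup m (XVar k) = ircont lam mu T k"
    and "\<And>k. Poly_Mapping.lookup m (TVar k) = ceq lam mu T k"
    and "\<And>k. Poly_Mapping.lookup m (WVar k) = ex lam mu T k"
proof -
  let ?m = "\<lambda>Y (\<alpha> :: nat \<Rightarrow> nat). \<Sum>k | \<alpha> k \<noteq> 0. Poly_Mapping.single (Y k :: indet) (\<alpha> k)"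
  let ?M = "?m XVar (ircont lam mu T) + ?m TVar (ceq lam mu T) + ?m WVar (ex lam mu T)"
  note wc = weak_composition_ircont[OF assms] weak_composition_ceq[OF assms(1), of T]
    weak_composition_ex[OF assms(1), of T]
  have inj: "inj XVar" "inj TVar" "inj WVar" by (auto intro: injI)
  have "svrpp_weight lam mu T = Poly_Mapping.single ?M 1"
    unfolding svrpp_weight_def by (simp add: multi_power_eq_single wc mult_single)
  moreover have "Poly_Mapping.lookup ?M (XVar k) = ircont lam mu T k" for k
    using lookup_exponent[OF wc(1) inj(1), of k]
    by (simp add: lookup_add lookup_sum lookup_single when_def)
  moreover have "Poly_Mapping.lookup ?M (TVar k) = ceq lam mu T k" for k
    using lookup_exponent[OF wc(2) inj(2), of k]
    by (simp add: lookup_add lookup_sum lookup_single when_def)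
  moreover have "Poly_Mapping.lookup ?M (WVar k) = ex lam mu T k" for k
    using lookup_exponent[OF wc(3) inj(3), of k]
    by (simp add: lookup_add lookup_sum lookup_single when_def)
  ultimately show thesis by (rule that)
qed

lemma single_one_inject:
  fixes m m' :: monom
  assumes "Poly_Mapping.single m' (1::int) = Poly_Mapping.single m 1"
  shows "m' = m"
proof -
  have "Poly_Mapping.keys (Poly_Mapping.single m' (1::int)) =
        Poly_Mapping.keys (Poly_Mapping.single m (1::int))"
    using assms by (rule arg_cong)
  then show ?thesis by simp
qed

lemma lookup_hybrid_grothendieck:
  assumes "is_skew_shape lam mu"
  shows "Poly_Mapping.lookup (hybrid_grothendieck n lam mu) m =
    (if \<exists>k > n. Poly_Mapping.lookup m (XVar k) \<noteq> 0 then 0 else hybrid_grothendieck_series lam mu m)"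
proof -
  let ?A = "{T \<in> SVRPP_upto n lam mu. svrpp_weight lam mu T = Poly_Mapping.single m 1}"
  let ?B = "{T \<in> SVRPP lam mu. svrpp_weight lam mu T = Poly_Mapping.single m 1}"
  have upto: "T \<in> SVRPP_upto n lam mu \<longleftrightarrow> (\<forall>k > n. Poly_Mapping.lookup m (XVar k) = 0)" if "T \<in> ?B" for T
  proof -
    from that have T: "T \<in> SVRPP lam mu" and m: "svrpp_weight lam mu T = Poly_Mapping.single m 1"
      by auto
    obtain m' where m': "svrpp_weight lam mu T = Poly_Mapping.single m' 1"
        "\<And>k. Poly_Mapping.lookup m' (XVar k) = ircont lam mu T k"
      using svrpp_weight_eq_single[OF assms T] by metis
    from m m'(1) have "m' = m" by (metis single_one_inject)
    then have "(\<forall>k > n. Poly_Mapping.lookup m (XVar k) = 0) \<longleftrightarrow> (\<forall>k > n. ircont lam mu T k = 0)"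
      using m'(2) by simp
    also have "\<dots> \<longleftrightarrow> (\<forall>k > n. \<forall>b \<in> skew_boxes lam mu. k \<notin> T b)"
      using ircont_nonzero_iff[OF assms] by blast
    also have "\<dots> \<longleftrightarrow> T \<in> SVRPP_upto n lam mu"
      using T by (fastforce simp: SVRPP_upto_def SVRPP_def not_less[symmetric])
    finally show ?thesis by blast
  qed
  have "Poly_Mapping.lookup (svrpp_weight lam mu T) m = (if svrpp_weight lam mu T = Poly_Mapping.single m 1 then 1 else 0)"
    if "T \<in> SVRPP_upto n lam mu" for T
  proof -
    from that have "T \<in> SVRPP lam mu" by (simp add: SVRPP_upto_def)
    then obtain m' where "svrpp_weight lam mu T = Poly_Mapping.single m' 1"
      using svrpp_weight_eq_single[OF assms] by metis
    then show ?thesis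
      using single_one_inject[of m' m] by (auto simp: lookup_single when_def)
  qed
  then have "Poly_Mapping.lookup (hybrid_grothendieck n lam mu) m =
      (\<Sum>T \<in> SVRPP_upto n lam mu. if svrpp_weight lam mu T = Poly_Mapping.single m 1 then 1 else 0)"
    by (simp add: hybrid_grothendieck_def lookup_sum)
  also have "\<dots> = int (card ?A)"
    by (simp add: finite_SVRPP_upto[OF assms] sum.If_cases Int_def)
  also have "\<dots> = (if \<exists>k > n. Poly_Mapping.lookup m (XVar k) \<noteq> 0 then 0 else int (card ?B))"
  proof (cases "\<exists>k > n. Poly_Mapping.lookup m (XVar k) \<noteq> 0")
    case True
    with upto have "?A = {}" by (auto simp: SVRPP_upto_def)
    then have "card ?A = 0" by (simp only: card.empty)
    with True show ?thesis by simp
  next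
    case False
    with upto have "?A = ?B" by (auto simp: SVRPP_upto_def)
    with False show ?thesis by (simp only: if_False)
  qed
  finally show ?thesis unfolding hybrid_grothendieck_series_def .
qed

end

theory Submission
  imports Defs "HOL-Combinatorics.Permutations"
begin

text \<open>
  The fillings with given \<open>ceq\<close> and \<open>ex\<close> carry crystal operators: if the operator that turns
  the leftmost unmatched \<open>k + 1\<close> of a word into \<open>k\<close> applies to \<open>read(T)\<close>, there is exactly one
  \<open>T'\<close> with the transformed word that agrees with \<open>T\<close> outside the letters \<open>k\<close> and \<open>k + 1\<close> and
  has the same statistics, and conversely. It is obtained by moving the border between \<open>k\<close> and
  \<open>k + 1\<close> by one box in a run of consecutive rows. Hence the number of fillings with reading word
  \<open>w\<close> is constant along crystal edges.

  For functions on words that are constant along crystal edges, Stembridge's argument applies: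
  multiplying the generating function by the alternant \<open>\<Sum>\<^sub>\<sigma> sgn \<sigma> x\<^bsup>\<sigma> \<delta>\<^esup>\<close>, the words that are not
  reverse lattice words cancel in pairs, so the weight sums are determined by the values at reverse
  lattice words. Semistandard tableaux of shape \<open>\<nu>\<close> are the fillings of \<open>\<nu>\<close> with \<open>ceq = ex = 0\<close>,
  and only one of them, of weight \<open>\<nu>\<close>, has a reverse lattice reading word; comparing both sides
  gives the Schur expansion.
\<close>

section \<open>Crystal operators on words\<close>

text \<open>The obstacle is the omission rule of the reading word: a pivot is skipped when it
  repeats the maximum of the box above, so turning a \<open>k + 1\<close> into \<open>k\<close> in
  one box can make a skipped \<open>k + 1\<close> in the box below readable. Moving the border there
  as well hides a letter again; the run of rows ends where nothing is left to uncover. To find its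
  first row, heights of suffixes at row ends are corrected by the number of boxes of that row with
  \<open>k\<close> but not \<open>k + 1\<close>. This \<open>potential\<close> changes in a simple
  way from row to row, and its maximum is the maximal height of a suffix.

  On words, subtracting \<open>i\<close> from the number of letters \<open>i\<close> makes the
  cancellation exact: the tail that begins with a first violation has exactly one surplus
  \<open>k + 1\<close>, which the shift absorbs, so reflecting the rest exchanges two exponents.
  That the values at lattice words determine everything is then triangularity: the alternant has a
  leading term with coefficient 1, singled out by a strict rearrangement inequality.\<close>

definition hgt :: "nat \<Rightarrow> nat list \<Rightarrow> int" where
  "hgt k w = int (count_list w (Suc k)) - int (count_list w k)"

lemma hgt_simps [simp]:
  "hgt k [] = 0"
  "hgt k (c # w) = (if c = Suc k then 1 else if c = k then - 1 else 0) + hgt k w"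
  "hgt k (v @ w) = hgt k v + hgt k w"
  by (auto simp: hgt_def)

text \<open>Read \<open>k + 1\<close> as an opening and \<open>k\<close> as a closing bracket. Then
  every \<open>k + 1\<close> of \<open>u\<close> is matched inside \<open>u\<close>, and no
  \<open>k\<close> of \<open>v\<close> is unmatched in \<open>v\<close>: the leftmost unmatched
  \<open>k + 1\<close> becomes the rightmost unmatched \<open>k\<close>. The conditions mention only
  \<open>u\<close> and \<open>v\<close>, so they serve the operator and its inverse alike.\<close>

definition raises :: "nat \<Rightarrow> nat list \<Rightarrow> nat list \<Rightarrow> bool" where
  "raises k w w' \<longleftrightarrow> (\<exists>u v. w = u @ Suc k # v \<and> w' = u @ k # v \<and>
     (\<forall>x y. u = x @ y \<longrightarrow> hgt k y \<le> 0) \<and> (\<forall>x y. v = x @ y \<longrightarrow> 0 \<le> hgt k x))"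

text \<open>For the word \<open>x\<close> between two admissible occurrences of \<open>c\<close> the
  conditions give \<open>hgt k x = 0\<close>, and then \<open>c\<close> itself would have height 0,
  whereas it has height 1 or -1. Both values of \<open>c\<close> are covered: one yields uniqueness
  of the result, the other injectivity.\<close>

lemma raises_position_unique:
  assumes "u @ c # v = u' @ c # v'" and c: "c = k \<or> c = Suc k"
    and "\<And>x y. u = x @ y \<Longrightarrow> hgt k y \<le> 0" "\<And>x y. v = x @ y \<Longrightarrow> 0 \<le> hgt k x"
    and "\<And>x y. u' = x @ y \<Longrightarrow> hgt k y \<le> 0" "\<And>x y. v' = x @ y \<Longrightarrow> 0 \<le> hgt k x"
  shows "u = u' \<and> v = v'"
proof -
  have *: False
    if H: "u2 @ c # v2 = u1 @ c # v1" "length u1 < length u2"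
      "\<And>x y. u2 = x @ y \<Longrightarrow> hgt k y \<le> 0" "\<And>x y. v1 = x @ y \<Longrightarrow> 0 \<le> hgt k x"
      "\<And>x y. u1 = x @ y \<Longrightarrow> hgt k y \<le> 0" "\<And>x y. v2 = x @ y \<Longrightarrow> 0 \<le> hgt k x"
    for u1 u2 v1 v2
  proof -
    obtain x where x: "u2 = u1 @ c # x" "v1 = x @ c # v2"
      using H(1,2) by (auto simp: append_eq_append_conv2 append_eq_Cons_conv Cons_eq_append_conv)
    have "hgt k (c # x) \<le> 0" "0 \<le> hgt k x" "hgt k x \<le> 0" "0 \<le> hgt k (x @ [c])"
      using H(3)[of u1 "c # x"] H(3)[of "u1 @ [c]" x] H(4)[of x "c # v2"]
        H(4)[of "x @ [c]" v2] x by simp_all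
    then show False using c by auto
  qed
  have "length u = length u'"
  proof (rule linorder_cases[of "length u" "length u'"])
    assume "length u < length u'"
    from *[OF assms(1)[symmetric] this assms(5,4,3,6)] show ?thesis ..
  next
    assume "length u' < length u"
    from *[OF assms(1) this assms(3,6,5,4)] show ?thesis ..
  qed
  then show ?thesis using assms(1) by simp
qed

lemma raisesE:
  assumes "raises k w w'"
  obtains u v where "w = u @ Suc k # v" "w' = u @ k # v"
    "\<And>x y. u = x @ y \<Longrightarrow> hgt k y \<le> 0" "\<And>x y. v = x @ y \<Longrightarrow> 0 \<le> hgt k x"
  using assms unfolding raises_def by blast

lemma raises_unique:
  assumes "raises k w w1" "raises k w w2"
  shows "w1 = w2"
proof -
  obtain u v where uv: "w = u @ Suc k # v" "w1 = u @ k # v"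
    "\<And>x y. u = x @ y \<Longrightarrow> hgt k y \<le> 0" "\<And>x y. v = x @ y \<Longrightarrow> 0 \<le> hgt k x"
    using raisesE[OF assms(1)] by metis
  obtain u' v' where uv': "w = u' @ Suc k # v'" "w2 = u' @ k # v'"
    "\<And>x y. u' = x @ y \<Longrightarrow> hgt k y \<le> 0" "\<And>x y. v' = x @ y \<Longrightarrow> 0 \<le> hgt k x"
    using raisesE[OF assms(2)] by metis
  have "u = u' \<and> v = v'"
    by (rule raises_position_unique[where c = "Suc k", OF _ _ uv(3,4) uv'(3,4)]) (use uv uv' in simp_all)
  then show ?thesis using uv uv' by simp
qed

lemma raises_inj:
  assumes "raises k w1 w" "raises k w2 w"
  shows "w1 = w2"
proof -
  obtain u v where uv: "w1 = u @ Suc k # v" "w = u @ k # v"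
    "\<And>x y. u = x @ y \<Longrightarrow> hgt k y \<le> 0" "\<And>x y. v = x @ y \<Longrightarrow> 0 \<le> hgt k x"
    using raisesE[OF assms(1)] by metis
  obtain u' v' where uv': "w2 = u' @ Suc k # v'" "w = u' @ k # v'"
    "\<And>x y. u' = x @ y \<Longrightarrow> hgt k y \<le> 0" "\<And>x y. v' = x @ y \<Longrightarrow> 0 \<le> hgt k x"
    using raisesE[OF assms(2)] by metis
  have "u = u' \<and> v = v'"
    by (rule raises_position_unique[where c = k, OF _ _ uv(3,4) uv'(3,4)]) (use uv uv' in simp_all)
  then show ?thesis using uv uv' by simp
qed

lemma raises_hgt: "raises k w w' \<Longrightarrow> hgt k w' = hgt k w - 2"
  by (auto simp: raises_def)

text \<open>No \<open>k\<close> of \<open>z\<close> is unmatched within \<open>z\<close>, so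
  \<open>z\<close> cannot bind a \<open>k + 1\<close> of \<open>w\<close>.\<close>

lemma raises_append:
  assumes "raises k w w'" "\<And>x y. z = x @ y \<Longrightarrow> 0 \<le> hgt k x"
  shows "raises k (w @ z) (w' @ z)"
proof -
  obtain u v where uv: "w = u @ Suc k # v" "w' = u @ k # v"
     "\<forall>x y. u = x @ y \<longrightarrow> hgt k y \<le> 0" "\<forall>x y. v = x @ y \<longrightarrow> 0 \<le> hgt k x"
    using assms(1) unfolding raises_def by metis
  have "0 \<le> hgt k x" if eq: "v @ z = x @ y" for x y
  proof -
    from eq consider c where "v = x @ c" | c where "x = v @ c" "z = c @ y"
      by (auto simp: append_eq_append_conv2)
    then show ?thesis
    proof cases
      case 1 then show ?thesis using uv(4) by blast
    next
      case 2
      then show ?thesis using uv(4)[rule_format, of v "[]"] assms(2)[of c y] by simp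
    qed
  qed
  then show ?thesis using uv unfolding raises_def
    by (intro exI[of _ u] exI[of _ "v @ z"]) auto
qed

text \<open>Among all suffixes, the one starting at the changed letter is highest. Lower bounds for
  the height of an arbitrary suffix thus pass to \<open>v\<close>, which drives the induction on the
  number of steps.\<close>

lemma raises_suffix_hgt_le:
  assumes "u @ Suc k # v = x @ y"
    "\<And>x y. u = x @ y \<Longrightarrow> hgt k y \<le> 0" "\<And>x y. v = x @ y \<Longrightarrow> 0 \<le> hgt k x"
  shows "hgt k y \<le> hgt k v + 1"
proof -
  from assms(1) consider c where "u = x @ c" "y = c @ Suc k # v" | c where "v = c @ y"
    by (auto simp: append_eq_append_conv2 Cons_eq_append_conv append_eq_Cons_conv)
  then show ?thesis
  proof cases
    case 1 then show ?thesis using assms(2)[of x c] by simp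
  next
    case 2 then show ?thesis using assms(3)[of c y] by simp
  qed
qed

lemma raises_prefix_hgt_ge:
  assumes "u @ k # v = x @ y"
    "\<And>x y. u = x @ y \<Longrightarrow> hgt k y \<le> 0" "\<And>x y. v = x @ y \<Longrightarrow> 0 \<le> hgt k x"
  shows "hgt k u - 1 \<le> hgt k x"
proof -
  from assms(1) consider c where "u = x @ c" | c where "x = u @ k # c" "v = c @ y"
    by (auto simp: append_eq_append_conv2 Cons_eq_append_conv append_eq_Cons_conv)
  then show ?thesis
  proof cases
    case 1 then show ?thesis using assms(2)[of x c] by simp
  next
    case 2 then show ?thesis using assms(3)[of c y] by simp
  qed
qed

lemma raises_exists:
  assumes "w = a @ b" "0 < hgt k b"
  obtains u v where "w = u @ Suc k # v"
    "\<And>x y. u = x @ y \<Longrightarrow> hgt k y \<le> 0" "\<And>x y. v = x @ y \<Longrightarrow> 0 \<le> hgt k x"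
proof -
  let ?h = "\<lambda>i. hgt k (drop i w)"
  define M where "M = Max (?h ` {..length w})"
  have le: "?h i \<le> M" if "i \<le> length w" for i unfolding M_def using that by (intro Max_ge) auto
  have le': "hgt k y \<le> M" if "w = x @ y" for x y
    using le[of "length x"] that by simp
  \<comment> \<open>The shortest suffix of maximal height: dropping its first letter lowers the
    height, so this letter is \<open>k + 1\<close>.\<close>
  define i where "i = Max {i. i \<le> length w \<and> ?h i = M}"
  have "M \<in> ?h ` {..length w}" unfolding M_def by (rule Max_in) auto
  then have ne: "{i. i \<le> length w \<and> ?h i = M} \<noteq> {}" by auto
  then have i: "i \<le> length w" "?h i = M"
    using Max_in[of "{i. i \<le> length w \<and> ?h i = M}"] by (auto simp: i_def)
  have lt: "?h j < M" if "i < j" "j \<le> length w" for j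
  proof -
    have "j \<le> i" if "?h j = M"
      unfolding i_def using that \<open>j \<le> length w\<close> by (intro Max_ge) auto
    with le[of j] that show ?thesis by force
  qed
  have "0 < M" using le'[OF assms(1)] assms(2) by simp
  then have il: "i < length w" using i by (cases "i = length w") auto
  define u c v where "u = take i w" "c = w ! i" "v = drop (Suc i) w"
  have w: "w = u @ c # v" unfolding u_c_v_def using il by (simp add: id_take_nth_drop)
  have di: "drop i w = c # v" unfolding u_c_v_def using il by (simp add: Cons_nth_drop_Suc)
  have hv: "hgt k v < M" using lt[of "Suc i"] il unfolding u_c_v_def by simp
  have c: "c = Suc k" "hgt k v = M - 1"
    using hv i(2) unfolding di by (auto split: if_splits)
  show thesis
  proof (rule that)
    show "w = u @ Suc k # v" using w c by simp
    fix x y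
    show "hgt k y \<le> 0" if "u = x @ y"
      using le'[of x "y @ c # v"] w c that by simp
    show "0 \<le> hgt k x" if "v = x @ y"
    proof -
      have "drop (Suc (i + length x)) w = y"
        using that unfolding u_c_v_def
        by (metis add_Suc append_eq_conv_conj drop_drop add.commute)
      moreover have "Suc (i + length x) \<le> length w"
        using il arg_cong[OF that, of length] unfolding u_c_v_def by simp
      ultimately have "hgt k y < M" using lt[of "Suc (i + length x)"] by simp
      then show ?thesis using c that by simp
    qed
  qed
qed

lemma lowers_exists:
  assumes "w = a @ b" "hgt k a < 0"
  obtains u v where "w = u @ k # v"
    "\<And>x y. u = x @ y \<Longrightarrow> hgt k y \<le> 0" "\<And>x y. v = x @ y \<Longrightarrow> 0 \<le> hgt k x"
proof -
  let ?h = "\<lambda>i. hgt k (drop i w)"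
  define M where "M = Max (?h ` {..length w})"
  have le: "?h i \<le> M" if "i \<le> length w" for i unfolding M_def using that by (intro Max_ge) auto
  have le': "hgt k y \<le> M" if "w = x @ y" for x y
    using le[of "length x"] that by simp
  \<comment> \<open>The longest suffix of maximal height: the letter in front of it lowers the
    height, so this letter is \<open>k\<close>.\<close>
  define i where "i = (LEAST i. i \<le> length w \<and> ?h i = M)"
  have "M \<in> ?h ` {..length w}" unfolding M_def by (rule Max_in) auto
  then have ex: "\<exists>i. i \<le> length w \<and> ?h i = M" by auto
  then have i: "i \<le> length w" "?h i = M"
    using LeastI_ex[OF ex] by (auto simp: i_def)
  have lt: "?h j < M" if "j < i" for j
    using not_less_Least[of j "\<lambda>i. i \<le> length w \<and> ?h i = M"] that le[of j] i(1)
    by (force simp: i_def)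
  have "hgt k w < M" using le'[OF assms(1)] assms by simp
  then have i0: "0 < i" using i by (cases i) auto
  define u c v where "u = take (i - 1) w" "c = w ! (i - 1)" "v = drop i w"
  have w: "w = u @ c # v" unfolding u_c_v_def using i0 i(1)
    by (metis Suc_diff_1 Suc_le_lessD id_take_nth_drop)
  have di: "drop (i - 1) w = c # v" unfolding u_c_v_def using i0 i(1)
    by (metis Cons_nth_drop_Suc Suc_diff_1 Suc_le_lessD)
  have hv: "hgt k v = M" using i(2) unfolding u_c_v_def by simp
  have "hgt k (c # v) < M" using lt[of "i - 1"] i0 unfolding di by simp
  then have c: "c = k" using hv by (auto split: if_splits)
  show thesis
  proof (rule that)
    show "w = u @ k # v" using w c by simp
    fix x y
    show "0 \<le> hgt k x" if "v = x @ y"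
      using le'[of "u @ c # x" y] w that hv by simp
    show "hgt k y \<le> 0" if "u = x @ y"
    proof -
      have "drop (length x) w = y @ c # v" using that w by simp
      moreover have "length x < i"
        using i0 i(1) arg_cong[OF that, of length] unfolding u_c_v_def by simp
      ultimately have "hgt k (y @ c # v) < M" using lt[of "length x"] by simp
      then show ?thesis using c hv by simp
    qed
  qed
qed

text \<open>Each step uses up one unit: after the change at \<open>u @ Suc k # v\<close>, the suffix
  \<open>v\<close> still has height at least \<open>hgt k b - 1\<close>.\<close>

lemma raises_power_exists:
  assumes "w = a @ b" "int d \<le> hgt k b"
  shows "\<exists>w'. (raises k ^^ d) w w'"
  using assms
proof (induction d arbitrary: w a b)
  case 0 then show ?case by auto
next
  case (Suc d)
  obtain u v where uv: "w = u @ Suc k # v"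
    "\<And>x y. u = x @ y \<Longrightarrow> hgt k y \<le> 0" "\<And>x y. v = x @ y \<Longrightarrow> 0 \<le> hgt k x"
  proof -
    have "0 < hgt k b" using Suc.prems by simp
    then show ?thesis using that raises_exists[OF Suc.prems(1)] by metis
  qed
  have "hgt k b \<le> hgt k v + 1"
    by (rule raises_suffix_hgt_le[of u k v a b]) (use uv Suc.prems in simp_all)
  then have "\<exists>w'. (raises k ^^ d) (u @ k # v) w'"
    using Suc.prems by (intro Suc.IH[of _ "u @ [k]" v]) auto
  moreover have "raises k w (u @ k # v)" unfolding raises_def using uv by blast
  ultimately show ?case by (metis relpowp_Suc_I2)
qed

lemma lowers_power_exists:
  assumes "w = a @ b" "hgt k a \<le> - int d"
  shows "\<exists>w'. (raises k ^^ d) w' w"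
  using assms
proof (induction d arbitrary: w a b)
  case 0 then show ?case by auto
next
  case (Suc d)
  obtain u v where uv: "w = u @ k # v"
    "\<And>x y. u = x @ y \<Longrightarrow> hgt k y \<le> 0" "\<And>x y. v = x @ y \<Longrightarrow> 0 \<le> hgt k x"
  proof -
    have "hgt k a < 0" using Suc.prems by simp
    then show ?thesis using that lowers_exists[OF Suc.prems(1)] by metis
  qed
  have "hgt k u - 1 \<le> hgt k a"
    by (rule raises_prefix_hgt_ge[of u k v a b]) (use uv Suc.prems in simp_all)
  then have "\<exists>w'. (raises k ^^ d) w' (u @ Suc k # v)"
    using Suc.prems by (intro Suc.IH[of _ "u" "Suc k # v"]) auto
  moreover have "raises k (u @ Suc k # v) w" unfolding raises_def using uv by blast
  ultimately show ?case by (metis relpowp_Suc_I)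
qed

section \<open>Strings of crystal edges and their reversal\<close>

lemma raises_power_unique:
  "(raises k ^^ d) w w1 \<Longrightarrow> (raises k ^^ d) w w2 \<Longrightarrow> w1 = w2"
proof (induction d arbitrary: w1 w2)
  case (Suc d)
  then show ?case by (metis relpowp_Suc_E raises_unique)
qed simp

lemma raises_power_inj:
  "(raises k ^^ d) w1 w \<Longrightarrow> (raises k ^^ d) w2 w \<Longrightarrow> w1 = w2"
proof (induction d arbitrary: w)
  case (Suc d)
  then show ?case by (metis relpowp_Suc_E raises_inj)
qed simp

lemma raises_power_hgt: "(raises k ^^ d) w w' \<Longrightarrow> hgt k w' = hgt k w - 2 * int d"
proof (induction d arbitrary: w')
  case (Suc d)
  from Suc.prems obtain y where "(raises k ^^ d) w y" "raises k y w'" by (rule relpowp_Suc_E)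
  with Suc.IH show ?case by (simp add: raises_hgt)
qed simp

lemma raises_count:
  assumes "raises k w w'"
  shows "count_list w' k + count_list w' (Suc k) = count_list w k + count_list w (Suc k)"
    "c \<noteq> k \<Longrightarrow> c \<noteq> Suc k \<Longrightarrow> count_list w' c = count_list w c"
  using assms by (auto simp: raises_def)

lemma raises_power_count:
  assumes "(raises k ^^ d) w w'"
  shows "count_list w' k + count_list w' (Suc k) = count_list w k + count_list w (Suc k) \<and>
    (\<forall>c. c \<noteq> k \<longrightarrow> c \<noteq> Suc k \<longrightarrow> count_list w' c = count_list w c)"
  using assms
proof (induction d arbitrary: w')
  case (Suc d)
  from Suc.prems obtain y where "(raises k ^^ d) w y" "raises k y w'" by (rule relpowp_Suc_E)
  with Suc.IH show ?case by (simp add: raises_count)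
qed simp

lemma raises_power_append:
  assumes "(raises k ^^ d) w w'" "\<And>x y. z = x @ y \<Longrightarrow> 0 \<le> hgt k x"
  shows "(raises k ^^ d) (w @ z) (w' @ z)"
  using assms(1)
proof (induction d arbitrary: w')
  case (Suc d)
  from Suc.prems obtain y where "(raises k ^^ d) w y" "raises k y w'" by (rule relpowp_Suc_E)
  from relpowp_Suc_I[OF Suc.IH[OF this(1)] raises_append[OF this(2) assms(2)]] show ?case .
qed simp

text \<open>A step lowers \<open>hgt\<close> by 2, so as many steps as the absolute value of the
  height lead to the opposite height. At height 0 both clauses hold and leave the word
  unchanged.\<close>

definition reflects :: "nat \<Rightarrow> nat list \<Rightarrow> nat list \<Rightarrow> bool" where
  "reflects k w w' \<longleftrightarrow>
     (raises k ^^ nat (hgt k w)) w w' \<and> 0 \<le> hgt k w \<or> (raises k ^^ nat (- hgt k w)) w' w \<and> hgt k w \<le> 0"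

lemma reflects_sym:
  assumes "reflects k w w'"
  shows "reflects k w' w"
proof -
  have "hgt k w' = - hgt k w"
    using assms unfolding reflects_def by (auto dest: raises_power_hgt)
  then show ?thesis using assms unfolding reflects_def by auto
qed

lemma reflects_unique: "reflects k w w1 \<Longrightarrow> reflects k w w2 \<Longrightarrow> w1 = w2"
  unfolding reflects_def
  by (cases "hgt k w = 0") (auto dest: raises_power_unique raises_power_inj)

lemma reflects_total: "\<exists>w'. reflects k w w'"
proof (cases "0 \<le> hgt k w")
  case True
  then show ?thesis unfolding reflects_def
    using raises_power_exists[of w "[]" w "nat (hgt k w)" k] by auto
next
  case False
  then show ?thesis unfolding reflects_def
    using lowers_power_exists[of w w "[]" k "nat (- hgt k w)"] by auto
qed

definition reflect :: "nat \<Rightarrow> nat list \<Rightarrow> nat list" where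
  "reflect k w = (THE w'. reflects k w w')"

lemma reflects_reflect: "reflects k w (reflect k w)"
proof -
  obtain w' where "reflects k w w'" using reflects_total by blast
  from this reflects_unique[OF _ this] show ?thesis unfolding reflect_def by (rule theI)
qed

lemma reflect_reflect [simp]: "reflect k (reflect k w) = w"
  by (rule reflects_unique[OF reflects_reflect reflects_sym[OF reflects_reflect]])

lemma count_reflect: "count_list (reflect k w) (transpose k (Suc k) c) = count_list w c"
proof -
  have "hgt k (reflect k w) = - hgt k w"
    using reflects_reflect[of k w] unfolding reflects_def by (auto dest: raises_power_hgt)
  moreover have "count_list (reflect k w) k + count_list (reflect k w) (Suc k) =
      count_list w k + count_list w (Suc k) \<and>
      (\<forall>c. c \<noteq> k \<longrightarrow> c \<noteq> Suc k \<longrightarrow> count_list (reflect k w) c = count_list w c)"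
    using reflects_reflect[of k w] unfolding reflects_def by (auto dest: raises_power_count)
  ultimately show ?thesis
    by (cases "c = k"; cases "c = Suc k") (auto simp: hgt_def transpose_def)
qed

text \<open>By the condition on \<open>z\<close>, each step on the left part is also a step on the
  whole word. This permits reflecting only what precedes a lattice violation.\<close>

lemma reflect_invariant:
  assumes inv: "\<And>w w'. raises k w w' \<Longrightarrow> N w = (N w' :: 'a)"
    and z: "\<And>x y. z = x @ y \<Longrightarrow> 0 \<le> hgt k x"
  shows "N (reflect k w @ z) = N (w @ z)"
proof -
  have pow: "N w = N w'" if "(raises k ^^ d) w w'" for d w w'
    using that
  proof (induction d arbitrary: w')
    case (Suc d)
    from Suc.prems obtain y where "(raises k ^^ d) w y" "raises k y w'" by (rule relpowp_Suc_E)
    with Suc.IH show ?case by (simp add: inv)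
  qed simp
  have app: "N (w @ z) = N (w' @ z)" if "(raises k ^^ d) w w'" for d w w'
    by (rule pow[OF raises_power_append[OF that z]])
  show ?thesis
    using reflects_reflect[of k w] unfolding reflects_def by (auto dest: app)
qed

section \<open>Cancellation of words violating the lattice condition\<close>

lemma reverse_lattice_word_iff:
  "reverse_lattice_word u \<longleftrightarrow> (\<forall>k\<ge>1. \<forall>x y. u = x @ y \<longrightarrow> hgt k y \<le> 0)"
proof
  assume L: "reverse_lattice_word u"
  show "\<forall>k\<ge>1. \<forall>x y. u = x @ y \<longrightarrow> hgt k y \<le> 0"
  proof (intro allI impI)
    fix k :: nat and x y assume "1 \<le> k" "u = x @ y"
    with L[unfolded reverse_lattice_word_def, rule_format, of k "Suc k" "length x"]
    show "hgt k y \<le> 0" by (simp add: hgt_def)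
  qed
next
  assume R: "\<forall>k\<ge>1. \<forall>x y. u = x @ y \<longrightarrow> hgt k y \<le> 0"
  show "reverse_lattice_word u"
    unfolding reverse_lattice_word_def
  proof (intro allI impI)
    fix i a b :: nat assume ab: "1 \<le> a \<and> a < b"
    have step: "count_list (drop i u) (Suc c) \<le> count_list (drop i u) c" if "1 \<le> c" for c
      using R[rule_format, OF that, of "take i u" "drop i u"] by (simp add: hgt_def)
    have "count_list (drop i u) (a + d) \<le> count_list (drop i u) a" for d
    proof (induction d)
      case (Suc d)
      have "count_list (drop i u) (a + Suc d) \<le> count_list (drop i u) (a + d)"
        using step[of "a + d"] ab by simp
      with Suc show ?case by linarith
    qed simp
    from this[of "b - a"] ab show "count_list (drop i u) b \<le> count_list (drop i u) a" by simp
  qed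
qed

lemma reverse_lattice_word_suffix: "reverse_lattice_word (x @ y) \<Longrightarrow> reverse_lattice_word y"
  unfolding reverse_lattice_word_iff by (metis append_assoc)

text \<open>All suffixes of \<open>v\<close> satisfy the condition, and one letter raises a height
  by at most 1; so the height of \<open>v\<close> is exactly 0. The cancellation rests on this
  equality.\<close>

lemma first_violation:
  assumes "reverse_lattice_word v" "\<not> reverse_lattice_word (c # v)"
  obtains k where "1 \<le> k" "c = Suc k" "hgt k v = 0"
proof -
  obtain k x y where k: "1 \<le> k" "c # v = x @ y" "0 < hgt k y"
    using assms(2) unfolding reverse_lattice_word_iff by (auto simp: not_le)
  have v: "hgt k y \<le> 0" if "v = x @ y" for x y
    using assms(1) k(1) that unfolding reverse_lattice_word_iff by blast
  from k(2,3) v have "y = c # v" by (cases x) force+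
  with k v[of "[]" v] show thesis by (intro that[of k]) (auto split: if_splits)
qed

lemma not_reverse_lattice_word_split:
  assumes "\<not> reverse_lattice_word w"
  obtains y k v where "1 \<le> k" "w = y @ Suc k # v" "reverse_lattice_word v"
    "\<not> reverse_lattice_word (Suc k # v)"
proof -
  have "\<exists>y k v. 1 \<le> k \<and> w = y @ Suc k # v \<and> reverse_lattice_word v \<and>
    \<not> reverse_lattice_word (Suc k # v)"
    using assms
  proof (induction w)
    case Nil
    then show ?case by (simp add: reverse_lattice_word_iff)
  next
    case (Cons c w)
    show ?case
    proof (cases "reverse_lattice_word w")
      case True
      with Cons.prems obtain k where "1 \<le> k" "c = Suc k" by (metis first_violation)
      with True Cons.prems show ?thesis by (intro exI[of _ "[]"] exI[of _ k] exI[of _ w]) simp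
    next
      case False
      with Cons.IH obtain y k v where "1 \<le> k" "w = y @ Suc k # v" "reverse_lattice_word v"
        "\<not> reverse_lattice_word (Suc k # v)" by blast
      then show ?thesis by (intro exI[of _ "c # y"] exI[of _ k] exI[of _ v]) simp
    qed
  qed
  then show thesis using that by blast
qed

lemma not_reverse_lattice_word_split_unique:
  assumes "y @ c # v = y' @ c' # v'" "reverse_lattice_word v" "\<not> reverse_lattice_word (c # v)"
    "reverse_lattice_word v'" "\<not> reverse_lattice_word (c' # v')"
  shows "y = y' \<and> c = c' \<and> v = v'"
proof -
  have *: "\<not> length v < length v'"
    if H: "y @ c # v = y' @ c' # v'" "\<not> reverse_lattice_word (c # v)" "reverse_lattice_word v'"
    for y y' v v' and c c' :: nat
  proof
    assume "length v < length v'"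
    then obtain z where "v' = z @ c # v"
      using H(1) by (auto simp: append_eq_append_conv2 Cons_eq_append_conv append_eq_Cons_conv)
    then show False using H(2,3) reverse_lattice_word_suffix by blast
  qed
  have "length v = length v'"
    using *[OF assms(1,3,4)] *[OF assms(1)[symmetric] assms(5,2)] by linarith
  then have "length (c # v) = length (c' # v')" by simp
  with assms(1) have "y = y' \<and> c # v = c' # v'" by (metis append_eq_append_conv)
  then show ?thesis by simp
qed

abbreviation "lattice \<equiv> reverse_lattice_word"

text \<open>
  Cut a word at the first violation of the lattice condition met when reading from the right,
  say by an excess of \<open>k + 1\<close> over \<open>k\<close>, and reflect what lies to the left of it.
\<close>

definition toggle :: "nat list \<Rightarrow> nat list" where
  "toggle w = (THE z. \<exists>y k v. 1 \<le> k \<and> w = y @ Suc k # v \<and> lattice v \<and>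
     \<not> lattice (Suc k # v) \<and> z = reflect k y @ Suc k # v)"

lemma toggle_eq:
  assumes "1 \<le> k" "lattice v" "\<not> lattice (Suc k # v)"
  shows "toggle (y @ Suc k # v) = reflect k y @ Suc k # v"
  unfolding toggle_def
proof (rule the_equality)
  show "\<exists>y' k' v'. 1 \<le> k' \<and> y @ Suc k # v = y' @ Suc k' # v' \<and> lattice v' \<and>
    \<not> lattice (Suc k' # v') \<and> reflect k y @ Suc k # v = reflect k' y' @ Suc k' # v'"
    using assms by blast
next
  fix z
  assume "\<exists>y' k' v'. 1 \<le> k' \<and> y @ Suc k # v = y' @ Suc k' # v' \<and> lattice v' \<and>
    \<not> lattice (Suc k' # v') \<and> z = reflect k' y' @ Suc k' # v'"
  then show "z = reflect k y @ Suc k # v"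
  proof (elim exE conjE)
    fix y' k' v'
    assume *: "y @ Suc k # v = y' @ Suc k' # v'" "lattice v'"
      "\<not> lattice (Suc k' # v')" and z: "z = reflect k' y' @ Suc k' # v'"
    from not_reverse_lattice_word_split_unique[OF *(1) assms(2,3) *(2,3)] z show ?thesis by simp
  qed
qed

lemma toggle_toggle:
  assumes "\<not> lattice w"
  shows "toggle (toggle w) = w"
  by (rule not_reverse_lattice_word_split[OF assms]) (simp add: toggle_eq)

lemma not_reverse_lattice_word_toggle:
  assumes "\<not> lattice w"
  shows "\<not> lattice (toggle w)"
proof (rule not_reverse_lattice_word_split[OF assms])
  fix y k v
  assume "1 \<le> k" "w = y @ Suc k # v" "lattice v" "\<not> lattice (Suc k # v)"
  then show ?thesis using reverse_lattice_word_suffix by (auto simp: toggle_eq)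
qed

text \<open>Values are integers because the results are applied to a difference of fiber
  counts.\<close>

locale crystal_invariant =
  fixes n :: nat and N :: "nat list \<Rightarrow> int"
  assumes finite_support: "finite {w. N w \<noteq> 0}"
    and letters: "N w \<noteq> 0 \<Longrightarrow> set w \<subseteq> {1..n}"
    and invariant: "1 \<le> k \<Longrightarrow> Suc k \<le> n \<Longrightarrow> raises k w w' \<Longrightarrow> N w = N w'"
begin

text \<open>Integer exponents allow shifts by permutations that leave the nonnegative range; such a
  sum is empty.\<close>

definition weight_sum :: "(nat \<Rightarrow> int) \<Rightarrow> int" where
  "weight_sum \<beta> = (\<Sum>w | N w \<noteq> 0 \<and> (\<forall>i\<in>{1..n}. int (count_list w i) = \<beta> i). N w)"

lemma weight_sum_cong: "(\<And>i. i \<in> {1..n} \<Longrightarrow> \<beta> i = \<beta>' i) \<Longrightarrow> weight_sum \<beta> = weight_sum \<beta>'"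
  unfolding weight_sum_def by (metis (no_types, lifting))

section \<open>Symmetry of the weight sums\<close>

lemma weight_sum_adjacent:
  assumes "1 \<le> k" "Suc k \<le> n"
  shows "weight_sum (\<beta> \<circ> transpose k (Suc k)) = weight_sum \<beta>"
proof -
  let ?t = "transpose k (Suc k)"
  have N: "N (reflect k w) = N w" for w
    using reflect_invariant[of k N "[]" w, OF invariant[OF assms]] by simp
  have c: "count_list (reflect k w) i = count_list w (?t i)" for w i
    using count_reflect[of k w "?t i"] by simp
  have t: "?t i \<in> {1..n} \<longleftrightarrow> i \<in> {1..n}" for i
    using assms by (auto simp: transpose_def)
  have tt: "(\<forall>i\<in>{1..n}. P (?t i)) \<longleftrightarrow> (\<forall>i\<in>{1..n}. P i)" for P
    using t by (metis transpose_involutory)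
  show ?thesis
    unfolding weight_sum_def
  proof (rule sum.reindex_bij_witness[of _ "reflect k" "reflect k"])
    fix w assume w: "w \<in> {w. N w \<noteq> 0 \<and> (\<forall>i\<in>{1..n}. int (count_list w i) = (\<beta> \<circ> ?t) i)}"
    have "\<forall>i\<in>{1..n}. int (count_list w (?t i)) = (\<beta> \<circ> ?t) (?t i)"
      using w by (subst tt) simp
    then show "reflect k w \<in> {w. N w \<noteq> 0 \<and> (\<forall>i\<in>{1..n}. int (count_list w i) = \<beta> i)}"
      using w by (simp add: N c)
  next
    fix w assume w: "w \<in> {w. N w \<noteq> 0 \<and> (\<forall>i\<in>{1..n}. int (count_list w i) = \<beta> i)}"
    have "\<forall>i\<in>{1..n}. int (count_list w (?t i)) = \<beta> (?t i)"
      using w by (subst tt) simp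
    then show "reflect k w \<in> {w. N w \<noteq> 0 \<and> (\<forall>i\<in>{1..n}. int (count_list w i) = (\<beta> \<circ> ?t) i)}"
      using w by (simp add: N c)
  qed (simp_all add: N)
qed

text \<open>A transposition at distance \<open>d + 1\<close> is one at distance \<open>d\<close>
  conjugated by an adjacent transposition.\<close>

lemma weight_sum_transpose:
  assumes "1 \<le> a" "a + d \<le> n"
  shows "weight_sum (\<beta> \<circ> transpose a (a + d)) = weight_sum \<beta>"
  using assms(2)
proof (induction d arbitrary: \<beta>)
  case (Suc d)
  show ?case
  proof (cases "d = 0")
    case True
    then show ?thesis using weight_sum_adjacent[of a \<beta>] assms(1) Suc.prems by (simp add: comp_def)
  next
    case False
    let ?s = "transpose (Suc (a + d)) (a + d)" and ?u = "transpose (a + d) a"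
    have adj: "weight_sum (\<beta> \<circ> ?s) = weight_sum \<beta>" for \<beta>
      using weight_sum_adjacent[of "a + d" \<beta>] assms(1) Suc.prems
      by (simp add: transpose_commute[of "Suc (a + d)"])
    have IH: "weight_sum (\<beta> \<circ> ?u) = weight_sum \<beta>" for \<beta>
      using Suc.IH[of \<beta>] Suc.prems by (simp add: transpose_commute[of "a + d" a] comp_def)
    have "transpose a (a + Suc d) = ?s \<circ> ?u \<circ> ?s"
      using False transpose_comp_triple[of "Suc (a + d)" a "a + d"] by (simp add: transpose_commute)
    then have "\<beta> \<circ> transpose a (a + Suc d) = ((\<beta> \<circ> ?s) \<circ> ?u) \<circ> ?s" by (simp add: comp_assoc)
    then show ?thesis by (simp only: adj IH)
  qed
qed simp

lemma weight_sum_permutes: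
  assumes "\<sigma> permutes {1..n}"
  shows "weight_sum (\<beta> \<circ> \<sigma>) = weight_sum \<beta>"
  using assms finite_atLeastAtMost
proof (induction arbitrary: \<beta> rule: permutes_induct)
  case (swap a b p)
  have tr: "weight_sum (\<beta> \<circ> transpose a b) = weight_sum \<beta>" for \<beta>
  proof (cases "a \<le> b")
    case True
    then show ?thesis using weight_sum_transpose[of a "b - a" \<beta>] swap by simp
  next
    case False
    then show ?thesis using weight_sum_transpose[of b "a - b" \<beta>] swap
      by (simp add: transpose_commute)
  qed
  have "\<beta> \<circ> (transpose a b \<circ> p) = (\<beta> \<circ> transpose a b) \<circ> p" by (simp add: comp_assoc)
  then show ?case using swap by (simp only: tr)
qed simp

text \<open>
  The coefficient of \<open>x\<^bsup>\<beta>\<^esup>\<close> in \<open>\<Sum>\<^sub>\<sigma> sgn \<sigma> x\<^bsup>\<sigma> (c + \<delta>)\<^esup>\<close> for \<open>\<delta> = (-1, \<dots>, -n)\<close>.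
\<close>

definition alternant :: "(nat \<Rightarrow> int) \<Rightarrow> (nat \<Rightarrow> nat) \<Rightarrow> int" where
  "alternant \<beta> c = (\<Sum>\<sigma> | \<sigma> permutes {1..n}.
     sign \<sigma> * of_bool (\<forall>i\<in>{1..n}. int (c (\<sigma> i)) - int (\<sigma> i) = \<beta> i))"

text \<open>If \<open>y\<close> has \<open>p\<close> letters \<open>k\<close> and \<open>q\<close>
  letters \<open>k + 1\<close>, and \<open>v\<close> has \<open>r\<close> of each, then subtracting
  the index turns the two counts of \<open>w\<close> into \<open>p + r - k\<close> and
  \<open>q + r - k\<close>. Reflecting \<open>y\<close> interchanges them, and the sum over
  permutations absorbs the transposition at the price of a sign.\<close>

lemma alternant_toggle:
  assumes "N w \<noteq> 0" "\<not> lattice w"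
  shows "alternant \<beta> (count_list (toggle w)) = - alternant \<beta> (count_list w) \<and> N (toggle w) = N w"
proof -
  obtain y k v where k: "1 \<le> k" "w = y @ Suc k # v" "lattice v"
    "\<not> lattice (Suc k # v)"
    using not_reverse_lattice_word_split[OF assms(2)] by metis
  obtain k' where "Suc k = Suc k'" "hgt k' v = 0" using first_violation[OF k(3,4)] by metis
  then have h: "hgt k v = 0" by simp
  have kn: "Suc k \<le> n" using letters[OF assms(1)] k(2) by auto
  have pre: "0 \<le> hgt k x" if "Suc k # v = x @ z" for x z
  proof (cases x)
    case (Cons c x')
    with that have "v = x' @ z" "c = Suc k" by auto
    moreover from this have "hgt k z \<le> 0" using k(1,3) unfolding reverse_lattice_word_iff by blast
    ultimately show ?thesis using h Cons by simp
  qed simp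
  have tw: "toggle w = reflect k y @ Suc k # v" using k by (simp add: toggle_eq)
  have N: "N (toggle w) = N w"
    unfolding tw unfolding k(2) by (rule reflect_invariant[OF invariant[OF k(1) kn] pre])
  let ?t = "transpose k (Suc k)"
  have t: "?t permutes {1..n}" using k(1) kn by (intro permutes_swap_id) auto
  have c: "int (count_list (toggle w) i) - int i =
      int (count_list w (?t i)) - int (?t i)" for i
    using h count_reflect[of k y "?t i"] unfolding tw unfolding k(2)
    by (auto simp: hgt_def transpose_def)
  have "alternant \<beta> (count_list (toggle w)) = (\<Sum>\<sigma> | \<sigma> permutes {1..n}.
     sign \<sigma> * of_bool (\<forall>i\<in>{1..n}. int (count_list w (?t (\<sigma> i))) - int (?t (\<sigma> i)) = \<beta> i))"
    unfolding alternant_def c ..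
  also have "\<dots> = (\<Sum>\<sigma> | \<sigma> permutes {1..n}.
     sign (?t \<circ> \<sigma>) * of_bool (\<forall>i\<in>{1..n}. int (count_list w (?t ((?t \<circ> \<sigma>) i))) - int (?t ((?t \<circ> \<sigma>) i)) = \<beta> i))"
    by (rule setum_permutations_compose_left[OF t])
  also have "\<dots> = (\<Sum>\<sigma> | \<sigma> permutes {1..n}. - (sign \<sigma> *
      of_bool (\<forall>i\<in>{1..n}. int (count_list w (\<sigma> i)) - int (\<sigma> i) = \<beta> i)))"
  proof (rule sum.cong[OF refl])
    fix \<sigma> assume "\<sigma> \<in> {\<sigma>. \<sigma> permutes {1..n}}"
    then have "permutation \<sigma>" by (auto simp: permutation_permutes)
    then have "sign (?t \<circ> \<sigma>) = - sign \<sigma>"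
      by (simp add: sign_compose permutation_swap_id sign_swap_id)
    then show "sign (?t \<circ> \<sigma>) * of_bool (\<forall>i\<in>{1..n}. int (count_list w (?t ((?t \<circ> \<sigma>) i))) - int (?t ((?t \<circ> \<sigma>) i)) = \<beta> i)
      = - (sign \<sigma> * of_bool (\<forall>i\<in>{1..n}. int (count_list w (\<sigma> i)) - int (\<sigma> i) = \<beta> i))"
      by simp
  qed
  also have "\<dots> = - alternant \<beta> (count_list w)" by (simp add: alternant_def sum_negf)
  finally show ?thesis using N by simp
qed

lemma alternant_sum_zero:
  assumes "\<And>\<nu>. (\<Sum>w | N w \<noteq> 0 \<and> count_list w = \<nu> \<and> lattice w. N w) = 0"
  shows "(\<Sum>w | N w \<noteq> 0. N w * alternant \<beta> (count_list w)) = 0"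
proof -
  let ?S = "{w. N w \<noteq> 0}"
  let ?f = "\<lambda>w. N w * alternant \<beta> (count_list w)"
  let ?G = "{w \<in> ?S. lattice w}" and ?B = "{w \<in> ?S. \<not> lattice w}"
  have fin: "finite ?G" "finite ?B" using finite_support by auto
  have "sum ?f (?G \<union> ?B) = sum ?f ?G + sum ?f ?B"
    by (rule sum.union_disjoint[OF fin]) auto
  moreover have "?G \<union> ?B = ?S" by auto
  moreover have "sum ?f ?G = 0"
  proof -
    have "sum ?f ?G = (\<Sum>\<nu>\<in>count_list ` ?G. sum ?f {w \<in> ?G. count_list w = \<nu>})"
      by (rule sum.image_gen[OF fin(1)])
    also have "\<dots> = 0"
    proof (rule sum.neutral, rule ballI)
      fix \<nu>
      have "sum ?f {w \<in> ?G. count_list w = \<nu>} =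
          (\<Sum>w | N w \<noteq> 0 \<and> count_list w = \<nu> \<and> lattice w. N w) * alternant \<beta> \<nu>"
        unfolding sum_distrib_right by (rule sum.cong) auto
      then show "sum ?f {w \<in> ?G. count_list w = \<nu>} = 0" using assms by simp
    qed
    finally show ?thesis .
  qed
  moreover from calculation have "sum ?f ?S = sum ?f ?B" by simp
  moreover have "sum ?f ?B = - sum ?f ?B"
  proof -
    have "sum ?f ?B = (\<Sum>w\<in>?B. - ?f w)"
      by (rule sum.reindex_bij_witness[of _ toggle toggle])
        (use alternant_toggle not_reverse_lattice_word_toggle toggle_toggle in auto)
    then show ?thesis by (simp add: sum_negf)
  qed
  ultimately show ?thesis by linarith
qed

text \<open>Both sides are the coefficient of \<open>x^\<beta>\<close> in the product of the
  generating function with the alternant, expanded over words on the left and over permutations on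
  the right. Symmetry of the weight sums reconciles the two.\<close>

lemma alternant_sum_eq:
  "(\<Sum>w | N w \<noteq> 0. N w * alternant \<beta> (count_list w)) =
   (\<Sum>\<sigma> | \<sigma> permutes {1..n}. sign \<sigma> * weight_sum (\<lambda>i. \<beta> i + int (\<sigma> i)))"
proof -
  let ?S = "{w. N w \<noteq> 0}"
  let ?P = "\<lambda>\<sigma> w. \<forall>i\<in>{1..n}. int (count_list w (\<sigma> i)) - int (\<sigma> i) = \<beta> i"
  have "(\<Sum>w\<in>?S. N w * alternant \<beta> (count_list w)) =
      (\<Sum>\<sigma> | \<sigma> permutes {1..n}. sign \<sigma> * (\<Sum>w\<in>?S. N w * of_bool (?P \<sigma> w)))"
    unfolding alternant_def sum_distrib_left
    by (subst sum.swap) (simp add: ac_simps)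
  also have "\<dots> = (\<Sum>\<sigma> | \<sigma> permutes {1..n}. sign \<sigma> * weight_sum (\<lambda>i. \<beta> i + int (\<sigma> i)))"
  proof (rule sum.cong[OF refl])
    fix \<sigma> assume "\<sigma> \<in> {\<sigma>. \<sigma> permutes {1..n}}"
    then have s: "\<sigma> permutes {1..n}" by simp
    define \<beta>' where "\<beta>' = (\<lambda>i. \<beta> i + int (\<sigma> i))"
    have P_iff: "?P \<sigma> w \<longleftrightarrow> (\<forall>i\<in>{1..n}. int (count_list w i) = (\<beta>' \<circ> inv \<sigma>) i)" for w
    proof
      assume P: "?P \<sigma> w"
      show "\<forall>i\<in>{1..n}. int (count_list w i) = (\<beta>' \<circ> inv \<sigma>) i"
      proof
        fix i assume "i \<in> {1..n}"
        then have "inv \<sigma> i \<in> {1..n}" using permutes_in_image[OF permutes_inv[OF s]] by blast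
        with P have "int (count_list w (\<sigma> (inv \<sigma> i))) - int (\<sigma> (inv \<sigma> i)) = \<beta> (inv \<sigma> i)" by blast
        then show "int (count_list w i) = (\<beta>' \<circ> inv \<sigma>) i"
          by (simp add: permutes_inverses[OF s] \<beta>'_def)
      qed
    next
      assume P: "\<forall>i\<in>{1..n}. int (count_list w i) = (\<beta>' \<circ> inv \<sigma>) i"
      show "?P \<sigma> w"
      proof
        fix i assume "i \<in> {1..n}"
        then have "\<sigma> i \<in> {1..n}" using permutes_in_image[OF s] by blast
        with P have "int (count_list w (\<sigma> i)) = (\<beta>' \<circ> inv \<sigma>) (\<sigma> i)" by blast
        then show "int (count_list w (\<sigma> i)) - int (\<sigma> i) = \<beta> i"
          by (simp add: permutes_inverses[OF s] \<beta>'_def)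
      qed
    qed
    have "(\<Sum>w\<in>?S. N w * of_bool (?P \<sigma> w)) = (\<Sum>w\<in>?S. if ?P \<sigma> w then N w else 0)"
      by (rule sum.cong[OF refl]) (simp only: of_bool_def mult_1_right mult_zero_right split: if_split, simp)
    also have "\<dots> = sum N {w \<in> ?S. ?P \<sigma> w}" by (rule sum.inter_filter[OF finite_support, symmetric])
    also have "{w \<in> ?S. ?P \<sigma> w} =
        {w. N w \<noteq> 0 \<and> (\<forall>i\<in>{1..n}. int (count_list w i) = (\<beta>' \<circ> inv \<sigma>) i)}"
      unfolding P_iff by simp
    also have "sum N \<dots> = weight_sum (\<beta>' \<circ> inv \<sigma>)" unfolding weight_sum_def ..
    also have "\<dots> = weight_sum \<beta>'" by (rule weight_sum_permutes[OF permutes_inv[OF s]])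
    finally show "sign \<sigma> * (\<Sum>w\<in>?S. N w * of_bool (?P \<sigma> w)) = sign \<sigma> * weight_sum (\<lambda>i. \<beta> i + int (\<sigma> i))"
      by (simp add: \<beta>'_def)
  qed
  finally show ?thesis .
qed

text \<open>The sum of the squares of \<open>i - \<sigma> i\<close> is positive; expanding it gives
  the strict rearrangement inequality.\<close>

lemma sum_index_permuted_less:
  assumes "\<sigma> permutes {1..n}" "\<sigma> \<noteq> id"
  shows "(\<Sum>i\<in>{1..n}. int i * int (\<sigma> i)) < (\<Sum>i\<in>{1..n}. int i * int i)"
proof -
  obtain j where j: "\<sigma> j \<noteq> j" using assms(2) by (auto simp: fun_eq_iff)
  then have "j \<in> {1..n}" using assms(1) unfolding permutes_def by blast
  then have "0 < (\<Sum>i\<in>{1..n}. (int i - int (\<sigma> i))\<^sup>2)"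
    using j by (intro sum_pos2[of _ j]) auto
  also have "(\<Sum>i\<in>{1..n}. (int i - int (\<sigma> i))\<^sup>2) = (\<Sum>i\<in>{1..n}. int i * int i) +
      (\<Sum>i\<in>{1..n}. int (\<sigma> i) * int (\<sigma> i)) - 2 * (\<Sum>i\<in>{1..n}. int i * int (\<sigma> i))"
    by (simp add: sum.distrib sum_subtractf sum_distrib_left power2_eq_square algebra_simps)
  also have "(\<Sum>i\<in>{1..n}. int (\<sigma> i) * int (\<sigma> i)) = (\<Sum>i\<in>{1..n}. int i * int i)"
    using sum.permute[OF assms(1), of "\<lambda>i. int i * int i"] by (simp add: comp_def)
  finally show ?thesis by simp
qed

lemma weight_sum_zero:
  assumes "\<And>\<nu>. (\<Sum>w | N w \<noteq> 0 \<and> count_list w = \<nu> \<and> lattice w. N w) = 0"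
  shows "weight_sum \<beta> = 0"
proof (rule ccontr)
  assume nz: "weight_sum \<beta> \<noteq> 0"
  let ?c = "\<lambda>w i. int (count_list w i)"
  define S where "S = {w. N w \<noteq> 0 \<and> weight_sum (?c w) \<noteq> 0}"
  \<comment> \<open>The coefficients \<open>- int i\<close> make the identity the leading
    permutation of the alternant: replacing the content of \<open>w\<close> by
    \<open>\<alpha> + \<sigma>\<close> strictly raises \<open>f\<close> unless
    \<open>\<sigma> = id\<close>. At a maximal \<open>w\<close> only the identity term
    survives.\<close>
  define f where "f = (\<lambda>w. \<Sum>i\<in>{1..n}. - int i * ?c w i)"
  have finS: "finite S" unfolding S_def using finite_support by (rule rev_finite_subset) auto
  have inS: "\<exists>w\<in>S. \<forall>i\<in>{1..n}. ?c w i = \<beta> i" if "weight_sum \<beta> \<noteq> 0" for \<beta>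
  proof -
    from that obtain w where w: "N w \<noteq> 0" "\<forall>i\<in>{1..n}. ?c w i = \<beta> i"
      unfolding weight_sum_def by (metis (mono_tags, lifting) mem_Collect_eq sum.neutral)
    moreover have "weight_sum (?c w) = weight_sum \<beta>" using w by (intro weight_sum_cong) auto
    ultimately show ?thesis using that unfolding S_def by auto
  qed
  have "S \<noteq> {}" using inS[OF nz] by auto
  then obtain w where w: "w \<in> S" and max: "\<And>w'. w' \<in> S \<Longrightarrow> f w' \<le> f w"
    using finS by (metis obtains_MAX Max_ge finite_imageI imageI)
  define \<alpha> where "\<alpha> = (\<lambda>i. ?c w i - int i)"
  have "weight_sum (\<lambda>i. \<alpha> i + int (\<sigma> i)) = 0" if s: "\<sigma> permutes {1..n}" "\<sigma> \<noteq> id" for \<sigma>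
  proof (rule ccontr)
    assume "weight_sum (\<lambda>i. \<alpha> i + int (\<sigma> i)) \<noteq> 0"
    then obtain w' where w': "w' \<in> S" "\<forall>i\<in>{1..n}. ?c w' i = \<alpha> i + int (\<sigma> i)" using inS by blast
    have "f w' = (\<Sum>i\<in>{1..n}. - int i * (\<alpha> i + int (\<sigma> i)))"
      unfolding f_def using w'(2) by (intro sum.cong) auto
    also have "\<dots> = f w + (\<Sum>i\<in>{1..n}. int i * int i) - (\<Sum>i\<in>{1..n}. int i * int (\<sigma> i))"
      unfolding f_def \<alpha>_def by (simp add: sum.distrib sum_subtractf sum_negf algebra_simps)
    also have "\<dots> > f w" using sum_index_permuted_less[OF s] by simp
    finally show False using max[OF w'(1)] by simp
  qed
  then have "(\<Sum>\<sigma> | \<sigma> permutes {1..n}. sign \<sigma> * weight_sum (\<lambda>i. \<alpha> i + int (\<sigma> i))) =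
      (\<Sum>\<sigma> | \<sigma> permutes {1..n}. if \<sigma> = id then weight_sum (?c w) else 0)"
    by (intro sum.cong) (auto simp: \<alpha>_def)
  also have "\<dots> = weight_sum (?c w)"
    by (simp add: finite_permutations permutes_id)
  also have "\<dots> \<noteq> 0" using w by (simp add: S_def)
  finally show False using alternant_sum_zero[OF assms] alternant_sum_eq by simp
qed

lemma weighted_sum_zero:
  fixes F :: "(nat \<Rightarrow> nat) \<Rightarrow> 'a :: comm_ring_1"
  assumes "\<And>\<nu>. (\<Sum>w | N w \<noteq> 0 \<and> count_list w = \<nu> \<and> lattice w. N w) = 0"
  shows "(\<Sum>w | N w \<noteq> 0. of_int (N w) * F (count_list w)) = 0"
proof -
  let ?S = "{w. N w \<noteq> 0}"
  let ?f = "\<lambda>w. of_int (N w) * F (count_list w)"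
  have "sum ?f ?S = (\<Sum>\<nu>\<in>count_list ` ?S. sum ?f {w \<in> ?S. count_list w = \<nu>})"
    by (rule sum.image_gen[OF finite_support])
  also have "\<dots> = 0"
  proof (rule sum.neutral, rule ballI)
    fix \<nu> assume "\<nu> \<in> count_list ` ?S"
    then obtain w0 where w0: "N w0 \<noteq> 0" "\<nu> = count_list w0" by auto
    have out: "count_list w i = 0" if "N w \<noteq> 0" "i \<notin> {1..n}" for w i
      using letters[OF that(1)] that(2) by (auto simp: count_list_0_iff)
    have eq: "{w \<in> ?S. count_list w = \<nu>} =
        {w. N w \<noteq> 0 \<and> (\<forall>i\<in>{1..n}. int (count_list w i) = int (\<nu> i))}"
      using w0 out by (auto simp: fun_eq_iff)
    have "sum ?f {w \<in> ?S. count_list w = \<nu>} = (\<Sum>w\<in>{w \<in> ?S. count_list w = \<nu>}. of_int (N w) * F \<nu>)"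
      by (rule sum.cong) auto
    also have "\<dots> = of_int (weight_sum (\<lambda>i. int (\<nu> i))) * F \<nu>"
      unfolding weight_sum_def eq of_int_sum sum_distrib_right ..
    also have "\<dots> = 0" using weight_sum_zero[OF assms] by simp
    finally show "sum ?f {w \<in> ?S. count_list w = \<nu>} = 0" .
  qed
  finally show ?thesis .
qed

end

section \<open>Reading words of fillings\<close>

lemma sorted_split:
  fixes xs :: "nat list"
  assumes "sorted xs"
  shows "xs = filter (\<lambda>x. x < k) xs @ replicate (count_list xs k) k @
    replicate (count_list xs (Suc k)) (Suc k) @ filter (\<lambda>x. Suc k < x) xs"
  using assms
proof (induction xs)
  case (Cons a xs)
  then have le: "\<forall>x\<in>set xs. a \<le> x" by simp
  have IH: "xs = filter (\<lambda>x. x < k) xs @ replicate (count_list xs k) k @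
    replicate (count_list xs (Suc k)) (Suc k) @ filter (\<lambda>x. Suc k < x) xs"
    using Cons by simp
  consider "a < k" | "a = k" | "a = Suc k" | "Suc k < a" by linarith
  then show ?case
  proof cases
    case 1
    then show ?thesis using IH by simp
  next
    case 2
    then have "filter (\<lambda>x. x < k) xs = []" using le by (auto simp: filter_empty_conv)
    then show ?thesis using IH 2 by simp
  next
    case 3
    then have "filter (\<lambda>x. x < k) xs = []" "count_list xs k = 0"
      using le by (auto simp: filter_empty_conv count_list_0_iff)
    then show ?thesis using IH 3 by simp
  next
    case 4
    then have "filter (\<lambda>x. x < k) xs = []" "count_list xs k = 0" "count_list xs (Suc k) = 0"
      using le by (auto simp: filter_empty_conv count_list_0_iff)
    then show ?thesis using IH 4 by simp
  qed
qed simp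

lemma sorted_concat:
  fixes xss :: "nat list list"
  assumes "sorted_wrt (\<lambda>xs ys. \<forall>x\<in>set xs. \<forall>y\<in>set ys. x \<le> y) xss" "\<And>xs. xs \<in> set xss \<Longrightarrow> sorted xs"
  shows "sorted (concat xss)"
  using assms by (induction xss) (auto simp: sorted_append)

lemma count_list_concat_map:
  assumes "distinct js" "\<And>j. j \<in> set js \<Longrightarrow> distinct (f j)"
  shows "count_list (concat (map f js)) v = card {j \<in> set js. v \<in> set (f j)}"
  using assms
proof (induction js)
  case (Cons j js)
  have eq: "{i \<in> set (j # js). v \<in> set (f i)} =
      (if v \<in> set (f j) then insert j {i \<in> set js. v \<in> set (f i)} else {i \<in> set js. v \<in> set (f i)})"
    by auto
  have "count_list (f j) v = (if v \<in> set (f j) then 1 else 0)"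
  proof -
    have "count_list xs v = (if v \<in> set xs then 1 else 0)" if "distinct xs" for xs
      using that by (induction xs) auto
    then show ?thesis using Cons.prems by simp
  qed
  with Cons show ?case unfolding eq by simp
qed simp

lemma count_list_map_filter:
  assumes "distinct js"
  shows "count_list (map g (filter P js)) v = card {j \<in> set js. P j \<and> g j = v}"
  using assms
proof (induction js)
  case (Cons j js)
  have eq: "{i \<in> set (j # js). P i \<and> g i = v} =
      (if P j \<and> g j = v then insert j {i \<in> set js. P i \<and> g i = v} else {i \<in> set js. P i \<and> g i = v})"
    by auto
  show ?case unfolding eq using Cons by simp
qed simp

lemma filter_sorted_list_of_set:
  assumes "finite A"
  shows "filter P (sorted_list_of_set A) = sorted_list_of_set {x \<in> A. P x}"
  using assms by (intro sorted_distinct_set_unique) (auto intro: sorted_wrt_filter)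

locale skew_shape =
  fixes lam mu :: "nat \<Rightarrow> nat"
  assumes skew: "is_skew_shape lam mu"
begin

abbreviation "boxes \<equiv> skew_boxes lam mu"
abbreviation "fillings \<equiv> SVRPP lam mu"
abbreviation "row_letters \<equiv> row_word lam mu"
abbreviation "reading \<equiv> reading_word lam mu"
abbreviation "content \<equiv> ircont lam mu"
abbreviation "cols i \<equiv> {mu i<..lam i}"

lemma mu_le_lam: "mu i \<le> lam i"
proof (cases "1 \<le> i \<and> 1 \<le> mu i")
  case True
  then have "(i, mu i) \<in> young_diagram mu" by (simp add: young_diagram_def)
  then have "(i, mu i) \<in> young_diagram lam" using skew unfolding is_skew_shape_def by blast
  then show ?thesis by (simp add: young_diagram_def)
next
  case False
  moreover have "mu 0 = 0" using skew
    by (simp add: is_skew_shape_def is_partition_def weak_composition_def)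
  ultimately show ?thesis by (cases i) auto
qed

lemma lam_antimono: "1 \<le> i \<Longrightarrow> i \<le> i' \<Longrightarrow> lam i' \<le> lam i"
  and mu_antimono: "1 \<le> i \<Longrightarrow> i \<le> i' \<Longrightarrow> mu i' \<le> mu i"
  using skew by (auto simp: is_skew_shape_def is_partition_def)

lemma mem_boxes: "(i, j) \<in> boxes \<longleftrightarrow> 1 \<le> i \<and> mu i < j \<and> j \<le> lam i"
  by (auto simp: skew_boxes_def young_diagram_def)

lemma lam_eq_0:
  assumes "num_rows lam < i"
  shows "lam i = 0"
proof (rule ccontr)
  assume "lam i \<noteq> 0"
  moreover have "finite {i. lam i \<noteq> 0}"
    using skew by (auto simp: is_skew_shape_def is_partition_def weak_composition_def)
  moreover have "{1..i} \<subseteq> {i. lam i \<noteq> 0}"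
    using lam_antimono[of _ i] \<open>lam i \<noteq> 0\<close> by fastforce
  ultimately have "card {1..i} \<le> card {i. lam i \<noteq> 0}" by (intro card_mono)
  with assms show False by (simp add: num_rows_def)
qed

text \<open>\<open>Max\<close> and \<open>Min\<close> are informative only on finite nonempty sets.
  The entrywise form is the one that survives changing single entries.\<close>

lemma SVRPP_iff:
  "T \<in> fillings \<longleftrightarrow>
    (\<forall>b. b \<notin> boxes \<longrightarrow> T b = {}) \<and>
    (\<forall>b\<in>boxes. T b \<noteq> {} \<and> finite (T b) \<and> (\<forall>k\<in>T b. 1 \<le> k)) \<and>
    (\<forall>i j j'. (i, j) \<in> boxes \<and> (i, j') \<in> boxes \<and> j < j' \<longrightarrow> (\<forall>x\<in>T (i, j). \<forall>y\<in>T (i, j'). x \<le> y)) \<and>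
    (\<forall>i i' j. (i, j) \<in> boxes \<and> (i', j) \<in> boxes \<and> i < i' \<longrightarrow> (\<forall>x\<in>T (i, j). \<forall>y\<in>T (i', j). x \<le> y))"
proof -
  have le: "set_le A B \<longleftrightarrow> (\<forall>x\<in>A. \<forall>y\<in>B. x \<le> y)"
    if "finite A" "A \<noteq> {}" "finite B" "B \<noteq> {}" for A B
    using that unfolding set_le_def by (auto simp: Max_le_iff Min_ge_iff)
  show ?thesis
  proof (cases "(\<forall>b. b \<notin> boxes \<longrightarrow> T b = {}) \<and> (\<forall>b\<in>boxes. T b \<noteq> {} \<and> finite (T b) \<and> (\<forall>k\<in>T b. 1 \<le> k))")
    case True
    have "set_le (T b) (T b') \<longleftrightarrow> (\<forall>x\<in>T b. \<forall>y\<in>T b'. x \<le> y)" if "b \<in> boxes" "b' \<in> boxes" for b b'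
      by (rule le) (use True that in blast)+
    with True show ?thesis unfolding SVRPP_def mem_Collect_eq by simp
  next
    case False
    then show ?thesis unfolding SVRPP_def by blast
  qed
qed

context
  fixes T assumes T: "T \<in> fillings"
begin

lemma box_empty: "b \<notin> boxes \<Longrightarrow> T b = {}"
  and box_nonempty: "b \<in> boxes \<Longrightarrow> T b \<noteq> {}"
  and box_finite: "finite (T b)"
  and box_positive: "v \<in> T b \<Longrightarrow> 1 \<le> v"
  and row_le: "x \<in> T (i, j) \<Longrightarrow> y \<in> T (i, j') \<Longrightarrow> j < j' \<Longrightarrow> x \<le> y"
  and column_le: "x \<in> T (i, j) \<Longrightarrow> y \<in> T (i', j) \<Longrightarrow> i < i' \<Longrightarrow> x \<le> y"
proof -
  have all: "(\<forall>b. b \<notin> boxes \<longrightarrow> T b = {})"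
    "(\<forall>b\<in>boxes. T b \<noteq> {} \<and> finite (T b) \<and> (\<forall>k\<in>T b. 1 \<le> k))"
    "(\<forall>i j j'. (i, j) \<in> boxes \<and> (i, j') \<in> boxes \<and> j < j' \<longrightarrow> (\<forall>x\<in>T (i, j). \<forall>y\<in>T (i, j'). x \<le> y))"
    "(\<forall>i i' j. (i, j) \<in> boxes \<and> (i', j) \<in> boxes \<and> i < i' \<longrightarrow> (\<forall>x\<in>T (i, j). \<forall>y\<in>T (i', j). x \<le> y))"
    using T unfolding SVRPP_iff by metis+
  show out: "b \<notin> boxes \<Longrightarrow> T b = {}" for b using all(1) by blast
  show "b \<in> boxes \<Longrightarrow> T b \<noteq> {}" using all(2) by blast
  show "finite (T b)" using out[of b] all(2) by (cases "b \<in> boxes") auto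
  have ins: "b \<in> boxes" if "v \<in> T b" for v b using out[of b] that by blast
  show "v \<in> T b \<Longrightarrow> 1 \<le> v" using ins[of v b] all(2) by blast
  show "x \<in> T (i, j) \<Longrightarrow> y \<in> T (i, j') \<Longrightarrow> j < j' \<Longrightarrow> x \<le> y" using ins all(3) by blast
  show "x \<in> T (i, j) \<Longrightarrow> y \<in> T (i', j) \<Longrightarrow> i < i' \<Longrightarrow> x \<le> y" using ins all(4) by blast
qed

lemma mem_box: "v \<in> T b \<Longrightarrow> b \<in> boxes"
  using box_empty by blast

lemma Min_in_box: "b \<in> boxes \<Longrightarrow> Min (T b) \<in> T b"
  and Max_in_box: "b \<in> boxes \<Longrightarrow> Max (T b) \<in> T b"
  using box_nonempty box_finite by auto

lemma Min_box_le: "v \<in> T b \<Longrightarrow> Min (T b) \<le> v"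
  using box_finite by auto

end

section \<open>The descending and the ascending half of a row word\<close>

definition nonpivots :: "(box \<Rightarrow> nat set) \<Rightarrow> nat \<Rightarrow> nat list" where
  "nonpivots T i = concat (map (\<lambda>j. rev (sorted_list_of_set (T (i, j) - {pivot T (i, j)}))) (rev (row_cols lam mu i)))"

definition kept :: "(box \<Rightarrow> nat set) \<Rightarrow> nat \<Rightarrow> nat \<Rightarrow> bool" where
  "kept T i j \<longleftrightarrow> \<not> ((i - 1, j) \<in> boxes \<and> pivot T (i, j) = Max (T (i - 1, j)))"

definition pivots :: "(box \<Rightarrow> nat set) \<Rightarrow> nat \<Rightarrow> nat list" where
  "pivots T i = map (\<lambda>j. pivot T (i, j)) (filter (kept T i) (row_cols lam mu i))"

lemma row_word_eq: "row_letters T i = nonpivots T i @ pivots T i"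
  unfolding row_word_def nonpivots_def pivots_def kept_def ..

lemma set_row_cols: "set (row_cols lam mu i) = cols i"
  by (auto simp: row_cols_def)

lemma distinct_row_cols: "distinct (row_cols lam mu i)"
  by (simp add: row_cols_def)

lemma sorted_row_cols: "sorted_wrt (<) (row_cols lam mu i)"
  by (simp add: row_cols_def del: upt_Suc)

lemma in_boxes_iff_cols: "1 \<le> i \<Longrightarrow> (i, j) \<in> boxes \<longleftrightarrow> j \<in> cols i"
  by (auto simp: mem_boxes)

context
  fixes T assumes T: "T \<in> fillings"
begin

lemma rev_nonpivots:
  "rev (nonpivots T i) = concat (map (\<lambda>j. sorted_list_of_set (T (i, j) - {pivot T (i, j)})) (row_cols lam mu i))"
  by (simp add: nonpivots_def rev_concat rev_map comp_def)

lemma sorted_rev_nonpivots: "sorted (rev (nonpivots T i))"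
  unfolding rev_nonpivots
proof (rule sorted_concat)
  show "sorted_wrt (\<lambda>xs ys. \<forall>x\<in>set xs. \<forall>y\<in>set ys. x \<le> y)
     (map (\<lambda>j. sorted_list_of_set (T (i, j) - {pivot T (i, j)})) (row_cols lam mu i))"
    unfolding sorted_wrt_map
  proof (rule sorted_wrt_mono_rel[OF _ sorted_row_cols])
    fix j j' assume "j < (j' :: nat)"
    then show "\<forall>x\<in>set (sorted_list_of_set (T (i, j) - {pivot T (i, j)})).
        \<forall>y\<in>set (sorted_list_of_set (T (i, j') - {pivot T (i, j')})). x \<le> y"
      using box_finite[OF T] by (auto intro: row_le[OF T])
  qed
qed auto

lemma sorted_pivots: "1 \<le> i \<Longrightarrow> sorted (pivots T i)"
  unfolding pivots_def sorted_wrt_map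
proof (rule sorted_wrt_mono_rel[OF _ sorted_wrt_filter[OF sorted_row_cols]])
  fix j j' assume i: "1 \<le> i" and j: "j \<in> set (filter (kept T i) (row_cols lam mu i))"
    "j' \<in> set (filter (kept T i) (row_cols lam mu i))" "j < j'"
  then have "(i, j) \<in> boxes" "(i, j') \<in> boxes" by (simp_all add: set_row_cols mem_boxes)
  then show "pivot T (i, j) \<le> pivot T (i, j')"
    unfolding pivot_def by (intro row_le[where i = i, OF T _ _ j(3)] Min_in_box[OF T])
qed

lemma count_nonpivots:
  "count_list (nonpivots T i) v = card {j \<in> cols i. v \<in> T (i, j) \<and> v \<noteq> Min (T (i, j))}"
proof -
  have "count_list (nonpivots T i) v = count_list (rev (nonpivots T i)) v" by simp
  also have "\<dots> = card {j \<in> set (row_cols lam mu i). v \<in> set (sorted_list_of_set (T (i, j) - {pivot T (i, j)}))}"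
    unfolding rev_nonpivots by (rule count_list_concat_map) (auto simp: distinct_row_cols)
  finally show ?thesis using box_finite[OF T] by (simp add: set_row_cols pivot_def)
qed

lemma count_pivots:
  "count_list (pivots T i) v = card {j \<in> cols i. Min (T (i, j)) = v \<and> kept T i j}"
  unfolding pivots_def count_list_map_filter[OF distinct_row_cols] set_row_cols pivot_def
  by (rule arg_cong[where f = card]) auto

text \<open>The omission rule concerns pivots only, but a non-pivot exceeds the minimum of its box
  and hence every entry above it. So one condition covers all entries.\<close>

lemma count_row_word:
  assumes i: "1 \<le> i"
  shows "count_list (row_letters T i) v =
    card {j \<in> cols i. v \<in> T (i, j) \<and> \<not> ((i - 1, j) \<in> boxes \<and> v = Max (T (i - 1, j)))}"
proof -
  let ?X = "{j \<in> cols i. v \<in> T (i, j) \<and> v \<noteq> Min (T (i, j))}"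
  let ?Y = "{j \<in> cols i. Min (T (i, j)) = v \<and> kept T i j}"
  have "count_list (row_letters T i) v = card (?X \<union> ?Y)"
    unfolding row_word_eq count_list_append count_nonpivots count_pivots
    by (rule card_Un_disjoint[symmetric]) auto
  also have "?X \<union> ?Y = {j \<in> cols i. v \<in> T (i, j) \<and> \<not> ((i - 1, j) \<in> boxes \<and> v = Max (T (i - 1, j)))}"
  proof (rule set_eqI)
    fix j
    show "j \<in> ?X \<union> ?Y \<longleftrightarrow> j \<in> {j \<in> cols i. v \<in> T (i, j) \<and> \<not> ((i - 1, j) \<in> boxes \<and> v = Max (T (i - 1, j)))}"
    proof (cases "j \<in> cols i")
      case True
      then have ij: "(i, j) \<in> boxes" using i in_boxes_iff_cols by blast
      have "\<not> ((i - 1, j) \<in> boxes \<and> v = Max (T (i - 1, j)))" if "v \<in> T (i, j)" "v \<noteq> Min (T (i, j))"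
      proof
        assume a: "(i - 1, j) \<in> boxes \<and> v = Max (T (i - 1, j))"
        then have "v \<in> T (i - 1, j)" using Max_in_box[OF T] by simp
        then have "v \<le> Min (T (i, j))" using column_le[OF T _ Min_in_box[OF T ij], of v "i - 1"] i by simp
        with Min_box_le[OF T that(1)] that(2) show False by simp
      qed
      with True Min_in_box[OF T ij] show ?thesis by (auto simp: kept_def pivot_def)
    qed auto
  qed
  finally show ?thesis .
qed

text \<open>Non-pivots descend and pivots ascend, so the letters below \<open>k\<close> end up
  between the two groups of \<open>k\<close>.\<close>

lemma row_word_split:
  assumes i: "1 \<le> i"
  shows "row_letters T i =
    filter (\<lambda>x. Suc k < x) (nonpivots T i) @ replicate (count_list (nonpivots T i) (Suc k)) (Suc k) @
    replicate (count_list (nonpivots T i) k) k @ filter (\<lambda>x. x < k) (nonpivots T i) @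
    filter (\<lambda>x. x < k) (pivots T i) @ replicate (count_list (pivots T i) k) k @
    replicate (count_list (pivots T i) (Suc k)) (Suc k) @ filter (\<lambda>x. Suc k < x) (pivots T i)"
proof -
  have "nonpivots T i = rev (rev (nonpivots T i))" by simp
  also have "\<dots> = filter (\<lambda>x. Suc k < x) (nonpivots T i) @ replicate (count_list (nonpivots T i) (Suc k)) (Suc k) @
    replicate (count_list (nonpivots T i) k) k @ filter (\<lambda>x. x < k) (nonpivots T i)"
    by (subst sorted_split[OF sorted_rev_nonpivots, of i k]) (simp add: rev_filter[symmetric])
  finally have "nonpivots T i = \<dots>" .
  moreover note sorted_split[OF sorted_pivots[OF i], of k]
  ultimately show ?thesis unfolding row_word_eq by (metis append_assoc)
qed

text \<open>The omitted pivots of row \<open>Suc i\<close> are the boxes counted by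
  \<open>ceq\<close> at \<open>i\<close>. Thus \<open>ceq\<close> is recovered from lengths of row
  words and numbers of entries.\<close>

lemma length_row_word:
  assumes i: "1 \<le> i"
  shows "length (row_letters T (Suc i)) + ceq lam mu T i = (\<Sum>j\<in>cols (Suc i). card (T (Suc i, j)))"
proof -
  let ?C = "cols (Suc i)"
  have box: "(Suc i, j) \<in> boxes \<longleftrightarrow> j \<in> ?C" for j by (rule in_boxes_iff_cols) simp
  have "length (nonpivots T (Suc i)) = length (rev (nonpivots T (Suc i)))" by simp
  also have "\<dots> = (\<Sum>j\<leftarrow>row_cols lam mu (Suc i). card (T (Suc i, j) - {pivot T (Suc i, j)}))"
    unfolding rev_nonpivots by (simp add: length_concat comp_def)
  also have "\<dots> = (\<Sum>j\<in>?C. card (T (Suc i, j) - {pivot T (Suc i, j)}))"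
    by (simp add: sum_list_distinct_conv_sum_set distinct_row_cols set_row_cols)
  also have "\<dots> = (\<Sum>j\<in>?C. card (T (Suc i, j)) - 1)"
  proof (rule sum.cong[OF refl])
    fix j assume "j \<in> ?C"
    then have "pivot T (Suc i, j) \<in> T (Suc i, j)" unfolding pivot_def using box by (intro Min_in_box[OF T]) simp
    then show "card (T (Suc i, j) - {pivot T (Suc i, j)}) = card (T (Suc i, j)) - 1"
      by (simp add: card_Diff_singleton)
  qed
  finally have 1: "length (nonpivots T (Suc i)) = (\<Sum>j\<in>?C. card (T (Suc i, j)) - 1)" .
  have 2: "length (pivots T (Suc i)) = card {j \<in> ?C. kept T (Suc i) j}"
    unfolding pivots_def length_map distinct_length_filter[OF distinct_row_cols] set_row_cols
    by (rule arg_cong[where f = card]) auto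
  have 3: "ceq lam mu T i = card {j \<in> ?C. \<not> kept T (Suc i) j}"
    unfolding ceq_def kept_def pivot_def 
    by (rule arg_cong[where f = card]) (auto simp: box)
  have "card {j \<in> ?C. kept T (Suc i) j} + card {j \<in> ?C. \<not> kept T (Suc i) j} = card ({j \<in> ?C. kept T (Suc i) j} \<union> {j \<in> ?C. \<not> kept T (Suc i) j})"
    by (rule card_Un_disjoint[symmetric]) auto
  also have "{j \<in> ?C. kept T (Suc i) j} \<union> {j \<in> ?C. \<not> kept T (Suc i) j} = ?C" by auto
  finally have "card {j \<in> ?C. kept T (Suc i) j} + card {j \<in> ?C. \<not> kept T (Suc i) j} = (\<Sum>j\<in>?C. 1)" by simp
  then have "length (row_letters T (Suc i)) + ceq lam mu T i = (\<Sum>j\<in>?C. card (T (Suc i, j)) - 1) + (\<Sum>j\<in>?C. 1)"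
    unfolding row_word_eq using 1 2 3 by simp
  also have "\<dots> = (\<Sum>j\<in>?C. card (T (Suc i, j)))"
    unfolding sum.distrib[symmetric]
  proof (rule sum.cong[OF refl])
    fix j assume "j \<in> ?C"
    then have "card (T (Suc i, j)) \<noteq> 0" using box_nonempty[OF T, of "(Suc i, j)"] box_finite[OF T] box by simp
    then show "card (T (Suc i, j)) - 1 + 1 = card (T (Suc i, j))" by simp
  qed
  finally show ?thesis .
qed

end

end

section \<open>Two consecutive letters in a filling\<close>

type_synonym filling = "box \<Rightarrow> nat set"

type_synonym bounds = "nat \<Rightarrow> nat"

context skew_shape
begin

text \<open>\<open>A i \<le> Suc (D i)\<close> holds because at most one box of a row contains both
  letters, and \<open>A (Suc i) \<le> D i\<close> because no \<open>k\<close> lies below a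
  \<open>k + 1\<close>.\<close>

definition interlaced :: "bounds \<Rightarrow> bounds \<Rightarrow> bounds \<Rightarrow> bounds \<Rightarrow> bool" where
  "interlaced l D A e \<longleftrightarrow>
     l 0 = lam 1 \<and> D 0 = lam 1 \<and> A 0 = lam 1 \<and> e 0 = lam 1 \<and>
     (\<forall>i\<ge>1. mu i \<le> l i \<and> l i \<le> D i \<and> D i \<le> A i \<and> A i \<le> Suc (D i) \<and> A i \<le> e i \<and> e i \<le> lam i) \<and>
     (\<forall>i. l (Suc i) \<le> l i \<and> e (Suc i) \<le> e i \<and> A (Suc i) \<le> D i)"

text \<open>
  In row \<open>i\<close>, the boxes with all entries below \<open>k\<close> end at column \<open>l i\<close>; they are followed by the
  boxes containing \<open>k\<close> but not \<open>k + 1\<close>, up to column \<open>D i\<close>, those containing both, up to \<open>A i\<close>, and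
  those containing \<open>k + 1\<close> but not \<open>k\<close>, up to \<open>e i\<close>. A fictitious row \<open>0\<close> makes the first row
  behave like the others.
\<close>

definition profile :: "filling \<Rightarrow> nat \<Rightarrow> bounds \<Rightarrow> bounds \<Rightarrow> bounds \<Rightarrow> bounds \<Rightarrow> bool" where
  "profile T k l D A e \<longleftrightarrow> interlaced l D A e \<and>
     (\<forall>i\<ge>1. \<forall>j\<in>cols i. ((\<forall>v\<in>T (i, j). v < k) \<longleftrightarrow> j \<le> l i) \<and>
        (k \<in> T (i, j) \<longleftrightarrow> l i < j \<and> j \<le> A i) \<and> (Suc k \<in> T (i, j) \<longleftrightarrow> D i < j \<and> j \<le> e i))"

section \<open>Bounds of initial segments of rows\<close>

definition last_col :: "(nat \<Rightarrow> nat \<Rightarrow> bool) \<Rightarrow> nat \<Rightarrow> nat" where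
  "last_col P i = (if i = 0 then lam 1 else Max (insert (mu i) {j \<in> cols i. P i j}))"

lemma last_col_bounds: "1 \<le> i \<Longrightarrow> mu i \<le> last_col P i \<and> last_col P i \<le> lam i"
  using mu_le_lam[of i] by (simp add: last_col_def)

lemma last_col_iff:
  assumes i: "1 \<le> i" and j: "j \<in> cols i"
    and down: "\<And>j j'. j \<in> cols i \<Longrightarrow> j' \<in> {mu i<..<j} \<Longrightarrow> P i j \<Longrightarrow> P i j'"
  shows "P i j \<longleftrightarrow> j \<le> last_col P i"
proof
  let ?X = "insert (mu i) {j \<in> cols i. P i j}"
  have eq: "last_col P i = Max ?X" using i by (simp add: last_col_def)
  show "j \<le> last_col P i" if "P i j" unfolding eq using that j by (intro Max_ge) auto
  assume le: "j \<le> last_col P i"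
  have "last_col P i \<in> ?X" unfolding eq by (rule Max_in) auto
  then have "P i (last_col P i)" "last_col P i \<in> cols i" using le j by auto
  with down[of "last_col P i" j] le j show "P i j" by (cases "j = last_col P i") auto
qed

lemma last_col_le:
  assumes i: "1 \<le> i" "\<And>j. j \<in> cols i \<Longrightarrow> P i j \<Longrightarrow> Q i j"
  shows "last_col P i \<le> last_col Q i"
proof -
  have "insert (mu i) {j \<in> cols i. P i j} \<subseteq> insert (mu i) {j \<in> cols i. Q i j}"
    using i by auto
  then show ?thesis using i by (simp add: last_col_def Max_mono)
qed

text \<open>A box of row \<open>Suc i\<close> with no box above it lies in a column at most
  \<open>mu i\<close>, which is already a lower bound of \<open>last_col Q i\<close>.\<close>

lemma last_col_Suc_le:
  assumes down: "\<And>j. (Suc i, j) \<in> boxes \<Longrightarrow> (i, j) \<in> boxes \<Longrightarrow> P (Suc i) j \<Longrightarrow> Q i j"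
  shows "last_col P (Suc i) \<le> last_col Q i"
proof (cases "i = 0")
  case True
  then show ?thesis using last_col_bounds[of 1 P] by (simp add: last_col_def)
next
  case False
  let ?X = "insert (mu (Suc i)) {j \<in> cols (Suc i). P (Suc i) j}"
  have eq: "last_col P (Suc i) = Max ?X" by (simp add: last_col_def)
  have eqQ: "last_col Q i = Max (insert (mu i) {j \<in> cols i. Q i j})"
    using False by (simp add: last_col_def)
  have "x \<le> last_col Q i" if x: "x \<in> ?X" for x
  proof (cases "x \<le> mu i")
    case True
    then show ?thesis using last_col_bounds[of i Q] False by linarith
  next
    case xm: False
    have "mu (Suc i) \<le> mu i" "lam (Suc i) \<le> lam i" using False by (auto intro: mu_antimono lam_antimono)
    with xm x have "x \<in> cols i" "x \<in> cols (Suc i)" "P (Suc i) x" by auto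
    with down[of x] False have "x \<in> {j \<in> cols i. Q i j}" by (simp add: mem_boxes)
    then show ?thesis unfolding eqQ by (intro Max_ge) auto
  qed
  then show ?thesis unfolding eq by (subst Max_le_iff) auto
qed

lemma profile_exists:
  assumes T: "T \<in> fillings"
  obtains l D A e where "profile T k l D A e"
proof -
  \<comment> \<open>The four predicates pass to boxes further left in the row, which is why
    \<open>L\<close> is a disjunct of each of the others. Their last columns are the bounds
    \<open>l\<close>, \<open>D\<close>, \<open>A\<close>, \<open>e\<close>.\<close>
  define L where "L = (\<lambda>i j. \<forall>v\<in>T (i, j). v < k)"
  define d where "d = (\<lambda>i j. L i j \<or> k \<in> T (i, j) \<and> Suc k \<notin> T (i, j))"
  define a where "a = (\<lambda>i j. L i j \<or> k \<in> T (i, j))"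
  define E where "E = (\<lambda>i j. L i j \<or> k \<in> T (i, j) \<or> Suc k \<in> T (i, j))"
  have row: "x \<le> y" if "x \<in> T (i, j')" "y \<in> T (i, j)" "j' \<in> {mu i<..<j}" for x y i j j'
    using row_le[OF T that(1,2)] that(3) by simp
  have ne: "\<exists>y. y \<in> T (i, j)" if "1 \<le> i" "j \<in> cols i" for i j
    using box_nonempty[OF T, of "(i, j)"] that by (auto simp: mem_boxes)
  have L_down: "L i j'" if H: "1 \<le> i" "j \<in> cols i" "j' \<in> {mu i<..<j}" "L i j" for i j j'
    unfolding L_def
  proof
    fix v assume "v \<in> T (i, j')"
    moreover obtain y where "y \<in> T (i, j)" using ne H by blast
    ultimately show "v < k" using row[of v i j' y j] H(3,4) by (auto simp: L_def)
  qed
  have below: "L i j' \<or> (k \<in> T (i, j') \<and> Suc k \<notin> T (i, j'))"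
    if "j' \<in> {mu i<..<j}" "k \<in> T (i, j)" for i j j'
  proof -
    have "v \<le> k" if "v \<in> T (i, j')" for v using row[OF that] \<open>k \<in> T (i, j)\<close> \<open>j' \<in> _\<close> by blast
    then show ?thesis unfolding L_def by (metis Suc_n_not_le_n le_neq_implies_less)
  qed
  have below': "E i j'" if "j' \<in> {mu i<..<j}" "Suc k \<in> T (i, j)" for i j j'
  proof -
    have "v \<le> Suc k" if "v \<in> T (i, j')" for v using row[OF that] \<open>Suc k \<in> T (i, j)\<close> \<open>j' \<in> _\<close> by blast
    then show ?thesis unfolding E_def L_def by (metis le_neq_implies_less less_Suc_eq)
  qed
  have l: "L i j \<longleftrightarrow> j \<le> last_col L i" and D: "d i j \<longleftrightarrow> j \<le> last_col d i"
    and A: "a i j \<longleftrightarrow> j \<le> last_col a i" and e: "E i j \<longleftrightarrow> j \<le> last_col E i"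
    if ij: "1 \<le> i" "j \<in> cols i" for i j
  proof -
    show "L i j \<longleftrightarrow> j \<le> last_col L i" by (rule last_col_iff[OF ij]) (use L_down ij in blast)
    show "d i j \<longleftrightarrow> j \<le> last_col d i"
      by (rule last_col_iff[OF ij]) (use L_down ij below in \<open>unfold d_def, blast\<close>)
    show "a i j \<longleftrightarrow> j \<le> last_col a i"
      by (rule last_col_iff[OF ij]) (use L_down ij below in \<open>unfold a_def, blast\<close>)
    show "E i j \<longleftrightarrow> j \<le> last_col E i"
    proof (rule last_col_iff[OF ij])
      fix j j' assume j: "j \<in> cols i" "j' \<in> {mu i<..<j}" "E i j"
      then consider "L i j" | "k \<in> T (i, j)" | "Suc k \<in> T (i, j)" unfolding E_def by blast
      then show "E i j'"
        using L_down[OF ij(1) j(1,2)] below[OF j(2)] below'[OF j(2)] by cases (auto simp: E_def)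
    qed
  qed
  have "profile T k (last_col L) (last_col d) (last_col a) (last_col E)"
    unfolding profile_def interlaced_def
  proof (intro conjI allI impI ballI)
    fix i :: nat assume i: "1 \<le> i"
    show "mu i \<le> last_col L i" "last_col E i \<le> lam i" using last_col_bounds[OF i] by auto
    show "last_col L i \<le> last_col d i" by (rule last_col_le[OF i]) (simp add: d_def)
    show "last_col d i \<le> last_col a i" by (rule last_col_le[OF i]) (auto simp: d_def a_def)
    show "last_col a i \<le> last_col E i" by (rule last_col_le[OF i]) (auto simp: E_def a_def)
    show "last_col a i \<le> Suc (last_col d i)"
    proof (rule ccontr)
      assume "\<not> last_col a i \<le> Suc (last_col d i)"
      then have lt: "Suc (last_col d i) < last_col a i" by simp
      have in_row: "last_col a i \<in> cols i" "Suc (last_col d i) \<in> cols i"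
        using lt last_col_bounds[OF i, of a] last_col_bounds[OF i, of d] by auto
      then have "a i (last_col a i)" "a i (Suc (last_col d i))" "\<not> d i (last_col a i)" "\<not> d i (Suc (last_col d i))"
        using A[OF i] D[OF i] lt by auto
      then have "k \<in> T (i, last_col a i)" "Suc k \<in> T (i, Suc (last_col d i))" by (auto simp: a_def d_def)
      then have "Suc k \<le> k" using row_le[OF T] lt by metis
      then show False by simp
    qed
    fix j assume j: "j \<in> cols i"
    show "(\<forall>v\<in>T (i, j). v < k) \<longleftrightarrow> j \<le> last_col L i" using l[OF i j] by (simp add: L_def)
    show "k \<in> T (i, j) \<longleftrightarrow> last_col L i < j \<and> j \<le> last_col a i"
      using l[OF i j] A[OF i j] by (auto simp: L_def a_def)
    have "\<not> (L i j \<and> Suc k \<in> T (i, j))" by (force simp: L_def)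
    moreover have "\<not> (L i j \<and> k \<in> T (i, j))" by (auto simp: L_def)
    ultimately have "Suc k \<in> T (i, j) \<longleftrightarrow> \<not> d i j \<and> E i j" by (auto simp: d_def E_def)
    then show "Suc k \<in> T (i, j) \<longleftrightarrow> last_col d i < j \<and> j \<le> last_col E i"
      using D[OF i j] e[OF i j] by auto
  next
    fix i
    have col: "x \<le> y" if "x \<in> T (i, j)" "y \<in> T (Suc i, j)" for x y j
      using column_le[OF T that] by simp
    have ne': "\<exists>y. y \<in> T (Suc i, j)" if "(Suc i, j) \<in> boxes" for j using box_nonempty[OF T that] by blast
    have LL: "L i j" if H: "(Suc i, j) \<in> boxes" "L (Suc i) j" for j
      unfolding L_def
    proof
      fix v assume "v \<in> T (i, j)"
      moreover obtain y where "y \<in> T (Suc i, j)" using ne' H by blast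
      ultimately show "v < k" using col[of v j y] H(2) by (auto simp: L_def)
    qed
    show "last_col L (Suc i) \<le> last_col L i" by (rule last_col_Suc_le) (use LL in blast)
    have dd: "d i j" if "k \<in> T (Suc i, j)" for j
    proof -
      have "v \<le> k" if "v \<in> T (i, j)" for v using col[OF that] \<open>k \<in> _\<close> by blast
      then show ?thesis unfolding d_def L_def by (metis Suc_n_not_le_n le_neq_implies_less)
    qed
    have EE: "E i j" if "Suc k \<in> T (Suc i, j)" for j
    proof -
      have "v \<le> Suc k" if "v \<in> T (i, j)" for v using col[OF that] \<open>Suc k \<in> _\<close> by blast
      then show ?thesis unfolding E_def L_def by (metis le_neq_implies_less less_Suc_eq)
    qed
    show "last_col a (Suc i) \<le> last_col d i"
      by (rule last_col_Suc_le) (use LL dd in \<open>auto simp: a_def d_def\<close>)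
    show "last_col E (Suc i) \<le> last_col E i"
      by (rule last_col_Suc_le) (use LL dd EE in \<open>auto simp: E_def d_def\<close>)
  qed (simp_all add: last_col_def)
  then show thesis by (rule that)
qed

lemma profile_interlaced: "profile T k l D A e \<Longrightarrow> interlaced l D A e"
  by (simp add: profile_def)

lemma profile_mem:
  assumes "profile T k l D A e" "(i, j) \<in> boxes"
  shows "(\<forall>v\<in>T (i, j). v < k) \<longleftrightarrow> j \<le> l i"
    "k \<in> T (i, j) \<longleftrightarrow> l i < j \<and> j \<le> A i" "Suc k \<in> T (i, j) \<longleftrightarrow> D i < j \<and> j \<le> e i"
  using assms by (auto simp: profile_def mem_boxes)

lemma interlacedD:
  assumes "interlaced l D A e"
  shows "1 \<le> i \<Longrightarrow> mu i \<le> l i" "l i \<le> D i" "D i \<le> A i" "A i \<le> Suc (D i)" "A i \<le> e i" "1 \<le> i \<Longrightarrow> e i \<le> lam i"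
    "l (Suc i) \<le> l i" "e (Suc i) \<le> e i" "A (Suc i) \<le> D i"
  using assms unfolding interlaced_def by (cases i; force)+

text \<open>Fixing which boxes meet \<open>{k, Suc k}\<close> makes the outer bounds
  \<open>l\<close> and \<open>e\<close> common to both fillings, so that only \<open>D\<close> and
  \<open>A\<close> can vary.\<close>

definition agree :: "nat \<Rightarrow> filling \<Rightarrow> filling \<Rightarrow> bool" where
  "agree k T T' \<longleftrightarrow> (\<forall>b. T b - {k, Suc k} = T' b - {k, Suc k}) \<and>
     (\<forall>b. k \<in> T b \<or> Suc k \<in> T b \<longleftrightarrow> k \<in> T' b \<or> Suc k \<in> T' b)"

lemma agree_sym: "agree k T T' \<Longrightarrow> agree k T' T"
  unfolding agree_def by simp

lemma agree_trans: "agree k T T' \<Longrightarrow> agree k T' T'' \<Longrightarrow> agree k T T''"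
  unfolding agree_def by simp

lemma agree_mem: "agree k T T' \<Longrightarrow> v \<noteq> k \<Longrightarrow> v \<noteq> Suc k \<Longrightarrow> v \<in> T b \<longleftrightarrow> v \<in> T' b"
  unfolding agree_def by (metis DiffE DiffI insertE singletonD)

lemma agree_block: "agree k T T' \<Longrightarrow> k \<in> T b \<or> Suc k \<in> T b \<longleftrightarrow> k \<in> T' b \<or> Suc k \<in> T' b"
  unfolding agree_def by blast

text \<open>\<open>R\<close> does not distinguish \<open>k\<close> from \<open>k + 1\<close>, so a
  witness among these two letters can be exchanged for the other.\<close>

lemma agree_ex:
  assumes "agree k T T'" "R k \<longleftrightarrow> R (Suc k)"
  shows "(\<exists>u\<in>T b. R u) \<longleftrightarrow> (\<exists>u\<in>T' b. R u)"
proof -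
  have "\<exists>u\<in>T2 b. R u" if ag: "agree k T1 T2" and u: "u \<in> T1 b" "R u" for T1 T2 u
  proof (cases "u = k \<or> u = Suc k")
    case True
    then show ?thesis using agree_block[OF ag, of b] assms(2) u by blast
  next
    case False
    then show ?thesis using agree_mem[OF ag, of u b] u by blast
  qed
  from this[OF assms(1)] this[OF agree_sym[OF assms(1)]] show ?thesis by blast
qed

lemma agree_all_less: "agree k T T' \<Longrightarrow> (\<forall>v\<in>T b. v < k) \<longleftrightarrow> (\<forall>v\<in>T' b. v < k)"
  using agree_ex[of k T T' "\<lambda>v. \<not> v < k" b] by auto

definition refill :: "nat \<Rightarrow> bounds \<Rightarrow> bounds \<Rightarrow> bounds \<Rightarrow> bounds \<Rightarrow> filling \<Rightarrow> box \<Rightarrow> nat set" where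
  "refill k l D A e T = (\<lambda>(i, j). if (i, j) \<in> boxes \<and> l i < j \<and> j \<le> e i
     then T (i, j) - {k, Suc k} \<union> {v. v = k \<and> j \<le> A i} \<union> {v. v = Suc k \<and> D i < j} else T (i, j))"

text \<open>Every other number compares in the same way with \<open>k\<close> and with
  \<open>k + 1\<close>, so the only inequality that can be destroyed is one with
  \<open>k + 1\<close> before \<open>k\<close>.\<close>

lemma swapped_entries_le:
  assumes le: "\<And>x y. x \<in> X \<Longrightarrow> y \<in> Y \<Longrightarrow> x \<le> y"
    and X: "\<And>v. v \<noteq> k \<Longrightarrow> v \<noteq> Suc k \<Longrightarrow> v \<in> X' \<longleftrightarrow> v \<in> X" "k \<in> X' \<or> Suc k \<in> X' \<longleftrightarrow> k \<in> X \<or> Suc k \<in> X"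
    and Y: "\<And>v. v \<noteq> k \<Longrightarrow> v \<noteq> Suc k \<Longrightarrow> v \<in> Y' \<longleftrightarrow> v \<in> Y" "k \<in> Y' \<or> Suc k \<in> Y' \<longleftrightarrow> k \<in> Y \<or> Suc k \<in> Y"
    and no: "\<not> (Suc k \<in> X' \<and> k \<in> Y')"
    and xy: "x \<in> X'" "y \<in> Y'"
  shows "x \<le> (y :: nat)"
proof (rule ccontr)
  assume "\<not> x \<le> y"
  then have lt: "y < x" by simp
  show False
  proof (cases "x = k \<or> x = Suc k")
    case True
    then obtain x' where x': "x' \<in> X" "x' = k \<or> x' = Suc k" using X(2) xy(1) by blast
    show False
    proof (cases "y = k \<or> y = Suc k")
      case True
      with \<open>x = k \<or> x = Suc k\<close> lt have "x = Suc k" "y = k" by auto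
      with no xy show False by simp
    next
      case False
      then have "y \<in> Y" using Y(1) xy(2) by blast
      with le[OF x'(1)] x'(2) have "k \<le> y" by fastforce
      with False lt True show False by auto
    qed
  next
    case False
    then have x: "x \<in> X" using X(1) xy(1) by blast
    show False
    proof (cases "y = k \<or> y = Suc k")
      case True
      then obtain y' where "y' \<in> Y" "y' = k \<or> y' = Suc k" using Y(2) xy(2) by blast
      with le[OF x] have "x \<le> Suc k" by fastforce
      with False lt True show False by auto
    next
      case False
      then have "y \<in> Y" using Y(1) xy(2) by blast
      with le[OF x] lt show False by fastforce
    qed
  qed
qed

lemma interlaced_antimono: "interlaced l D A e \<Longrightarrow> i < i' \<Longrightarrow> A i' \<le> D i"
proof (induction i' rule: less_induct)
  case (less i')
  then obtain m where m: "i' = Suc m" by (cases i') auto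
  show ?case
  proof (cases "i = m")
    case True
    then show ?thesis using interlacedD(9)[OF less.prems(1), of m] m by simp
  next
    case False
    then have "A m \<le> D i" using less m by simp
    then show ?thesis using interlacedD(3,9)[OF less.prems(1), of m] m by simp
  qed
qed

text \<open>Interlacing excludes the pair forbidden in \<open>swapped_entries_le\<close>: along a
  row by \<open>A' i \<le> Suc (D' i)\<close>, down a column by
  \<open>interlaced_antimono\<close>.\<close>

lemma
  assumes T: "T \<in> SVRPP_upto n lam mu" and prof: "profile T k l D A e" and il: "interlaced l D' A' e"
    and k: "1 \<le> k" "Suc k \<le> n"
  shows refill_SVRPP_upto: "refill k l D' A' e T \<in> SVRPP_upto n lam mu"
    and profile_refill: "profile (refill k l D' A' e T) k l D' A' e"
    and agree_refill: "agree k T (refill k l D' A' e T)"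
proof -
  let ?T = "refill k l D' A' e T"
  have TS: "T \<in> fillings" and Tn: "\<And>b. T b \<subseteq> {1..n}"
    using T box_empty by (fastforce simp: SVRPP_upto_def)+
  have il0: "interlaced l D A e" using prof by (rule profile_interlaced)
  note I = interlacedD[OF il] and I0 = interlacedD[OF il0]
  have block: "k \<in> T (i, j) \<or> Suc k \<in> T (i, j) \<longleftrightarrow> l i < j \<and> j \<le> e i" if "(i, j) \<in> boxes" for i j
    using profile_mem[OF prof that] I0[of i] by (auto)
  have mem: "v \<in> ?T (i, j) \<longleftrightarrow> v \<in> T (i, j)" if "v \<noteq> k" "v \<noteq> Suc k" for v i j
    using that by (auto simp: refill_def)
  have out: "?T b = {}" if "b \<notin> boxes" for b
    using that box_empty[OF TS that] by (cases b) (auto simp: refill_def)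
  have memk: "k \<in> ?T (i, j) \<longleftrightarrow> l i < j \<and> j \<le> A' i" if "(i, j) \<in> boxes" for i j
    using block[OF that] that I[of i] by (auto simp: refill_def)
  have memk': "Suc k \<in> ?T (i, j) \<longleftrightarrow> D' i < j \<and> j \<le> e i" if "(i, j) \<in> boxes" for i j
    using block[OF that] that I[of i] by (auto simp: refill_def)
  have block': "k \<in> ?T (i, j) \<or> Suc k \<in> ?T (i, j) \<longleftrightarrow> k \<in> T (i, j) \<or> Suc k \<in> T (i, j)" for i j
  proof (cases "(i, j) \<in> boxes")
    case True
    then show ?thesis using memk[OF True] memk'[OF True] block[OF True] I[of i] by auto
  next
    case False
    then show ?thesis using out[OF False] box_empty[OF TS False] by simp
  qed
  show ag: "agree k T ?T"
    unfolding agree_def using mem block' by fastforce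
  have sub: "?T b \<subseteq> {1..n}" for b
  proof
    fix v assume v: "v \<in> ?T b"
    obtain i j where b: "b = (i, j)" by (cases b)
    show "v \<in> {1..n}"
    proof (cases "v = k \<or> v = Suc k")
      case True then show ?thesis using k by auto
    next
      case False
      then show ?thesis using v mem Tn unfolding b by blast
    qed
  qed
  have ne: "?T b \<noteq> {}" if H: "b \<in> boxes" for b
  proof -
    obtain i j where b: "b = (i, j)" by (cases b)
    obtain v where "v \<in> T b" using box_nonempty[OF TS H] by blast
    then show ?thesis using mem[of v] block' unfolding b by (cases "v = k \<or> v = Suc k") blast+
  qed
  have "?T \<in> fillings"
    unfolding SVRPP_iff
  proof (intro conjI allI impI ballI)
    fix b assume "b \<notin> boxes" then show "?T b = {}" by (rule out)
  next
    fix b assume "b \<in> boxes"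
    then show "?T b \<noteq> {}" by (rule ne)
    show "finite (?T b)" using sub finite_subset by blast
    show "1 \<le> v" if "v \<in> ?T b" for v using sub that by (meson atLeastAtMost_iff subsetD)
  next
    fix i j j' x y
    assume a: "(i, j) \<in> boxes \<and> (i, j') \<in> boxes \<and> j < j'" and xy: "x \<in> ?T (i, j)" "y \<in> ?T (i, j')"
    show "x \<le> y"
    proof (rule swapped_entries_le[OF _ mem block' mem block' _ xy])
      show "x \<le> y" if "x \<in> T (i, j)" "y \<in> T (i, j')" for x y using row_le[OF TS that] a by blast
      show "\<not> (Suc k \<in> ?T (i, j) \<and> k \<in> ?T (i, j'))"
        using a memk[of i j'] memk'[of i j] I(4)[of i] by auto
    qed
  next
    fix i i' j x y
    assume a: "(i, j) \<in> boxes \<and> (i', j) \<in> boxes \<and> i < i'" and xy: "x \<in> ?T (i, j)" "y \<in> ?T (i', j)"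
    show "x \<le> y"
    proof (rule swapped_entries_le[OF _ mem block' mem block' _ xy])
      show "x \<le> y" if "x \<in> T (i, j)" "y \<in> T (i', j)" for x y using column_le[OF TS that] a by blast
      show "\<not> (Suc k \<in> ?T (i, j) \<and> k \<in> ?T (i', j))"
        using a memk[of i' j] memk'[of i j] interlaced_antimono[OF il, of i i'] by auto
    qed
  qed
  then show "?T \<in> SVRPP_upto n lam mu" using sub by (simp add: SVRPP_upto_def)
  show "profile ?T k l D' A' e"
    unfolding profile_def
  proof (intro conjI allI impI ballI il)
    fix i j assume "1 \<le> i" "j \<in> cols i"
    then have b: "(i, j) \<in> boxes" by (simp add: mem_boxes)
    have "(\<forall>v\<in>?T (i, j). v < k) \<longleftrightarrow> (\<forall>v\<in>T (i, j). v < k)"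
      by (rule agree_all_less[OF ag, symmetric])
    then show "(\<forall>v\<in>?T (i, j). v < k) \<longleftrightarrow> j \<le> l i" using profile_mem(1)[OF prof b] by simp
    show "k \<in> ?T (i, j) \<longleftrightarrow> l i < j \<and> j \<le> A' i" by (rule memk[OF b])
    show "Suc k \<in> ?T (i, j) \<longleftrightarrow> D' i < j \<and> j \<le> e i" by (rule memk'[OF b])
  qed
qed

end

section \<open>Row words in terms of the two letters\<close>

abbreviation "k_part k \<equiv> filter (\<lambda>c. c = k \<or> c = Suc k)"

lemma hgt_filter: "hgt k w = hgt k (k_part k w)"
  by (induction w) auto

lemma hgt_replicate [simp]: "hgt k (replicate n (Suc k)) = int n" "hgt k (replicate n k) = - int n"
  by (induction n) auto

text \<open>From the right, the height first rises to \<open>q\<close>, then falls by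
  \<open>p\<close>, then rises by \<open>m\<close>; its maximum is at the end of one of the two
  rises.\<close>

lemma hgt_suffix_blocks:
  assumes "k_part k (x @ y) = replicate m (Suc k) @ replicate p k @ replicate q (Suc k)"
  shows "hgt k y \<le> max (int q) (int q - int p + int m)"
proof -
  define d where "d = length (k_part k x)"
  have "k_part k y = drop d (replicate m (Suc k) @ replicate p k @ replicate q (Suc k))"
    unfolding d_def assms[symmetric] by simp
  then have "hgt k y = int (m - d) - int (p - (d - m)) + int (q - (d - m - p))"
    by (subst hgt_filter) simp
  then show ?thesis by linarith
qed

text \<open>
  The word \<open>(k + 1)\<^sup>m k\<^sup>p (k + 1)\<^sup>q\<close> with \<open>S\<close> inserted after \<open>b\<close> of the last \<open>p + q\<close> letters: if the
  leftmost box of a row that meets \<open>{k, k + 1}\<close> has an entry below \<open>k\<close>, then \<open>b = 1\<close>, because one of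
  these letters is not a pivot and hence read before the smaller letters.
\<close>

definition block_word :: "nat \<Rightarrow> nat \<Rightarrow> nat \<Rightarrow> nat \<Rightarrow> nat \<Rightarrow> nat list \<Rightarrow> nat list" where
  "block_word k b m p q S =
     replicate (m + (b - min b p)) (Suc k) @ replicate (min b p) k @ S @
     replicate (p - min b p) k @ replicate (q - (b - min b p)) (Suc k)"

text \<open>Enlarging \<open>p\<close> at the expense of \<open>q\<close> changes just the letter at
  the boundary of the two groups. If \<open>b = 1\<close> and \<open>p = 0\<close>, this letter
  stands in front of \<open>S\<close>, hence the case distinction.\<close>

lemma block_word_change:
  assumes "b \<le> 1" "1 \<le> q" "k \<notin> set S" "Suc k \<notin> set S"
    and B: "k_part k B1 = []" "k \<notin> set B2" "Suc k \<notin> set B2"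
  obtains u v where "B1 @ block_word k b m p q S @ B2 = u @ Suc k # v"
    "B1 @ block_word k b m (Suc p) (q - 1) S @ B2 = u @ k # v"
    "k_part k u = replicate m (Suc k) @ replicate p k"
    "count_list v (Suc k) = q - 1" "count_list v k = 0"
proof -
  have S: "k_part k S = []" "count_list S k = 0" "count_list S (Suc k) = 0"
    "count_list B2 k = 0" "count_list B2 (Suc k) = 0"
    using assms(3-) by (auto simp: filter_empty_conv count_list_0_iff)
  have rep: "count_list (replicate n c) d = (if c = d then n else 0)" for n and c d :: nat
    by (induction n) auto
  obtain q' where q: "q = Suc q'" using assms(2) by (cases q) auto
  show thesis
  proof (cases "b = 1 \<and> p = 0")
    case True
    show ?thesis
      by (rule that[of "B1 @ replicate m (Suc k)" "S @ replicate q' (Suc k) @ B2"])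
        (use True q S B(1) rep in \<open>auto simp: block_word_def replicate_append_same[symmetric]\<close>)
  next
    case False
    then have b: "min b p = b" using assms(1) by auto
    show ?thesis
      by (rule that[of "B1 @ replicate m (Suc k) @ replicate b k @ S @ replicate (p - b) k" "replicate q' (Suc k) @ B2"])
        (use b q S B(1) rep in \<open>auto simp: block_word_def Suc_diff_le replicate_append_same[symmetric] min_def
           replicate_add[symmetric] split: if_splits\<close>)
  qed
qed

context skew_shape
begin

definition low :: "filling \<Rightarrow> nat \<Rightarrow> nat \<Rightarrow> nat" where
  "low T k i = of_bool (\<exists>j\<in>cols i. (k \<in> T (i, j) \<or> Suc k \<in> T (i, j)) \<and> (\<exists>v\<in>T (i, j). v < k))"

lemma low_le_1: "low T k i \<le> 1"
  by (simp add: low_def)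

context
  fixes T k l D A e
  assumes T: "T \<in> fillings" and prof: "profile T k l D A e"
begin

lemmas chain = interlacedD[OF profile_interlaced[OF prof]]

text \<open>The box in column \<open>Suc (l i)\<close> has an entry at least \<open>k\<close>, so no
  box further right has an entry below \<open>k\<close>.\<close>

lemma low_box:
  assumes "(i, j) \<in> boxes" "k \<in> T (i, j) \<or> Suc k \<in> T (i, j)" "v \<in> T (i, j)" "v < k"
  shows "j = Suc (l i) \<and> low T k i = 1"
proof -
  have "l i < j"
  proof (rule ccontr)
    assume "\<not> l i < j"
    then have "\<forall>v\<in>T (i, j). v < k" using profile_mem(1)[OF prof assms(1)] by simp
    with assms(2) show False by force
  qed
  moreover have "\<not> Suc (l i) < j"
  proof
    assume lt: "Suc (l i) < j"
    have "(i, Suc (l i)) \<in> boxes" using lt assms(1) chain(1)[of i] by (simp add: mem_boxes)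
    moreover from profile_mem(1)[OF prof this] obtain w where "w \<in> T (i, Suc (l i))" "\<not> w < k" by auto
    ultimately show False using row_le[OF T _ assms(3) lt, of w] assms(4) by simp
  qed
  moreover have "low T k i = 1" using assms by (auto simp: low_def mem_boxes)
  ultimately show ?thesis by simp
qed

text \<open>An entry below \<open>k\<close> forces all entries above it in its column below
  \<open>k\<close>. So the special box lies weakly left of column \<open>l i\<close>, and its letter
  \<open>k\<close> or \<open>k + 1\<close> is never hidden by the row above.\<close>

lemma low_Suc:
  assumes "low T k (Suc i) = 1"
  shows "l (Suc i) < e (Suc i)" "l (Suc i) < l i" "\<exists>v\<in>T (Suc i, Suc (l (Suc i))). v < k"
proof -
  obtain j v where jv: "j \<in> cols (Suc i)" "k \<in> T (Suc i, j) \<or> Suc k \<in> T (Suc i, j)"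
    "v \<in> T (Suc i, j)" "v < k"
  proof -
    have "\<exists>j\<in>cols (Suc i). (k \<in> T (Suc i, j) \<or> Suc k \<in> T (Suc i, j)) \<and> (\<exists>v\<in>T (Suc i, j). v < k)"
      using assms unfolding low_def of_bool_eq_1_iff .
    then show ?thesis using that by blast
  qed
  have box: "(Suc i, j) \<in> boxes" using jv(1) by (simp add: mem_boxes)
  then have j: "j = Suc (l (Suc i))" using low_box jv by blast
  show "\<exists>v\<in>T (Suc i, Suc (l (Suc i))). v < k" using jv j by blast
  show "l (Suc i) < e (Suc i)"
    using jv(2) profile_mem[OF prof box] j chain(5)[of "Suc i"] by auto
  show "l (Suc i) < l i"
  proof (rule ccontr)
    assume "\<not> l (Suc i) < l i"
    then have le: "l i < j" using j by simp
    then have i: "i \<noteq> 0" using profile_interlaced[OF prof] jv(1) by (cases i) (auto simp: interlaced_def)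
    then have box': "(i, j) \<in> boxes"
      using le jv(1) chain(1)[of i] lam_antimono[of i "Suc i"] by (simp add: mem_boxes)
    then obtain w where "w \<in> T (i, j)" "\<not> w < k" using profile_mem(1)[OF prof box'] le by auto
    with column_le[OF T this(1) jv(3)] jv(4) show False by simp
  qed
qed

lemma box_above:
  assumes "(Suc i, j) \<in> boxes" "c < j" "c = l i \<or> c = D i"
  shows "(i, j) \<in> boxes"
proof -
  have "i \<noteq> 0" using assms profile_interlaced[OF prof] by (cases i) (auto simp: interlaced_def mem_boxes)
  moreover have "mu i < j" using \<open>i \<noteq> 0\<close> assms(2,3) chain(1,2)[of i] by auto
  ultimately show ?thesis using assms(1) lam_antimono[of i "Suc i"] by (simp add: mem_boxes)
qed

text \<open>A \<open>c\<close> is omitted exactly when the box above contains \<open>c\<close> too,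
  since column order makes it the maximum there; this cuts off the columns beyond
  \<open>lo i\<close>. The instances are \<open>k\<close> with bounds \<open>l\<close>,
  \<open>A\<close> and \<open>k + 1\<close> with bounds \<open>D\<close>, \<open>e\<close>.\<close>

lemma count_row_word_columns:
  assumes c: "\<And>i j. (i, j) \<in> boxes \<Longrightarrow> c \<in> T (i, j) \<longleftrightarrow> lo i < j \<and> j \<le> hi i"
    and lo: "lo = l \<or> lo = D" and hi: "\<And>i. hi (Suc i) \<le> hi i" "\<And>i. 1 \<le> i \<Longrightarrow> hi i \<le> lam i"
  shows "count_list (row_letters T (Suc i)) c = min (hi (Suc i)) (lo i) - lo (Suc i)"
proof -
  have "{j \<in> cols (Suc i). c \<in> T (Suc i, j) \<and> \<not> ((Suc i - 1, j) \<in> boxes \<and> c = Max (T (Suc i - 1, j)))}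
      = {lo (Suc i)<..min (hi (Suc i)) (lo i)}"
  proof (rule set_eqI)
    fix j
    let ?o = "(i, j) \<in> boxes \<and> c = Max (T (i, j))"
    have row: "j \<in> cols (Suc i)" if "lo (Suc i) < j" "j \<le> hi (Suc i)"
      using that lo hi(2)[of "Suc i"] chain(1,2)[of "Suc i"] by auto
    have o: "?o \<longleftrightarrow> lo i < j" if b: "(Suc i, j) \<in> boxes" and cT: "c \<in> T (Suc i, j)"
    proof
      assume ?o
      then have "c \<in> T (i, j)" using Max_in_box[OF T, of "(i, j)"] by simp
      then show "lo i < j" using c[of i j] \<open>?o\<close> by simp
    next
      assume lj: "lo i < j"
      have b': "(i, j) \<in> boxes" by (rule box_above[OF b lj]) (use lo in auto)
      have "c \<in> T (i, j)" using cT c[OF b] c[OF b'] hi(1)[of i] lj by simp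
      moreover have "v \<le> c" if "v \<in> T (i, j)" for v using column_le[OF T that cT] by simp
      ultimately show ?o using b' box_finite[OF T] by (simp add: Max_eqI[symmetric])
    qed
    show "j \<in> {j \<in> cols (Suc i). c \<in> T (Suc i, j) \<and> \<not> ((Suc i - 1, j) \<in> boxes \<and> c = Max (T (Suc i - 1, j)))}
      \<longleftrightarrow> j \<in> {lo (Suc i)<..min (hi (Suc i)) (lo i)}"
      using o row c[of "Suc i" j] by (auto simp: mem_boxes)
  qed
  then show ?thesis using count_row_word[OF T, of "Suc i" c] by simp
qed

lemma count_row_word_k: "count_list (row_letters T (Suc i)) k = min (A (Suc i)) (l i) - l (Suc i)"
proof (rule count_row_word_columns)
  fix i
  show "A (Suc i) \<le> A i" using chain(3,9)[of i] by simp
  show "1 \<le> i \<Longrightarrow> A i \<le> lam i" using chain(5,6)[of i] by simp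
qed (simp_all add: profile_mem(2)[OF prof])

lemma count_row_word_Suc_k:
  "count_list (row_letters T (Suc i)) (Suc k) = min (e (Suc i)) (D i) - D (Suc i)"
  by (rule count_row_word_columns) (simp_all add: profile_mem(3)[OF prof] chain)

text \<open>The letter \<open>k\<close> fails to be a pivot only next to a smaller entry, that is,
  in the special box.\<close>

lemma count_nonpivots_k:
  "count_list (nonpivots T (Suc i)) k = min (low T k (Suc i)) (min (A (Suc i)) (l i) - l (Suc i))"
proof -
  note I = chain
  let ?X = "{j \<in> cols (Suc i). k \<in> T (Suc i, j) \<and> k \<noteq> Min (T (Suc i, j))}"
  let ?j = "Suc (l (Suc i))"
  have X: "j = ?j \<and> low T k (Suc i) = 1 \<and> l (Suc i) < A (Suc i)" if "j \<in> ?X" for j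
  proof -
    have b: "(Suc i, j) \<in> boxes" using that by (simp add: mem_boxes)
    have "Min (T (Suc i, j)) \<le> k" using that Min_box_le[OF T] by simp
    then have "Min (T (Suc i, j)) < k" using that by simp
    with low_box[OF b _ Min_in_box[OF T b]] that profile_mem(2)[OF prof b] show ?thesis by auto
  qed
  show ?thesis
  proof (cases "low T k (Suc i) = 1 \<and> l (Suc i) < A (Suc i)")
    case True
    have b: "(Suc i, ?j) \<in> boxes" using True I(1,5,6)[of "Suc i"] by (simp add: mem_boxes)
    have "k \<in> T (Suc i, ?j)" using True profile_mem(2)[OF prof b] by simp
    moreover obtain v where "v \<in> T (Suc i, ?j)" "v < k" using low_Suc(3) True by blast
    ultimately have "?j \<in> ?X" using b Min_box_le[OF T, of v "(Suc i, ?j)"] by (auto simp: mem_boxes)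
    then have "?X = {?j}" using X by blast
    then have "count_list (nonpivots T (Suc i)) k = 1" by (simp add: count_nonpivots[OF T])
    then show ?thesis using True low_Suc(2)[of i] by (auto simp: min_def)
  next
    case False
    then have "?X = {}" using X by blast
    then have "count_list (nonpivots T (Suc i)) k = 0" unfolding count_nonpivots[OF T] by simp
    moreover have "low T k (Suc i) = 0 \<or> A (Suc i) = l (Suc i)"
      using False low_le_1[of T k "Suc i"] I(2,3)[of "Suc i"] by auto
    ultimately show ?thesis by auto
  qed
qed

text \<open>The letter \<open>k + 1\<close> fails to be a pivot in the box that contains both
  letters, and in the special box if that box has no \<open>k\<close>.\<close>

lemma count_nonpivots_Suc_k:
  "count_list (nonpivots T (Suc i)) (Suc k) = (A (Suc i) - D (Suc i)) +
     (low T k (Suc i) - min (low T k (Suc i)) (min (A (Suc i)) (l i) - l (Suc i)))"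
proof -
  note I = chain
  let ?X = "{j \<in> cols (Suc i). Suc k \<in> T (Suc i, j) \<and> Suc k \<noteq> Min (T (Suc i, j))}"
  let ?j = "Suc (l (Suc i))"
  let ?c = "low T k (Suc i) = 1 \<and> A (Suc i) = l (Suc i)"
  have "?X = {D (Suc i)<..A (Suc i)} \<union> (if ?c then {?j} else {})"
  proof (intro equalityI subsetI)
    fix j assume j: "j \<in> ?X"
    then have b: "(Suc i, j) \<in> boxes" by (simp add: mem_boxes)
    have "Min (T (Suc i, j)) \<le> Suc k" using j Min_box_le[OF T] by simp
    with j consider "Min (T (Suc i, j)) = k" | "Min (T (Suc i, j)) < k" by fastforce
    then show "j \<in> {D (Suc i)<..A (Suc i)} \<union> (if ?c then {?j} else {})"
    proof cases
      case 1
      then have "k \<in> T (Suc i, j)" using Min_in_box[OF T b] by simp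
      then show ?thesis using profile_mem(2,3)[OF prof b] j by simp
    next
      case 2
      then have "j = ?j \<and> low T k (Suc i) = 1" using low_box[OF b _ Min_in_box[OF T b]] j by blast
      then show ?thesis using profile_mem(3)[OF prof b] j I(2,3)[of "Suc i"] by auto
    qed
  next
    fix j assume j: "j \<in> {D (Suc i)<..A (Suc i)} \<union> (if ?c then {?j} else {})"
    show "j \<in> ?X"
    proof (cases "j \<in> {D (Suc i)<..A (Suc i)}")
      case True
      then have b: "(Suc i, j) \<in> boxes" using I(1,2,5,6)[of "Suc i"] by (simp add: mem_boxes)
      have "k \<in> T (Suc i, j)" "Suc k \<in> T (Suc i, j)"
        using profile_mem(2,3)[OF prof b] True I(2,5)[of "Suc i"] by auto
      moreover have "Min (T (Suc i, j)) \<le> k" using Min_box_le[OF T] calculation(1) .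
      ultimately show ?thesis using b by (auto simp: mem_boxes)
    next
      case False
      with j have c: ?c "j = ?j" by (auto split: if_splits)
      have lt: "l (Suc i) < e (Suc i)" using low_Suc(1) c(1) by blast
      have b: "(Suc i, j) \<in> boxes" using lt c(2) I(1,6)[of "Suc i"] by (simp add: mem_boxes)
      have "Suc k \<in> T (Suc i, j)" using profile_mem(3)[OF prof b] c lt I(2,3)[of "Suc i"] by auto
      moreover obtain v where "v \<in> T (Suc i, j)" "v < k" using low_Suc(3) c by blast
      ultimately show ?thesis using b Min_box_le[OF T, of v "(Suc i, j)"] by (auto simp: mem_boxes)
    qed
  qed
  moreover have "card \<dots> = (A (Suc i) - D (Suc i)) + of_bool ?c"
    using I(2)[of "Suc i"] by (auto simp: card_insert_if)
  moreover have "of_bool ?c = low T k (Suc i) - min (low T k (Suc i)) (min (A (Suc i)) (l i) - l (Suc i))"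
    using low_le_1[of T k "Suc i"] low_Suc(2)[of i] I(2,3)[of "Suc i"]
    by (cases "low T k (Suc i) = 1") auto
  ultimately show ?thesis by (simp add: count_nonpivots[OF T])
qed

lemma row_word_block:
  "row_letters T (Suc i) = filter ((<) (Suc k)) (nonpivots T (Suc i)) @
    block_word k (low T k (Suc i)) (A (Suc i) - D (Suc i)) (min (A (Suc i)) (l i) - l (Suc i))
      (min (e (Suc i)) (D i) - A (Suc i))
      (filter (\<lambda>x. x < k) (nonpivots T (Suc i)) @ filter (\<lambda>x. x < k) (pivots T (Suc i))) @
    filter ((<) (Suc k)) (pivots T (Suc i))"
proof -
  note I = chain
  let ?p = "min (A (Suc i)) (l i) - l (Suc i)" and ?q = "min (e (Suc i)) (D i) - A (Suc i)"
  let ?b = "low T k (Suc i)" and ?m = "A (Suc i) - D (Suc i)"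
  have "count_list (nonpivots T (Suc i)) k + count_list (pivots T (Suc i)) k = ?p"
    using count_row_word_k[of i] unfolding row_word_eq by simp
  then have y0: "count_list (pivots T (Suc i)) k = ?p - min ?b ?p"
    unfolding count_nonpivots_k by linarith
  have "count_list (nonpivots T (Suc i)) (Suc k) + count_list (pivots T (Suc i)) (Suc k) = min (e (Suc i)) (D i) - D (Suc i)"
    using count_row_word_Suc_k[of i] unfolding row_word_eq by simp
  also have "\<dots> = ?m + ?q" using I(3,5,9)[of "Suc i"] I(9)[of i] by simp
  finally have y1: "count_list (pivots T (Suc i)) (Suc k) = ?q - (?b - min ?b ?p)"
    unfolding count_nonpivots_Suc_k by linarith
  show ?thesis
    using row_word_split[OF T, of "Suc i" k]
    unfolding block_word_def y0 y1 count_nonpivots_k count_nonpivots_Suc_k by simp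
qed

end

end

context skew_shape
begin

section \<open>What agreement outside \<open>k\<close> and \<open>k + 1\<close> preserves\<close>

lemma sum_card_profile:
  assumes T: "T \<in> fillings" and prof: "profile T k l D A e" and i: "1 \<le> i"
  shows "(\<Sum>j\<in>cols i. card (T (i, j))) =
    (\<Sum>j\<in>cols i. card (T (i, j) - {k, Suc k})) + (A i - l i) + (e i - D i)"
proof -
  let ?C = "cols i"
  note I = interlacedD[OF profile_interlaced[OF prof]]
  have "card (T (i, j)) = card (T (i, j) - {k, Suc k}) + (if k \<in> T (i, j) then 1 else 0) +
      (if Suc k \<in> T (i, j) then 1 else 0)" for j
  proof -
    have "card (T (i, j)) = card (T (i, j) - {k, Suc k}) + card (T (i, j) \<inter> {k, Suc k})"
      using box_finite[OF T] by (metis card_Int_Diff add.commute)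
    also have "T (i, j) \<inter> {k, Suc k} = (if k \<in> T (i, j) then {k} else {}) \<union> (if Suc k \<in> T (i, j) then {Suc k} else {})"
      by auto
    finally show ?thesis by simp
  qed
  then have "(\<Sum>j\<in>?C. card (T (i, j))) = (\<Sum>j\<in>?C. card (T (i, j) - {k, Suc k})) +
      card {j \<in> ?C. k \<in> T (i, j)} + card {j \<in> ?C. Suc k \<in> T (i, j)}"
    by (simp add: sum.distrib sum.inter_filter[symmetric])
  moreover have "{j \<in> ?C. k \<in> T (i, j)} = {l i<..A i}"
    using profile_mem(2)[OF prof, of i] I(1,5,6)[of i] i by (auto simp: mem_boxes)
  moreover have "{j \<in> ?C. Suc k \<in> T (i, j)} = {D i<..e i}"
    using profile_mem(3)[OF prof, of i] I(1,2,6)[of i] i by (auto simp: mem_boxes)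
  ultimately show ?thesis by simp
qed

lemma agree_low: "agree k T T' \<Longrightarrow> low T k i = low T' k i"
  unfolding low_def by (simp add: agree_block agree_ex)

text \<open>Not being the pivot is rephrased as having a smaller entry in the box, a condition to
  which \<open>agree_ex\<close> applies.\<close>

lemma filter_nonpivots:
  assumes T: "T \<in> fillings" and i: "1 \<le> i"
  shows "filter P (nonpivots T i) = concat (map (\<lambda>j. rev (sorted_list_of_set
    {v \<in> T (i, j). (\<exists>u\<in>T (i, j). u < v) \<and> P v})) (rev (row_cols lam mu i)))"
proof -
  have "{v \<in> T (i, j) - {pivot T (i, j)}. P v} = {v \<in> T (i, j). (\<exists>u\<in>T (i, j). u < v) \<and> P v}"
    if "j \<in> cols i" for j
  proof -
    have b: "(i, j) \<in> boxes" using that i by (simp add: mem_boxes)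
    have "v \<noteq> Min (T (i, j)) \<longleftrightarrow> (\<exists>u\<in>T (i, j). u < v)" if "v \<in> T (i, j)" for v
      using Min_in_box[OF T b] Min_box_le[OF T] that by (metis leD le_neq_implies_less)
    then show ?thesis by (auto simp: pivot_def)
  qed
  then show ?thesis
    unfolding nonpivots_def filter_concat map_map comp_def rev_filter[symmetric]
    using box_finite[OF T]
    by (intro arg_cong[where f = concat] map_cong) (simp_all add: filter_sorted_list_of_set set_row_cols)
qed

context
  fixes k T T' P
  assumes ag: "agree k T T'" and T: "T \<in> fillings" and T': "T' \<in> fillings"
    and P: "\<And>v. P v \<Longrightarrow> v < k \<or> Suc k < v"
begin

lemma agree_mem_P: "P v \<Longrightarrow> v \<in> T b \<longleftrightarrow> v \<in> T' b"
  using agree_mem[OF ag, of v b] P[of v] by auto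

lemma agree_less_P: "P v \<Longrightarrow> (\<exists>u\<in>T b. u < v) \<longleftrightarrow> (\<exists>u\<in>T' b. u < v)"
  by (rule agree_ex[OF ag]) (use P[of v] in auto)

lemma agree_greater_P: "P v \<Longrightarrow> (\<exists>u\<in>T b. v < u) \<longleftrightarrow> (\<exists>u\<in>T' b. v < u)"
  by (rule agree_ex[OF ag]) (use P[of v] in auto)

lemma agree_filter_nonpivots:
  assumes i: "1 \<le> i"
  shows "filter P (nonpivots T i) = filter P (nonpivots T' i)"
proof -
  have "{v \<in> T b. (\<exists>u\<in>T b. u < v) \<and> P v} = {v \<in> T' b. (\<exists>u\<in>T' b. u < v) \<and> P v}" for b
    using agree_mem_P agree_less_P by blast
  then show ?thesis unfolding filter_nonpivots[OF T i] filter_nonpivots[OF T' i] by simp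
qed

text \<open>Whether a letter outside \<open>{k, Suc k}\<close> is the minimum or maximum of its box
  depends only on the other such letters and on whether the box meets \<open>{k, Suc k}\<close>. So
  neither the pivots nor their omission change.\<close>

lemma agree_filter_pivots:
  assumes i: "1 \<le> i"
  shows "filter P (pivots T i) = filter P (pivots T' i)"
proof -
  have Min: "Min (T b) = v \<longleftrightarrow> Min (T' b) = v" and Max: "Max (T b) = v \<longleftrightarrow> Max (T' b) = v"
    if b: "b \<in> boxes" and v: "P v" for b v
  proof -
    note fin = box_finite[OF T] box_nonempty[OF T b] box_finite[OF T'] box_nonempty[OF T' b]
    show "Min (T b) = v \<longleftrightarrow> Min (T' b) = v"
      using agree_mem_P[OF v, of b] agree_less_P[OF v, of b] fin by (simp add: Min_eq_iff) (meson not_less)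
    show "Max (T b) = v \<longleftrightarrow> Max (T' b) = v"
      using agree_mem_P[OF v, of b] agree_greater_P[OF v, of b] fin by (simp add: Max_eq_iff) (meson not_less)
  qed
  have iff: "kept T i j \<and> P (pivot T (i, j)) \<longleftrightarrow> kept T' i j \<and> P (pivot T' (i, j))"
    and eq: "P (pivot T' (i, j)) \<Longrightarrow> pivot T (i, j) = pivot T' (i, j)"
    if "j \<in> set (row_cols lam mu i)" for j
  proof -
    have b: "(i, j) \<in> boxes" using that i by (simp add: set_row_cols mem_boxes)
    show "P (pivot T' (i, j)) \<Longrightarrow> pivot T (i, j) = pivot T' (i, j)"
      unfolding pivot_def using Min[OF b] by simp
    show "kept T i j \<and> P (pivot T (i, j)) \<longleftrightarrow> kept T' i j \<and> P (pivot T' (i, j))"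
      unfolding kept_def pivot_def using Min[OF b] Max[of "(i - 1, j)"] by metis
  qed
  have "filter P (pivots T i) =
      map (\<lambda>j. pivot T (i, j)) (filter (\<lambda>j. kept T i j \<and> P (pivot T (i, j))) (row_cols lam mu i))"
    by (simp add: pivots_def filter_map comp_def)
  also have "\<dots> = map (\<lambda>j. pivot T' (i, j)) (filter (\<lambda>j. kept T' i j \<and> P (pivot T' (i, j))) (row_cols lam mu i))"
  proof (rule map_cong)
    show "filter (\<lambda>j. kept T i j \<and> P (pivot T (i, j))) (row_cols lam mu i) =
        filter (\<lambda>j. kept T' i j \<and> P (pivot T' (i, j))) (row_cols lam mu i)"
      using iff by (rule filter_cong[OF refl])
  qed (simp add: eq)
  also have "\<dots> = filter P (pivots T' i)"
    by (simp add: pivots_def filter_map comp_def)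
  finally show ?thesis .
qed

end

definition small_letters :: "filling \<Rightarrow> nat \<Rightarrow> nat \<Rightarrow> nat list" where
  "small_letters T k i = filter (\<lambda>x. x < k) (nonpivots T i) @ filter (\<lambda>x. x < k) (pivots T i)"

text \<open>
  All that depends on \<open>D\<close> and \<open>A\<close> in the word of a row is a block of letters \<open>k\<close> and \<open>k + 1\<close>,
  which up to the letters \<open>< k\<close> reads \<open>(k + 1)\<^sup>m k\<^sup>p (k + 1)\<^sup>q\<close>.
\<close>

lemma row_word_refilled:
  assumes T: "T \<in> fillings" and prof: "profile T k l D A e"
    and T': "T' \<in> fillings" and prof': "profile T' k l D' A' e" and ag: "agree k T T'"
  shows "row_letters T' (Suc i) = filter ((<) (Suc k)) (nonpivots T (Suc i)) @
    block_word k (low T k (Suc i)) (A' (Suc i) - D' (Suc i)) (min (A' (Suc i)) (l i) - l (Suc i))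
      (min (e (Suc i)) (D' i) - A' (Suc i)) (small_letters T k (Suc i)) @
    filter ((<) (Suc k)) (pivots T (Suc i))"
proof -
  have "filter P (nonpivots T' (Suc i)) = filter P (nonpivots T (Suc i))"
    "filter P (pivots T' (Suc i)) = filter P (pivots T (Suc i))" if "\<And>v. P v \<Longrightarrow> v < k \<or> Suc k < v" for P
    using agree_filter_nonpivots[OF ag T T' that] agree_filter_pivots[OF ag T T' that] by simp_all
  then show ?thesis
    unfolding row_word_block[OF T' prof'] small_letters_def agree_low[OF ag] by simp
qed

end

lemma filter_block_word:
  assumes "k \<notin> set S" "Suc k \<notin> set S" "b \<le> 1" "b \<le> p + q"
  shows "k_part k (block_word k b m p q S) =
    replicate m (Suc k) @ replicate p k @ replicate q (Suc k)"
proof -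
  have S: "k_part k S = []" using assms(1,2) by (auto simp: filter_empty_conv)
  show ?thesis
  proof (cases "b = 1 \<and> p = 0")
    case True
    with assms(4) obtain q' where "q = Suc q'" by (cases q) auto
    then show ?thesis using True S by (simp add: block_word_def replicate_append_same[symmetric])
  next
    case False
    then have b: "min b p = b" "b + (p - b) = p" using assms(3) by auto
    have "replicate b k @ replicate (p - b) k = replicate p k"
      using b(2) by (simp flip: replicate_add)
    then have "replicate b k @ replicate (p - b) k @ z = replicate p k @ z" for z
      by (metis append_assoc)
    then show ?thesis using S b(1) by (simp add: block_word_def)
  qed
qed

lemma filter_large_letters: "k_part k (filter ((<) (Suc k)) w) = []"
  by (auto simp: filter_empty_conv)

lemma large_letters_notin: "k \<notin> set (filter ((<) (Suc k)) w)" "Suc k \<notin> set (filter ((<) (Suc k)) w)"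
  by auto

text \<open>Rows give control over heights of suffixes, so the bracket conditions are restated:
  \<open>Suc k # v\<close> is the shortest suffix of maximal height.\<close>

lemma raises_by_heights:
  assumes "\<And>x y. u @ Suc k # v = x @ y \<Longrightarrow> hgt k y \<le> hgt k v + 1"
    and "\<And>x y. v = x @ y \<Longrightarrow> hgt k y \<le> hgt k v"
  shows "raises k (u @ Suc k # v) (u @ k # v)"
  unfolding raises_def
proof (rule exI[of _ u], rule exI[of _ v], intro conjI refl allI impI)
  fix x y
  show "hgt k y \<le> 0" if "u = x @ y" using assms(1)[of x "y @ Suc k # v"] that by simp
  show "0 \<le> hgt k x" if "v = x @ y" using assms(2)[OF that] that by simp
qed

text \<open>Seen from the lowered word, \<open>v\<close> is the longest suffix of maximal
  height.\<close>

lemma lowers_by_heights: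
  assumes "\<And>x y. v = x @ y \<Longrightarrow> hgt k y \<le> hgt k v"
    and "\<And>x y. u = x @ y \<Longrightarrow> hgt k (y @ k # v) < hgt k v"
  shows "raises k (u @ Suc k # v) (u @ k # v)"
  unfolding raises_def
proof (rule exI[of _ u], rule exI[of _ v], intro conjI refl allI impI)
  fix x y
  show "hgt k y \<le> 0" if "u = x @ y" using assms(2)[OF that] by simp
  show "0 \<le> hgt k x" if "v = x @ y" using assms(1)[OF that] that by simp
qed

lemma hgt_le_count: "hgt k w \<le> int (count_list w (Suc k))"
  by (simp add: hgt_def)

context skew_shape
begin

text \<open>Rows are read bottom to top, so rows 1 to \<open>i\<close> contribute a suffix of the
  reading word. The name refers to row numbers, not to the position in the shape.\<close>

definition below :: "filling \<Rightarrow> nat \<Rightarrow> nat list" where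
  "below T i = concat (map (row_letters T) (rev [1..<Suc i]))"

lemma below_simps [simp]:
  "below T 0 = []" "below T (Suc i) = row_letters T (Suc i) @ below T i"
  by (simp_all add: below_def)

lemma reading_word_eq: "reading T = below T (num_rows lam)"
  by (simp add: reading_word_def below_def)

lemma row_word_Nil: "num_rows lam < i \<Longrightarrow> row_letters T i = []"
  using lam_eq_0[of i] mu_le_lam[of i] by (simp add: row_word_def row_cols_def)

lemma below_eq_reading_word: "num_rows lam \<le> i \<Longrightarrow> below T i = reading T"
proof (induction i)
  case (Suc i)
  show ?case
  proof (cases "num_rows lam \<le> i")
    case True
    then show ?thesis using Suc row_word_Nil[of "Suc i" T] by simp
  next
    case False
    then have "Suc i = num_rows lam" using Suc.prems by simp
    then show ?thesis by (simp only: reading_word_eq)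
  qed
qed (simp add: reading_word_eq)

lemma below_cong: "(\<And>i. i < r \<Longrightarrow> row_letters T' (Suc i) = row_letters T (Suc i)) \<Longrightarrow> below T' r = below T r"
  by (induction r) auto

text \<open>The last clause locates a suffix that starts left of the changed row: it begins inside
  the word of one row \<open>Suc i\<close> and continues with complete rows. Lowering needs this to
  bound the heights of such suffixes.\<close>

lemma below_replace:
  assumes "r < N" "\<And>i. i \<noteq> r \<Longrightarrow> row_letters T' (Suc i) = row_letters T (Suc i)"
  obtains h where "below T N = h @ row_letters T (Suc r) @ below T r"
    "below T' N = h @ row_letters T' (Suc r) @ below T r"
    "\<forall>x y. h = x @ y \<longrightarrow> y \<noteq> [] \<longrightarrow> (\<exists>i y'. r < i \<and> i < N \<and> (\<exists>x'. row_letters T (Suc i) = x' @ y') \<and>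
       y @ row_letters T (Suc r) @ below T r = y' @ below T i)"
proof -
  have "\<exists>h. below T N = h @ row_letters T (Suc r) @ below T r \<and>
    below T' N = h @ row_letters T' (Suc r) @ below T r \<and>
    (\<forall>x y. h = x @ y \<longrightarrow> y \<noteq> [] \<longrightarrow> (\<exists>i y'. r < i \<and> i < N \<and> (\<exists>x'. row_letters T (Suc i) = x' @ y') \<and>
       y @ row_letters T (Suc r) @ below T r = y' @ below T i))"
    using assms(1)
  proof (induction N)
    case (Suc N)
    show ?case
    proof (cases "r = N")
      case True
      have "below T' r = below T r" by (rule below_cong) (use assms(2) in simp)
      then show ?thesis using True by (intro exI[of _ "[]"]) simp
    next
      case False
      then have "r < N" using Suc.prems by simp
      with Suc.IH obtain h where h: "below T N = h @ row_letters T (Suc r) @ below T r"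
        "below T' N = h @ row_letters T' (Suc r) @ below T r"
        "\<And>x y. h = x @ y \<Longrightarrow> y \<noteq> [] \<Longrightarrow> \<exists>i y'. r < i \<and> i < N \<and> (\<exists>x'. row_letters T (Suc i) = x' @ y') \<and>
           y @ row_letters T (Suc r) @ below T r = y' @ below T i"
        by blast
      show ?thesis
      proof (intro exI[of _ "row_letters T (Suc N) @ h"] conjI allI impI)
        show "below T (Suc N) = (row_letters T (Suc N) @ h) @ row_letters T (Suc r) @ below T r"
          using h(1) by simp
        show "below T' (Suc N) = (row_letters T (Suc N) @ h) @ row_letters T' (Suc r) @ below T r"
          using h(2) assms(2)[of N] False by simp
        fix x y assume xy: "row_letters T (Suc N) @ h = x @ y" "y \<noteq> []"
        show "\<exists>i y'. r < i \<and> i < Suc N \<and> (\<exists>x'. row_letters T (Suc i) = x' @ y') \<and>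
           y @ row_letters T (Suc r) @ below T r = y' @ below T i"
        proof (cases "length (row_letters T (Suc N)) \<le> length x")
          case True
          then obtain c where "h = c @ y" using xy(1) by (auto simp: append_eq_append_conv2)
          from h(3)[OF this xy(2)] show ?thesis using less_SucI by blast
        next
          case False
          then obtain c where c: "row_letters T (Suc N) = x @ c" "y = c @ h"
            using xy(1) by (auto simp: append_eq_append_conv2)
          show ?thesis
            using c \<open>r < N\<close> h(1) by (intro exI[of _ N] exI[of _ c]) auto
        qed
      qed
    qed
  qed simp
  then show thesis using that by blast
qed

section \<open>Heights of suffixes, row by row\<close>

definition num_k :: "bounds \<Rightarrow> bounds \<Rightarrow> nat \<Rightarrow> nat" where
  "num_k l A i = min (A (Suc i)) (l i) - l (Suc i)"

definition num_Suc_k :: "bounds \<Rightarrow> bounds \<Rightarrow> bounds \<Rightarrow> nat \<Rightarrow> nat" where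
  "num_Suc_k D A e i = min (e (Suc i)) (D i) - A (Suc i)"

text \<open>The correction \<open>D i - l i\<close> is the number of boxes of row \<open>i\<close>
  with \<open>k\<close> but not \<open>k + 1\<close>. It makes the step to the next row depend only
  on the positive parts of \<open>l i - A (Suc i)\<close> and
  \<open>D i - e (Suc i)\<close>.\<close>

definition potential :: "filling \<Rightarrow> nat \<Rightarrow> bounds \<Rightarrow> bounds \<Rightarrow> nat \<Rightarrow> int" where
  "potential T k l D i = hgt k (below T i) + int (D i) - int (l i)"

context
  fixes T k l D A e
  assumes T: "T \<in> fillings" and prof: "profile T k l D A e"
begin

lemmas chain_ineqs = interlacedD[OF profile_interlaced[OF prof]]

lemma low_le: "low T k (Suc i) \<le> num_k l A i + num_Suc_k D A e i"
proof (cases "low T k (Suc i) = 0")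
  case False
  then have "low T k (Suc i) = 1" using low_le_1[of T k "Suc i"] by simp
  from low_Suc(1,2)[OF T prof this] chain_ineqs[of i] chain_ineqs[of "Suc i"] \<open>low T k (Suc i) = 1\<close>
  show ?thesis unfolding num_k_def num_Suc_k_def by linarith
qed simp

lemma small_letters_notin: "k \<notin> set (small_letters T k i)" "Suc k \<notin> set (small_letters T k i)"
  by (auto simp: small_letters_def)

lemma row_word_num:
  "row_letters T (Suc i) = filter ((<) (Suc k)) (nonpivots T (Suc i)) @
    block_word k (low T k (Suc i)) (A (Suc i) - D (Suc i)) (num_k l A i) (num_Suc_k D A e i) (small_letters T k (Suc i)) @
    filter ((<) (Suc k)) (pivots T (Suc i))"
  unfolding num_k_def num_Suc_k_def small_letters_def by (rule row_word_block[OF T prof])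

lemma filter_row_word:
  "k_part k (row_letters T (Suc i)) =
     replicate (A (Suc i) - D (Suc i)) (Suc k) @ replicate (num_k l A i) k @ replicate (num_Suc_k D A e i) (Suc k)"
  unfolding row_word_num filter_append filter_block_word[OF small_letters_notin low_le_1 low_le]
    filter_large_letters by simp

lemma hgt_row_word:
  "hgt k (row_letters T (Suc i)) = int (A (Suc i) - D (Suc i)) - int (num_k l A i) + int (num_Suc_k D A e i)"
  by (subst hgt_filter) (simp add: filter_row_word)

lemma hgt_row_suffix:
  "row_letters T (Suc i) = x @ y \<Longrightarrow>
     hgt k y \<le> max (int (num_Suc_k D A e i)) (int (num_Suc_k D A e i) - int (num_k l A i) + int (A (Suc i) - D (Suc i)))"
  using filter_row_word[of i] by (intro hgt_suffix_blocks[of k x]) simp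

lemma potential_0: "potential T k l D 0 = 0"
  using profile_interlaced[OF prof] by (simp add: potential_def interlaced_def)

lemma potential_Suc:
  "potential T k l D (Suc i) = potential T k l D i + max 0 (int (l i) - int (A (Suc i))) - max 0 (int (D i) - int (e (Suc i)))"
  using chain_ineqs[of i] chain_ineqs[of "Suc i"] hgt_row_word[of i]
  unfolding potential_def num_k_def num_Suc_k_def by (simp add: min_def max_def)

text \<open>The left side is the height just after the final group of \<open>k + 1\<close> of row
  \<open>Suc i\<close> has been added in front of \<open>below T i\<close>, a candidate for the
  maximum inside that row.\<close>

lemma peak_eq:
  "hgt k (below T i) + int (num_Suc_k D A e i) = potential T k l D (Suc i) - max 0 (int (A (Suc i)) - int (l i))"
  using chain_ineqs[of i] chain_ineqs[of "Suc i"] hgt_row_word[of i]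
  unfolding potential_def num_k_def num_Suc_k_def by (simp add: min_def max_def)

lemma hgt_below_le: "hgt k (below T i) \<le> potential T k l D i"
  using chain_ineqs[of i] unfolding potential_def by linarith

text \<open>Within a row the height is greatest after its final group of \<open>k + 1\<close> or at
  the completed row, by \<open>hgt_row_suffix\<close>; both values are at most the potential of that
  row.\<close>

lemma suffix_below_le:
  assumes "below T i = x @ y"
  shows "\<exists>i'\<le>i. hgt k y \<le> potential T k l D i'"
  using assms
proof (induction i arbitrary: x)
  case 0
  then show ?case using potential_0 by simp
next
  case (Suc i)
  from Suc.prems consider c where "row_letters T (Suc i) = x @ c" "y = c @ below T i"
    | c where "below T i = c @ y"
    by (auto simp: append_eq_append_conv2)
  then show ?case
  proof cases
    case 1
    have "hgt k y \<le> potential T k l D (Suc i)"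
      using hgt_row_suffix[OF 1(1)] peak_eq[of i] hgt_below_le[of "Suc i"] hgt_row_word[of i] 1(2)
      by simp
    then show ?thesis by blast
  next
    case 2
    from Suc.IH[OF this] show ?thesis using le_SucI by blast
  qed
qed

lemma row_empty: "num_rows lam < i \<Longrightarrow> l i = 0 \<and> D i = 0 \<and> A i = 0 \<and> e i = 0"
  using lam_eq_0[of i] chain_ineqs[of i] by simp

text \<open>Beyond the last row all bounds vanish and the potential stays constant, so only finitely
  many values occur.\<close>

lemma potential_max: "\<exists>r. (\<forall>i. potential T k l D i \<le> potential T k l D r) \<and> (\<forall>i<r. potential T k l D i < potential T k l D r)"
proof -
  let ?N = "Suc (num_rows lam)"
  have const: "potential T k l D (?N + d) = potential T k l D ?N" for d
  proof (induction d)
    case (Suc d)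
    then show ?case using potential_Suc[of "?N + d"] row_empty[of "?N + d"] row_empty[of "Suc (?N + d)"] by simp
  qed simp
  have "range (potential T k l D) \<subseteq> potential T k l D ` {..?N}"
  proof
    fix y assume "y \<in> range (potential T k l D)"
    then obtain i where i: "y = potential T k l D i" by blast
    show "y \<in> potential T k l D ` {..?N}"
    proof (cases "i \<le> ?N")
      case False
      then have "y = potential T k l D ?N" using const[of "i - ?N"] i by simp
      then show ?thesis by simp
    qed (use i in simp)
  qed
  then have fin: "finite (range (potential T k l D))" by (rule finite_subset) simp
  define M where "M = Max (range (potential T k l D))"
  have le: "potential T k l D i \<le> M" for i unfolding M_def using fin by simp
  have "M \<in> range (potential T k l D)" unfolding M_def using fin by (intro Max_in) auto
  then have ex: "\<exists>i. potential T k l D i = M" by (metis rangeE)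
  let ?r = "LEAST i. potential T k l D i = M"
  have r: "potential T k l D ?r = M" using ex by (rule LeastI_ex)
  moreover have "potential T k l D i < M" if "i < ?r" for i
    using not_less_Least[OF that] le[of i] by simp
  ultimately show ?thesis using le by (intro exI[of _ ?r]) auto
qed

end

end

section \<open>Crystal operators on fillings\<close>

context skew_shape
begin

text \<open>Equal numbers of entries per row give equal \<open>ex\<close>, and together with equal
  lengths of row words equal \<open>ceq\<close>. The lengths also show where the rows begin in a
  reading word.\<close>

definition similar :: "nat \<Rightarrow> filling \<Rightarrow> filling \<Rightarrow> bool" where
  "similar k T T' \<longleftrightarrow> agree k T T' \<and>
     (\<forall>i\<ge>1. (\<Sum>j\<in>cols i. card (T (i, j))) = (\<Sum>j\<in>cols i. card (T' (i, j)))) \<and>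
     (\<forall>i. length (row_letters T (Suc i)) = length (row_letters T' (Suc i)))"

lemma similar_sym: "similar k T T' \<Longrightarrow> similar k T' T"
  unfolding similar_def by (simp add: agree_sym)

lemma similar_trans: "similar k T T' \<Longrightarrow> similar k T' T'' \<Longrightarrow> similar k T T''"
  using agree_trans[of k T T' T''] unfolding similar_def by simp

lemma interlaced_pos_row: "interlaced l D A e \<Longrightarrow> A (Suc i) < e (Suc i) \<Longrightarrow> i < num_rows lam"
proof (rule ccontr)
  assume a: "interlaced l D A e" "A (Suc i) < e (Suc i)" "\<not> i < num_rows lam"
  then have "lam (Suc i) = 0" by (intro lam_eq_0) simp
  with a(2) interlacedD(6)[OF a(1), of "Suc i"] show False by simp
qed

section \<open>Moving the border: what raising and lowering have in common\<close>

context
  fixes n T k l D A e D' A' r T'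
  assumes T: "T \<in> SVRPP_upto n lam mu" and k: "1 \<le> k" "Suc k \<le> n"
    and prof: "profile T k l D A e" and il': "interlaced l D' A' e"
    and mixed: "\<And>i. A' i - D' i = A i - D i"
    and num: "\<forall>i. i \<noteq> r \<longrightarrow> num_k l A' i = num_k l A i \<and> num_Suc_k D' A' e i = num_Suc_k D A e i"
  defines "T' \<equiv> refill k l D' A' e T"
begin

lemma refilled_properties: "T \<in> fillings" "T' \<in> SVRPP_upto n lam mu" "T' \<in> fillings"
    "profile T' k l D' A' e" "agree k T T'"
  using T refill_SVRPP_upto[OF T prof il' k] profile_refill[OF T prof il' k] agree_refill[OF T prof il' k]
  unfolding T'_def by (auto simp: SVRPP_upto_def)

lemma refilled_row:
  "row_letters T' (Suc i) = filter ((<) (Suc k)) (nonpivots T (Suc i)) @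
    block_word k (low T k (Suc i)) (A (Suc i) - D (Suc i)) (num_k l A' i) (num_Suc_k D' A' e i)
      (small_letters T k (Suc i)) @ filter ((<) (Suc k)) (pivots T (Suc i))"
  using row_word_refilled[OF refilled_properties(1) prof refilled_properties(3,4,5), of i] mixed[of "Suc i"]
  by (simp add: num_k_def num_Suc_k_def)

lemma refilled_row_same: "i \<noteq> r \<Longrightarrow> row_letters T' (Suc i) = row_letters T (Suc i)"
  unfolding refilled_row row_word_num[OF refilled_properties(1) prof] using num by simp

lemma refilled_similar:
  assumes "length (row_letters T' (Suc r)) = length (row_letters T (Suc r))"
  shows "similar k T T'"
  unfolding similar_def
proof (intro conjI allI impI)
  show "agree k T T'" by (rule refilled_properties)
  fix i
  show "length (row_letters T (Suc i)) = length (row_letters T' (Suc i))"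
    using refilled_row_same[of i] assms by (cases "i = r") auto
  assume i: "1 \<le> i"
  have "T b - {k, Suc k} = T' b - {k, Suc k}" for b
    using refilled_properties(5) unfolding agree_def by blast
  then show "(\<Sum>j\<in>cols i. card (T (i, j))) = (\<Sum>j\<in>cols i. card (T' (i, j)))"
    unfolding sum_card_profile[OF refilled_properties(1) prof i] sum_card_profile[OF refilled_properties(3,4) i]
    using mixed[of i] interlacedD[OF il', of i] interlacedD[OF profile_interlaced[OF prof], of i] by simp
qed

end

lemma raise_SVRPP:
  assumes T: "T \<in> SVRPP_upto n lam mu" and k: "1 \<le> k" "Suc k \<le> n"
    and w: "reading T = x0 @ y0" "0 < hgt k y0"
  shows "\<exists>T'\<in>SVRPP_upto n lam mu. similar k T T' \<and> raises k (reading T) (reading T')"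
proof -
  have TS: "T \<in> fillings" using T by (simp add: SVRPP_upto_def)
  obtain l D A e where prof: "profile T k l D A e" using profile_exists[OF TS] by metis
  have il: "interlaced l D A e" using prof by (rule profile_interlaced)
  note I = interlacedD[OF il]
  let ?P = "potential T k l D" and ?p = "num_k l A" and ?q = "num_Suc_k D A e"
  \<comment> \<open>The first row of maximal potential contains the start of the shortest suffix of
    maximal height, hence the letter to be changed.\<close>
  obtain r' where max: "\<And>i. ?P i \<le> ?P r'" and first: "\<And>i. i < r' \<Longrightarrow> ?P i < ?P r'"
    using potential_max[OF TS prof] by auto
  have suf: "hgt k y \<le> ?P r'" if "reading T = x @ y" for x y
    using suffix_below_le[OF TS prof] that max unfolding reading_word_eq by (meson order_trans)
  have "0 < ?P r'" using suf[OF w(1)] w(2) by simp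
  then have "r' \<noteq> 0" using potential_0[OF TS prof] by (metis less_irrefl)
  then obtain r where r': "r' = Suc r" by (cases r') auto
  have Pr: "?P r < ?P (Suc r)" using first[of r] r' by simp
  then have Al: "A (Suc r) < l r" using potential_Suc[OF TS prof, of r] by (simp add: max_def split: if_splits)
  have peak: "hgt k (below T r) + int (?q r) = ?P (Suc r)" using peak_eq[OF TS prof, of r] Al by simp
  then have q: "1 \<le> ?q r" using hgt_below_le[OF TS prof, of r] Pr by simp
  then have Ae: "A (Suc r) < e (Suc r)" "A (Suc r) < D r" unfolding num_Suc_k_def by auto
  \<comment> \<open>Moving the border of row \<open>t\<close> to the right removes the
    \<open>k + 1\<close> in column \<open>Suc (D t)\<close>. If \<open>D t < e (Suc t)\<close>, this
    uncovers a \<open>k + 1\<close> below it, and row \<open>Suc t\<close> must move as well.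
    \<open>J\<close> is the resulting run of rows.\<close>
  define J where "J = (\<lambda>i. Suc r \<le> i \<and> (\<forall>t. Suc r \<le> t \<and> t < i \<longrightarrow> D t < e (Suc t)))"
  have J_small: "\<not> J i" if "i \<le> r" for i using that by (simp add: J_def)
  have J_r: "J (Suc r)" by (simp add: J_def)
  have J_Suc: "J (Suc i) \<longleftrightarrow> J i \<and> D i < e (Suc i)" if "i \<noteq> r" for i
    using that unfolding J_def by (auto simp: less_Suc_eq le_Suc_eq)
  have J_pot: "?P i = ?P (Suc r)" if "J i" for i
    using that
  proof (induction i)
    case (Suc i)
    show ?case
    proof (cases "i = r")
      case False
      then have "J i" "D i < e (Suc i)" using Suc.prems J_Suc by auto
      then have "?P (Suc r) \<le> ?P (Suc i)" using Suc.IH potential_Suc[OF TS prof, of i] by simp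
      then show ?thesis using max[of "Suc i"] r' by simp
    qed simp
  qed (use J_small in simp)
  \<comment> \<open>If \<open>A (Suc i) < l i\<close>, moving row \<open>Suc i\<close> would make a
    new \<open>k\<close> readable; but then the potential would exceed its maximum.\<close>
  have J_l: "l i \<le> A (Suc i)" if "J i" "D i < e (Suc i)" for i
  proof -
    have "i \<noteq> r" using that(1) J_small by blast
    then have "?P (Suc i) = ?P i" using J_pot[of i] J_pot[of "Suc i"] J_Suc that by simp
    then show ?thesis using potential_Suc[OF TS prof, of i] that(2) by simp
  qed
  define A' where "A' = (\<lambda>i. A i + of_bool (J i))"
  define D' where "D' = (\<lambda>i. D i + of_bool (J i))"
  have A'D': "A' (Suc i) \<le> D' i \<and> A' (Suc i) \<le> e (Suc i)" for i
  proof (cases "i = r")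
    case True
    then show ?thesis using Ae J_r J_small[of r] by (simp add: A'_def D'_def)
  next
    case False
    then show ?thesis using J_Suc[OF False] I(9)[of i] I(5)[of "Suc i"] by (auto simp: A'_def D'_def)
  qed
  have il': "interlaced l D' A' e"
    unfolding interlaced_def
  proof (intro conjI allI impI)
    show "l 0 = lam 1" "D' 0 = lam 1" "A' 0 = lam 1" "e 0 = lam 1"
      using il J_small[of 0] by (auto simp: interlaced_def A'_def D'_def)
    fix i :: nat
    show "l (Suc i) \<le> l i" "e (Suc i) \<le> e i" "A' (Suc i) \<le> D' i" using I A'D' by auto
    assume i: "1 \<le> i"
    show "mu i \<le> l i" "e i \<le> lam i" "l i \<le> D' i" "D' i \<le> A' i" "A' i \<le> Suc (D' i)"
      using I[of i] i by (auto simp: A'_def D'_def)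
    show "A' i \<le> e i" using A'D'[of "i - 1"] i by simp
  qed
  have mixed: "A' i - D' i = A i - D i" for i by (simp add: A'_def D'_def)
  have num: "\<forall>i. i \<noteq> r \<longrightarrow> num_k l A' i = ?p i \<and> num_Suc_k D' A' e i = ?q i"
  proof (intro allI impI)
    fix i assume "i \<noteq> r"
    from J_Suc[OF this] J_l[of i] show "num_k l A' i = ?p i \<and> num_Suc_k D' A' e i = ?q i"
      unfolding num_k_def num_Suc_k_def A'_def D'_def by auto
  qed
  have num_r: "num_k l A' r = Suc (?p r)" "num_Suc_k D' A' e r = ?q r - 1"
    using J_r J_small[of r] Al I(7)[of r] I(2,3)[of "Suc r"] unfolding num_k_def num_Suc_k_def A'_def D'_def by auto
  define T' where "T' = refill k l D' A' e T"
  note ref = refilled_properties(2)[OF T k prof il' mixed num, folded T'_def]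
    refilled_row[OF T k prof il' mixed num, folded T'_def]
    refilled_row_same[OF T k prof il' mixed num, folded T'_def]
    refilled_similar[OF T k prof il' mixed num, folded T'_def]
  obtain u v where row: "row_letters T (Suc r) = u @ Suc k # v" and row': "row_letters T' (Suc r) = u @ k # v"
    and cv: "count_list v (Suc k) = ?q r - 1" "count_list v k = 0"
    unfolding row_word_num[OF TS prof] ref(2) num_r
    by (rule block_word_change[OF low_le_1 q small_letters_notin[OF TS prof] filter_large_letters large_letters_notin])
  have rN: "r < num_rows lam" using interlaced_pos_row[OF il Ae(1)] .
  obtain h where h: "reading T = h @ row_letters T (Suc r) @ below T r"
    "reading T' = h @ row_letters T' (Suc r) @ below T r"
    unfolding reading_word_eq by (rule below_replace[OF rN ref(3)])
  let ?u = "h @ u" and ?v = "v @ below T r"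
  have split: "reading T = ?u @ Suc k # ?v" "reading T' = ?u @ k # ?v"
    unfolding h row row' by simp_all
  have hv: "hgt k ?v = ?P r' - 1" using cv peak q r' by (simp add: hgt_def)
  have "raises k (?u @ Suc k # ?v) (?u @ k # ?v)"
  proof (rule raises_by_heights)
    fix x y assume "?u @ Suc k # ?v = x @ y"
    then have "reading T = x @ y" using split(1) by simp
    from suf[OF this] hv show "hgt k y \<le> hgt k ?v + 1" by simp
  next
    fix x y assume "?v = x @ y"
    then consider c where "v = x @ c" "y = c @ below T r" | c where "below T r = c @ y"
      by (auto simp: append_eq_append_conv2)
    then show "hgt k y \<le> hgt k ?v"
    proof cases
      case 1
      have "count_list c (Suc k) \<le> count_list v (Suc k)" using 1(1) by simp
      then have "hgt k c \<le> hgt k v" using hgt_le_count[of k c] cv unfolding hgt_def[of k v] by simp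
      then show ?thesis using 1(2) by simp
    next
      case 2
      then obtain i where "i \<le> r" "hgt k y \<le> ?P i" using suffix_below_le[OF TS prof] by blast
      then show ?thesis using first[of i] r' hv by simp
    qed
  qed
  then have "raises k (reading T) (reading T')" using split by simp
  moreover have "similar k T T'" by (rule ref(4)) (simp add: row row')
  ultimately show ?thesis using ref(1) by blast
qed

end

context skew_shape
begin

lemma lower_SVRPP:
  assumes T: "T \<in> SVRPP_upto n lam mu" and k: "1 \<le> k" "Suc k \<le> n"
    and w: "reading T = x0 @ y0" "hgt k x0 < 0"
  shows "\<exists>T'\<in>SVRPP_upto n lam mu. similar k T T' \<and> raises k (reading T') (reading T)"
proof -
  have TS: "T \<in> fillings" using T by (simp add: SVRPP_upto_def)
  obtain l D A e where prof: "profile T k l D A e" using profile_exists[OF TS] by metis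
  have il: "interlaced l D A e" using prof by (rule profile_interlaced)
  note I = interlacedD[OF il]
  let ?P = "potential T k l D" and ?p = "num_k l A" and ?q = "num_Suc_k D A e"
  obtain r' where max: "\<And>i. ?P i \<le> ?P r'" and first: "\<And>i. i < r' \<Longrightarrow> ?P i < ?P r'"
    using potential_max[OF TS prof] by auto
  define M where "M = ?P r'"
  have suf: "hgt k y \<le> M" if "reading T = x @ y" for x y
    using suffix_below_le[OF TS prof] that max unfolding reading_word_eq M_def by (meson order_trans)
  have wM: "hgt k (reading T) < M" using suf[OF w(1)] w by simp
  \<comment> \<open>A row of maximal potential need not contain a suffix of height \<open>M\<close>;
    it does if \<open>A (Suc i) \<le> l i\<close>. So lowering is guided by the heights actually
    reached inside the rows.\<close>
  define peak where "peak = (\<lambda>i. hgt k (below T i) + int (?q i))"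
  have peak: "peak i = ?P (Suc i) - max 0 (int (A (Suc i)) - int (l i))" for i
    unfolding peak_def by (rule peak_eq[OF TS prof])
  have peak_le: "peak i \<le> M" for i using peak[of i] max[of "Suc i"] unfolding M_def by simp
  have below_peak: "hgt k (below T i) \<le> peak i" for i by (simp add: peak_def)
  have ex: "\<exists>i. peak i = M"
  proof (cases r')
    case 0
    then have "M = 0" using potential_0[OF TS prof] by (simp add: M_def)
    moreover have "0 \<le> peak 0" by (simp add: peak_def)
    ultimately show ?thesis using peak_le[of 0] by (intro exI[of _ 0]) simp
  next
    case (Suc r)
    then have "?P r < ?P (Suc r)" using first[of r] by simp
    then have "A (Suc r) < l r" using potential_Suc[OF TS prof, of r] by (simp add: max_def split: if_splits)
    then show ?thesis using peak[of r] Suc by (intro exI[of _ r]) (simp add: M_def)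
  qed
  \<comment> \<open>After the last row the peak is the height of the whole word, which is below
    \<open>M\<close> by the assumption on \<open>x0\<close>. Hence there is a last index with peak
    \<open>M\<close>.\<close>
  have bounded: "i < num_rows lam" if "peak i = M" for i
  proof (rule ccontr)
    assume "\<not> i < num_rows lam"
    moreover from this have "lam (Suc i) = 0" by (intro lam_eq_0) simp
    ultimately have "peak i = hgt k (reading T)"
      using below_eq_reading_word[of i T] I(6)[of "Suc i"] by (simp add: peak_def num_Suc_k_def)
    with wM that show False by simp
  qed
  \<comment> \<open>The longest suffix of maximal height begins in row \<open>Suc r\<close>, and the
    letter \<open>k\<close> of that row in front of it is to be changed.\<close>
  define r where "r = Max {i. peak i = M}"
  have fin: "finite {i. peak i = M}" by (rule finite_subset[of _ "{..<num_rows lam}"]) (use bounded in auto)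
  have "r \<in> {i. peak i = M}" unfolding r_def using fin ex by (intro Max_in) auto
  then have peak_r: "peak r = M" by simp
  have later: "peak i < M" if "r < i" for i
  proof -
    have "peak i \<noteq> M" using Max_ge[OF fin, of i] that unfolding r_def by fastforce
    with peak_le[of i] show ?thesis by simp
  qed
  have below_M: "hgt k (below T i) < M" if "r < i" for i using below_peak[of i] later[OF that] by simp
  have "M \<le> ?P (Suc r) - max 0 (int (A (Suc r)) - int (l r))" using peak_r peak by simp
  then have Al: "A (Suc r) \<le> l r" and Pr: "?P (Suc r) = M" using max[of "Suc r"] by (auto simp: M_def max_def split: if_splits)
  \<comment> \<open>Completing row \<open>Suc r\<close> must bring the height below
    \<open>M\<close>, so the \<open>k\<close> of its block outnumber the leading
    \<open>k + 1\<close>. This bounds all longer suffixes that start inside the row.\<close>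
  have mp: "A (Suc r) - D (Suc r) < ?p r"
    using below_M[of "Suc r"] peak_r hgt_row_word[OF TS prof, of r] by (simp add: peak_def)
  \<comment> \<open>Column \<open>D t\<close> of row \<open>t\<close> now receives a
    \<open>k + 1\<close>, which would hide a \<open>k + 1\<close> below it or stand above a
    \<open>k\<close>. So the run goes on while \<open>D t \<le> e (Suc t)\<close>; unlike in
    raising, equality is included.\<close>
  define J where "J = (\<lambda>i. Suc r \<le> i \<and> (\<forall>t. Suc r \<le> t \<and> t < i \<longrightarrow> D t \<le> e (Suc t)))"
  have J_small: "\<not> J i" if "i \<le> r" for i using that by (simp add: J_def)
  have J_r: "J (Suc r)" by (simp add: J_def)
  have J_Suc: "J (Suc i) \<longleftrightarrow> J i \<and> D i \<le> e (Suc i)" if "i \<noteq> r" for i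
    using that unfolding J_def by (auto simp: less_Suc_eq le_Suc_eq)
  have J_pot: "?P i = M" if "J i" for i
    using that
  proof (induction i)
    case (Suc i)
    show ?case
    proof (cases "i = r")
      case False
      then have "J i" "D i \<le> e (Suc i)" using Suc.prems J_Suc by auto
      then have "M \<le> ?P (Suc i)" using Suc.IH potential_Suc[OF TS prof, of i] by simp
      then show ?thesis using max[of "Suc i"] by (simp add: M_def)
    qed (simp add: Pr)
  qed (use J_small in simp)
  have J_l: "l i < A (Suc i)" if "J i" "D i \<le> e (Suc i)" for i
  proof -
    have "i \<noteq> r" "r < i" using that(1) J_small by (blast, force simp: J_def)
    then have "?P (Suc i) = M" using J_pot[of "Suc i"] J_Suc that by simp
    then show ?thesis using peak[of i] later[OF \<open>r < i\<close>] by (simp add: max_def split: if_splits)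
  qed
  \<comment> \<open>A row of the run has potential \<open>M\<close> but a height below
    \<open>M\<close> at its end, so it has a box with \<open>k\<close> and without
    \<open>k + 1\<close>, and the border can move left.\<close>
  have J_D: "l i < D i" if "J i" for i
  proof -
    have "r < i" using that by (simp add: J_def)
    then show ?thesis using J_pot[OF that] below_M[of i] unfolding potential_def by simp
  qed
  define A' where "A' = (\<lambda>i. A i - of_bool (J i))"
  define D' where "D' = (\<lambda>i. D i - of_bool (J i))"
  have A'D': "A' (Suc i) \<le> D' i" for i
  proof (cases "i = r")
    case True
    then show ?thesis using J_small[of r] I(9)[of r] by (simp add: A'_def D'_def)
  next
    case False
    then show ?thesis using J_Suc[OF False] I(9)[of i] I(5)[of "Suc i"] by (auto simp: A'_def D'_def)
  qed
  have il': "interlaced l D' A' e"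
    unfolding interlaced_def
  proof (intro conjI allI impI)
    show "l 0 = lam 1" "D' 0 = lam 1" "A' 0 = lam 1" "e 0 = lam 1"
      using il J_small[of 0] by (auto simp: interlaced_def A'_def D'_def)
    fix i :: nat
    show "l (Suc i) \<le> l i" "e (Suc i) \<le> e i" "A' (Suc i) \<le> D' i" using I A'D' by auto
    assume i: "1 \<le> i"
    show "mu i \<le> l i" "e i \<le> lam i" "l i \<le> D' i" "D' i \<le> A' i" "A' i \<le> Suc (D' i)" "A' i \<le> e i"
      using I[of i] J_D[of i] i by (auto simp: A'_def D'_def)
  qed
  have mixed: "A' i - D' i = A i - D i" for i
    using J_D[of i] I(3)[of i] unfolding A'_def D'_def by (cases "J i") auto
  have num: "\<forall>i. i \<noteq> r \<longrightarrow> num_k l A' i = ?p i \<and> num_Suc_k D' A' e i = ?q i"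
  proof (intro allI impI)
    fix i assume "i \<noteq> r"
    from J_Suc[OF this] J_l[of i] J_D[of i] I(9)[of i]
    show "num_k l A' i = ?p i \<and> num_Suc_k D' A' e i = ?q i"
      unfolding num_k_def num_Suc_k_def A'_def D'_def by auto
  qed
  have pos: "1 \<le> ?p r" using mp by simp
  have num_r: "?p r = Suc (num_k l A' r)" "num_Suc_k D' A' e r = Suc (?q r)"
    using J_r J_small[of r] Al I(9)[of r] I(5)[of "Suc r"] J_D[of "Suc r"] I(3)[of "Suc r"]
    unfolding num_k_def num_Suc_k_def A'_def D'_def by auto
  define T' where "T' = refill k l D' A' e T"
  note ref = refilled_properties(2)[OF T k prof il' mixed num, folded T'_def]
    refilled_row[OF T k prof il' mixed num, folded T'_def]
    refilled_row_same[OF T k prof il' mixed num, folded T'_def]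
    refilled_similar[OF T k prof il' mixed num, folded T'_def]
  have q_Suc: "1 \<le> Suc (?q r)" by simp
  have rowT: "row_letters T (Suc r) = filter ((<) (Suc k)) (nonpivots T (Suc r)) @
    block_word k (low T k (Suc r)) (A (Suc r) - D (Suc r)) (Suc (num_k l A' r)) (Suc (?q r) - 1)
      (small_letters T k (Suc r)) @ filter ((<) (Suc k)) (pivots T (Suc r))"
    unfolding row_word_num[OF TS prof] num_r(1) by simp
  obtain u v where row': "row_letters T' (Suc r) = u @ Suc k # v" and "row_letters T (Suc r) = u @ k # v"
    and fu: "k_part k u = replicate (A (Suc r) - D (Suc r)) (Suc k) @ replicate (num_k l A' r) k"
    and "count_list v (Suc k) = Suc (?q r) - 1" "count_list v k = 0"
    unfolding rowT ref(2) num_r(2)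
    by (rule block_word_change[OF low_le_1 q_Suc small_letters_notin[OF TS prof] filter_large_letters large_letters_notin])
  then have row: "row_letters T (Suc r) = u @ k # v"
    and cv: "count_list v (Suc k) = ?q r" "count_list v k = 0" by simp_all
  have rN: "r < num_rows lam" by (rule bounded[OF peak_r])
  obtain h where h: "reading T = h @ row_letters T (Suc r) @ below T r"
    "reading T' = h @ row_letters T' (Suc r) @ below T r"
    "\<forall>x y. h = x @ y \<longrightarrow> y \<noteq> [] \<longrightarrow> (\<exists>i y'. r < i \<and> i < num_rows lam \<and> (\<exists>x'. row_letters T (Suc i) = x' @ y') \<and>
       y @ row_letters T (Suc r) @ below T r = y' @ below T i)"
    unfolding reading_word_eq by (rule below_replace[OF rN ref(3)])
  let ?u = "h @ u" and ?v = "v @ below T r"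
  have split: "reading T = ?u @ k # ?v" "reading T' = ?u @ Suc k # ?v"
    unfolding h(1,2) row row' by simp_all
  have hv: "hgt k ?v = M" using cv peak_r by (simp add: hgt_def peak_def)
  have "raises k (?u @ Suc k # ?v) (?u @ k # ?v)"
  proof (rule lowers_by_heights)
    fix x y assume "?v = x @ y"
    then have "reading T = (?u @ k # x) @ y" using split(1) by simp
    from suf[OF this] hv show "hgt k y \<le> hgt k ?v" by simp
  next
    fix x y assume "?u = x @ y"
    then obtain c where "h @ c = x \<and> u = c @ y \<or> h = x @ c \<and> c @ u = y"
      by (auto simp: append_eq_append_conv2)
    then consider c where "u = c @ y" | c where "h = x @ c" "y = c @ u" "c \<noteq> []"
      by (cases "c = []") auto
    then show "hgt k (y @ k # ?v) < hgt k ?v"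
    proof cases
      case 1
      define d where "d = length (k_part k c)"
      have "k_part k y =
          drop d (replicate (A (Suc r) - D (Suc r)) (Suc k) @ replicate (num_k l A' r) k)"
        unfolding fu[symmetric] 1 d_def by simp
      then have "hgt k y = int (A (Suc r) - D (Suc r) - d) - int (num_k l A' r - (d - (A (Suc r) - D (Suc r))))"
        by (subst hgt_filter) simp
      then have "hgt k y \<le> 0" using mp num_r(1) by linarith
      then show ?thesis by simp
    next
      case 2
      obtain i y' x' where i: "r < i" "row_letters T (Suc i) = x' @ y'"
        "c @ row_letters T (Suc r) @ below T r = y' @ below T i"
        using h(3)[rule_format, OF 2(1,3)] by blast
      have eq: "y @ k # ?v = y' @ below T i" using i(3) 2(2) row by simp
      have "hgt k (y' @ below T i) < M"
        using hgt_row_suffix[OF TS prof i(2)] later[OF i(1)] below_M[of "Suc i"] i(1)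
          hgt_row_word[OF TS prof, of i] by (simp add: peak_def)
      then show ?thesis using hv eq by simp
    qed
  qed
  then have "raises k (reading T') (reading T)" using split by simp
  moreover have "similar k T T'" by (rule ref(4)) (simp add: row row')
  ultimately show ?thesis using ref(1) by blast
qed

section \<open>Uniqueness of the partner filling\<close>

lemma rows_eq_if_below_eq:
  assumes "below T1 N = below T2 N" "\<And>i. length (row_letters T1 (Suc i)) = length (row_letters T2 (Suc i))"
  shows "i < N \<Longrightarrow> row_letters T1 (Suc i) = row_letters T2 (Suc i)"
  using assms(1)
proof (induction N)
  case (Suc N)
  from Suc.prems(2) assms(2)[of N]
  have "row_letters T1 (Suc N) = row_letters T2 (Suc N)" "below T1 N = below T2 N" by simp_all
  then show ?case using Suc by (cases "i = N") auto
qed simp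

lemma column_bound_unique:
  fixes x :: nat
  assumes "\<And>j. j \<in> {m<..n} \<Longrightarrow> j \<le> x \<longleftrightarrow> j \<le> y" "m \<le> x" "x \<le> n" "m \<le> y" "y \<le> n"
  shows "x = y"
  using assms(1)[of x] assms(1)[of y] assms(2-) by (cases "m = x"; cases "m = y") auto

lemma profile_mem_e:
  assumes prof: "profile T k l D A e" and b: "(i, j) \<in> boxes"
  shows "j \<le> e i \<longleftrightarrow> (\<forall>v\<in>T (i, j). v < k) \<or> k \<in> T (i, j) \<or> Suc k \<in> T (i, j)"
  unfolding profile_mem[OF prof b]
  using interlacedD(2,3,4,5)[OF profile_interlaced[OF prof], of i] by arith

text \<open>\<open>agree\<close> fixes \<open>l\<close> and \<open>e\<close>, the numbers of entries
  fix \<open>A i - D i\<close>, and the number of readable \<open>k + 1\<close> in each row then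
  determines \<open>D\<close>, from the fictitious row 0 downwards.\<close>

lemma similar_unique:
  assumes T1: "T1 \<in> fillings" and T2: "T2 \<in> fillings" and sim: "similar k T1 T2"
    and w: "reading T1 = reading T2"
  shows "T1 = T2"
proof -
  have ag: "agree k T1 T2" using sim by (simp add: similar_def)
  obtain l1 D1 A1 e1 where prof1: "profile T1 k l1 D1 A1 e1" using profile_exists[OF T1] by metis
  obtain l D2 A2 e where prof2: "profile T2 k l D2 A2 e" using profile_exists[OF T2] by metis
  note I1 = interlacedD[OF profile_interlaced[OF prof1]] and I2 = interlacedD[OF profile_interlaced[OF prof2]]
  have low_iff: "(\<forall>v\<in>T1 b. v < k) \<longleftrightarrow> (\<forall>v\<in>T2 b. v < k)" for b by (rule agree_all_less[OF ag])
  have rows0: "l1 0 = l 0 \<and> e1 0 = e 0 \<and> A1 0 = A2 0 \<and> D1 0 = D2 0"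
    using profile_interlaced[OF prof1] profile_interlaced[OF prof2] by (simp add: interlaced_def)
  have eqI: "x = y" if "\<And>j. (i, j) \<in> boxes \<Longrightarrow> j \<le> x \<longleftrightarrow> j \<le> y"
    "mu i \<le> x" "x \<le> lam i" "mu i \<le> y" "y \<le> lam i" "i \<noteq> 0" for i x y :: nat
    using that by (intro column_bound_unique[of "mu i" "lam i"]) (auto simp: mem_boxes)
  have l: "l1 i = l i" for i
  proof (cases "i = 0")
    case False
    show ?thesis
    proof (rule eqI)
      show "j \<le> l1 i \<longleftrightarrow> j \<le> l i" if "(i, j) \<in> boxes" for j
        using profile_mem(1)[OF prof1 that] profile_mem(1)[OF prof2 that] low_iff by simp
    qed (use I1[of i] I2[of i] False in auto)
  qed (use rows0 in simp)
  have e: "e1 i = e i" for i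
  proof (cases "i = 0")
    case False
    show ?thesis
    proof (rule eqI)
      show "j \<le> e1 i \<longleftrightarrow> j \<le> e i" if "(i, j) \<in> boxes" for j
        using profile_mem_e[OF prof1 that] profile_mem_e[OF prof2 that] low_iff agree_block[OF ag, of "(i, j)"]
        by simp
    qed (use I1[of i] I2[of i] False in auto)
  qed (use rows0 in simp)
  have row: "row_letters T1 (Suc i) = row_letters T2 (Suc i)" for i
  proof (cases "i < num_rows lam")
    case True
    then show ?thesis using rows_eq_if_below_eq[OF w[unfolded reading_word_eq]] sim by (simp add: similar_def)
  next
    case False
    then show ?thesis using row_word_Nil[of "Suc i"] by simp
  qed
  have mixed: "A1 (Suc i) - D1 (Suc i) = A2 (Suc i) - D2 (Suc i)" for i
  proof -
    have "T1 b - {k, Suc k} = T2 b - {k, Suc k}" for b using ag unfolding agree_def by blast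
    then have "(\<Sum>j\<in>cols (Suc i). card (T1 (Suc i, j) - {k, Suc k})) =
        (\<Sum>j\<in>cols (Suc i). card (T2 (Suc i, j) - {k, Suc k}))" by simp
    moreover have "(\<Sum>j\<in>cols (Suc i). card (T1 (Suc i, j))) =
        (\<Sum>j\<in>cols (Suc i). card (T2 (Suc i, j)))"
      using sim by (simp add: similar_def)
    ultimately show ?thesis
      using sum_card_profile[OF T1 prof1, of "Suc i"] sum_card_profile[OF T2 prof2, of "Suc i"]
        I1(2,3,5)[of "Suc i"] I2(2,3,5)[of "Suc i"] l[of "Suc i"] e[of "Suc i"] by linarith
  qed
  have AD: "A1 i = A2 i \<and> D1 i = D2 i" for i
  proof (induction i)
    case (Suc i)
    have "min (e (Suc i)) (D1 i) - D1 (Suc i) = min (e (Suc i)) (D2 i) - D2 (Suc i)"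
      using count_row_word_Suc_k[OF T1 prof1, of i] count_row_word_Suc_k[OF T2 prof2, of i] row[of i] e by simp
    moreover have "D1 i = D2 i" using Suc.IH by simp
    ultimately have "D1 (Suc i) = D2 (Suc i)"
      using I1(3,5)[of "Suc i"] I2(3,5)[of "Suc i"] I1(9)[of i] I2(9)[of i] e[of "Suc i"] by linarith
    then show ?case using mixed[of i] I1(3)[of "Suc i"] I2(3)[of "Suc i"] by linarith
  qed (use rows0 in simp)
  show ?thesis
  proof
    fix b
    show "T1 b = T2 b"
    proof (cases "b \<in> boxes")
      case True
      obtain i j where b: "b = (i, j)" by (cases b)
      have "k \<in> T1 b \<longleftrightarrow> k \<in> T2 b" "Suc k \<in> T1 b \<longleftrightarrow> Suc k \<in> T2 b"
        using profile_mem(2,3)[OF prof1, of i j] profile_mem(2,3)[OF prof2, of i j] True l e AD unfolding b by simp_all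
      then have "v \<in> T1 b \<longleftrightarrow> v \<in> T2 b" for v
        using agree_mem[OF ag, of v b] by (cases "v = k \<or> v = Suc k") auto
      then show ?thesis by blast
    next
      case False
      then show ?thesis using box_empty[OF T1] box_empty[OF T2] by simp
    qed
  qed
qed

end

section \<open>Statistics and fibers of the reading word\<close>

context skew_shape
begin

lemma similar_ex:
  assumes T: "T \<in> fillings" and T': "T' \<in> fillings" and sim: "similar k T T'"
  shows "ex lam mu T = ex lam mu T'"
proof
  fix i
  show "ex lam mu T i = ex lam mu T' i"
  proof (cases "i = 0")
    case True
    then show ?thesis by (simp add: ex_def mem_boxes)
  next
    case False
    let ?C = "cols i"
    have C: "{j. (i, j) \<in> boxes} = ?C" using False by (auto simp: mem_boxes)
    have ex: "ex lam mu T i + card ?C = (\<Sum>j\<in>?C. card (T (i, j)))" if "T \<in> fillings" for T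
    proof -
      have "ex lam mu T i + card ?C = (\<Sum>j\<in>?C. card (T (i, j)) - 1 + 1)"
        unfolding ex_def C sum.distrib by simp
      also have "\<dots> = (\<Sum>j\<in>?C. card (T (i, j)))"
      proof (rule sum.cong[OF refl])
        fix j assume "j \<in> ?C"
        then have "(i, j) \<in> boxes" using False by (simp add: mem_boxes)
        then have "card (T (i, j)) \<noteq> 0" using box_nonempty[OF that] box_finite[OF that] by simp
        then show "card (T (i, j)) - 1 + 1 = card (T (i, j))" by simp
      qed
      finally show ?thesis .
    qed
    have "(\<Sum>j\<in>?C. card (T (i, j))) = (\<Sum>j\<in>?C. card (T' (i, j)))"
      using sim False by (simp add: similar_def)
    then show ?thesis using ex[OF T] ex[OF T'] by simp
  qed
qed

lemma similar_ceq:
  assumes T: "T \<in> fillings" and T': "T' \<in> fillings" and sim: "similar k T T'"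
  shows "ceq lam mu T = ceq lam mu T'"
proof
  fix i
  show "ceq lam mu T i = ceq lam mu T' i"
  proof (cases "i = 0")
    case True
    then show ?thesis by (simp add: ceq_def mem_boxes)
  next
    case False
    then have i: "1 \<le> i" by simp
    show ?thesis
      using length_row_word[OF T i] length_row_word[OF T' i] sim by (simp add: similar_def)
  qed
qed

text \<open>In each column that contains \<open>v\<close>, the topmost occurrence is read and every
  further one is omitted, because the box above it has maximum \<open>v\<close>. This matches the
  count by columns in \<open>ircont\<close>.\<close>

lemma count_reading_word:
  assumes T: "T \<in> fillings"
  shows "count_list (reading T) = content T"
proof
  fix v
  let ?N = "num_rows lam"
  let ?R = "\<lambda>i. {j \<in> cols (Suc i). v \<in> T (Suc i, j) \<and> \<not> ((i, j) \<in> boxes \<and> v = Max (T (i, j)))}"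
  have "count_list (below T M) v = (\<Sum>i<M. card (?R i))" for M
    by (induction M) (use count_row_word[OF T, of "Suc _" v] in simp_all)
  then have "count_list (reading T) v = card (SIGMA i:{..<?N}. ?R i)"
    unfolding reading_word_eq by simp
  also have "\<dots> = card {j. \<exists>i. (i, j) \<in> boxes \<and> v \<in> T (i, j)}"
  proof (rule bij_betw_same_card[of snd], rule bij_betw_imageI)
    have above: "v \<in> T (i, j) \<Longrightarrow> v = Max (T (i, j))" if "v \<in> T (Suc i, j)" for i j
      using box_finite[OF T] column_le[OF T _ that, of _ i] by (intro Max_eqI[symmetric]) auto
    \<comment> \<open>The box directly above row \<open>Suc i'\<close> either is the given
      occurrence or is squeezed between two occurrences of \<open>v\<close>; in both cases its
      maximum is \<open>v\<close>.\<close>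
    have no: "\<not> i < i'" if "v \<in> T (Suc i, j)" "j \<in> ?R i'" for i i' j
    proof
      assume lt: "i < i'"
      have b1: "(Suc i, j) \<in> boxes" and b2: "(Suc i', j) \<in> boxes"
        using that mem_box[OF T, of v] by blast+
      have b: "(i', j) \<in> boxes"
        using b1 b2 lt mu_antimono[of "Suc i" i'] lam_antimono[of i' "Suc i'"] by (simp add: mem_boxes)
      have "v \<in> T (i', j)"
      proof (cases "Suc i = i'")
        case False
        have "x = v" if "x \<in> T (i', j)" for x
          using column_le[OF T \<open>v \<in> T (Suc i, j)\<close> that] column_le[OF T that, of v "Suc i'"] lt False
            \<open>j \<in> ?R i'\<close> by force
        then show ?thesis using box_nonempty[OF T b] by blast
      qed (use that in simp)
      then show False using above[of i' j] that(2) b by blast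
    qed
    show "inj_on snd (SIGMA i:{..<?N}. ?R i)"
    proof (rule inj_onI)
      fix a b assume ab: "a \<in> (SIGMA i:{..<?N}. ?R i)" "b \<in> (SIGMA i:{..<?N}. ?R i)" "snd a = snd b"
      obtain i j i' where a: "a = (i, j)" "b = (i', j)" using ab(3) by (metis prod.collapse)
      have "\<not> i < i'" by (rule no[of i j]) (use ab a in auto)
      moreover have "\<not> i' < i" by (rule no[of i' j]) (use ab a in auto)
      ultimately show "a = b" using a by simp
    qed
    show "snd ` (SIGMA i:{..<?N}. ?R i) = {j. \<exists>i. (i, j) \<in> boxes \<and> v \<in> T (i, j)}"
    proof (intro equalityI subsetI)
      fix j assume "j \<in> snd ` (SIGMA i:{..<?N}. ?R i)"
      then obtain p where p: "p \<in> (SIGMA i:{..<?N}. ?R i)" "j = snd p" by (rule imageE)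
      then have "j \<in> ?R (fst p)" by (cases p) simp
      then show "j \<in> {j. \<exists>i. (i, j) \<in> boxes \<and> v \<in> T (i, j)}" using mem_box[OF T, of v] by blast
    next
      fix j assume "j \<in> {j. \<exists>i. (i, j) \<in> boxes \<and> v \<in> T (i, j)}"
      then have ex: "\<exists>i. v \<in> T (i, j)" by blast
      define i0 where "i0 = (LEAST i. v \<in> T (i, j))"
      have i0: "v \<in> T (i0, j)" unfolding i0_def using ex by (rule LeastI_ex)
      then have b: "(i0, j) \<in> boxes" by (rule mem_box[OF T])
      then obtain i where i: "i0 = Suc i" by (cases i0) (auto simp: mem_boxes)
      have "v \<notin> T (i, j)" using not_less_Least[of i "\<lambda>i. v \<in> T (i, j)"] i unfolding i0_def by simp
      then have "\<not> ((i, j) \<in> boxes \<and> v = Max (T (i, j)))" using Max_in_box[OF T, of "(i, j)"] by metis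
      then have "j \<in> ?R i" using i0 b i by (simp add: mem_boxes)
      moreover have "i < ?N"
      proof (rule ccontr)
        assume "\<not> i < ?N"
        then have "lam (Suc i) = 0" by (intro lam_eq_0) simp
        with b i show False by (auto simp: mem_boxes)
      qed
      ultimately show "j \<in> snd ` (SIGMA i:{..<?N}. ?R i)" by force
    qed
  qed
  finally show "count_list (reading T) v = content T v" by (simp add: ircont_def)
qed

lemma set_reading_word:
  assumes "T \<in> SVRPP_upto n lam mu"
  shows "set (reading T) \<subseteq> {1..n}"
proof
  fix v assume "v \<in> set (reading T)"
  then have "count_list (reading T) v \<noteq> 0" by (simp add: count_list_0_iff)
  then have "content T v \<noteq> 0" using count_reading_word[of T] assms by (simp add: SVRPP_upto_def)
  then obtain b where "b \<in> boxes" "v \<in> T b" using ircont_nonzero_iff[OF skew] by blast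
  then show "v \<in> {1..n}" using assms unfolding SVRPP_upto_def by blast
qed

definition level :: "nat \<Rightarrow> (nat \<Rightarrow> nat) \<Rightarrow> (nat \<Rightarrow> nat) \<Rightarrow> (box \<Rightarrow> nat set) set" where
  "level n \<gamma> \<theta> = {T \<in> SVRPP_upto n lam mu. ceq lam mu T = \<gamma> \<and> ex lam mu T = \<theta>}"

lemma finite_level: "finite (level n \<gamma> \<theta>)"
  using finite_SVRPP_upto[OF skew] by (simp add: level_def)

lemma similar_level:
  assumes "T \<in> level n \<gamma> \<theta>" "T' \<in> SVRPP_upto n lam mu" "similar k T T'"
  shows "T' \<in> level n \<gamma> \<theta>"
  using assms similar_ex[of T T' k] similar_ceq[of T T' k] by (simp add: level_def SVRPP_upto_def)

lemma card_fiber_raises: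
  assumes k: "1 \<le> k" "Suc k \<le> n" and w: "raises k w w'"
  shows "card {T \<in> level n \<gamma> \<theta>. reading T = w} = card {T \<in> level n \<gamma> \<theta>. reading T = w'}"
    (is "card ?X = card ?X'")
proof (rule antisym)
  have fin: "finite ?X" "finite ?X'" using finite_level by simp_all
  have S: "T \<in> SVRPP_upto n lam mu" "T \<in> fillings" if "T \<in> level n \<gamma> \<theta>" for T
    using that by (simp_all add: level_def SVRPP_upto_def)
  have unique: "T1 = T2" if "T1 \<in> level n \<gamma> \<theta>" "T2 \<in> level n \<gamma> \<theta>" "similar k T1 T'" "similar k T2 T'"
    "reading T1 = reading T2" for T1 T2 T'
    by (rule similar_unique[OF S(2)[OF that(1)] S(2)[OF that(2)] similar_trans[OF that(3) similar_sym[OF that(4)]] that(5)])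
  obtain u v where uv: "w = u @ Suc k # v" "w' = u @ k # v"
    "\<And>x y. u = x @ y \<Longrightarrow> hgt k y \<le> 0" "\<And>x y. v = x @ y \<Longrightarrow> 0 \<le> hgt k x"
    using raisesE[OF w] by metis
  have "hgt k u \<le> 0" using uv(3)[of "[]" u] by simp
  have "0 \<le> hgt k v" using uv(4)[of v "[]"] by simp
  show "card ?X \<le> card ?X'"
  proof (rule card_le_if_inj_on_rel[where r = "similar k", OF fin(2)])
    fix T assume T: "T \<in> ?X"
    have "reading T = u @ (Suc k # v)" "0 < hgt k (Suc k # v)" using T uv(1) \<open>0 \<le> hgt k v\<close> by auto
    from raise_SVRPP[OF S(1) k this] T
    obtain T' where T': "T' \<in> SVRPP_upto n lam mu" "similar k T T'" "raises k w (reading T')" by auto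
    then have "reading T' = w'" using raises_unique[OF w] by simp
    then show "\<exists>T'. T' \<in> ?X' \<and> similar k T T'" using T' similar_level[OF _ T'(1,2)] T by blast
  next
    fix T1 T2 T' assume "T1 \<in> ?X" "T2 \<in> ?X" "similar k T1 T'" "similar k T2 T'"
    then show "T1 = T2" using unique[of T1 T2 T'] by simp
  qed
  show "card ?X' \<le> card ?X"
  proof (rule card_le_if_inj_on_rel[where r = "similar k", OF fin(1)])
    fix T assume T: "T \<in> ?X'"
    have "reading T = (u @ [k]) @ v" "hgt k (u @ [k]) < 0" using T uv(2) \<open>hgt k u \<le> 0\<close> by auto
    from lower_SVRPP[OF S(1) k this] T
    obtain T' where T': "T' \<in> SVRPP_upto n lam mu" "similar k T T'" "raises k (reading T') w'" by auto
    then have "reading T' = w" using raises_inj[OF w] by simp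
    then show "\<exists>T'. T' \<in> ?X \<and> similar k T T'" using T' similar_level[OF _ T'(1,2)] T by blast
  next
    fix T1 T2 T' assume "T1 \<in> ?X'" "T2 \<in> ?X'" "similar k T1 T'" "similar k T2 T'"
    then show "T1 = T2" using unique[of T1 T2 T'] by simp
  qed
qed

lemma is_partition_ircont:
  assumes T: "T \<in> SVRPP_upto n lam mu" and "lattice (reading T)"
  shows "is_partition (content T)" "content T i \<noteq> 0 \<Longrightarrow> i \<le> n"
proof -
  have TS: "T \<in> fillings" using T by (simp add: SVRPP_upto_def)
  have "content T b \<le> content T a" if "1 \<le> a" "a \<le> b" for a b
    using assms(2)[unfolded reverse_lattice_word_def, rule_format, of a b 0] that
    by (cases "a = b") (simp_all add: count_reading_word[OF TS])
  then show "is_partition (content T)"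
    using weak_composition_ircont[OF skew TS] by (simp add: is_partition_def)
  show "i \<le> n" if nz: "content T i \<noteq> 0"
  proof -
    obtain b where "b \<in> boxes" "i \<in> T b" using nz ircont_nonzero_iff[OF skew] by blast
    moreover have "T b \<subseteq> {1..n}" using T \<open>b \<in> boxes\<close> by (simp add: SVRPP_upto_def)
    ultimately show ?thesis by (meson atLeastAtMost_iff subsetD)
  qed
qed

end

section \<open>Straight shapes and Schur polynomials\<close>

lemma skew_boxes_straight: "skew_boxes nu (\<lambda>_. 0) = young_diagram nu"
  by (auto simp: skew_boxes_def young_diagram_def)

lemma skew_shape_straight: "is_partition nu \<Longrightarrow> skew_shape nu (\<lambda>_. 0)"
  by standard (auto simp: is_skew_shape_def is_partition_def weak_composition_def young_diagram_def)

locale straight_shape =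
  fixes nu :: "nat \<Rightarrow> nat"
  assumes partition: "is_partition nu"

sublocale straight_shape \<subseteq> skew_shape nu "\<lambda>_. 0"
  using partition by (rule skew_shape_straight)

context straight_shape
begin

abbreviation tableaux :: "nat \<Rightarrow> (box \<Rightarrow> nat set) set" where
  "tableaux n \<equiv> level n (\<lambda>_. 0) (\<lambda>_. 0)"

lemma boxes_eq: "boxes = young_diagram nu"
  by (rule skew_boxes_straight)

lemma tableau_filling: "T \<in> tableaux n \<Longrightarrow> T \<in> fillings"
  by (simp add: level_def SVRPP_upto_def)

lemma tableau_singleton:
  assumes T: "T \<in> tableaux n" and b: "b \<in> boxes"
  shows "T b = {Min (T b)}"
proof -
  note TS = tableau_filling[OF T]
  obtain i j where ij: "b = (i, j)" by (cases b)
  have "ex nu (\<lambda>_. 0) T i = 0" using T by (simp add: level_def)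
  \<comment> \<open>A sum over an infinite index set would be 0 by default; finiteness is what makes
    each summand vanish.\<close>
  moreover have "finite {j. (i, j) \<in> boxes}"
    by (rule finite_subset[of _ "snd ` boxes"]) (use finite_skew_boxes[OF skew] in force)+
  ultimately have "card (T b) - 1 = 0" using b unfolding ex_def ij by simp
  moreover have "card (T b) \<noteq> 0" using box_nonempty[OF TS b] box_finite[OF TS] by simp
  ultimately have "card (T b) = 1" by simp
  then show ?thesis by (metis Min_singleton card_1_singletonE)
qed

text \<open>Vanishing \<open>ceq\<close> gives strictness only between vertical neighbours; from row
  \<open>Suc i\<close> on, weak growth suffices.\<close>

lemma tableau_column_strict:
  assumes T: "T \<in> tableaux n" and b: "(i, j) \<in> boxes" "(i', j) \<in> boxes" "i < i'"
  shows "Min (T (i, j)) < Min (T (i', j))"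
proof -
  note TS = tableau_filling[OF T]
  have b': "(Suc i, j) \<in> boxes" using b lam_antimono[of "Suc i" i'] by (simp add: mem_boxes)
  have "ceq nu (\<lambda>_. 0) T i = 0" using T by (simp add: level_def)
  moreover have "finite {j. (i, j) \<in> boxes \<and> (i + 1, j) \<in> boxes \<and> Max (T (i, j)) = Min (T (i + 1, j))}"
    by (rule finite_subset[of _ "snd ` boxes"]) (use finite_skew_boxes[OF skew] in force)+
  ultimately have "Max (T (i, j)) \<noteq> Min (T (Suc i, j))" using b(1) b' unfolding ceq_def by auto
  moreover have "Max (T (i, j)) = Min (T (i, j))"
    using tableau_singleton[OF T b(1)] by (metis Max_singleton)
  moreover have "Min (T (i, j)) \<le> Min (T (Suc i, j))"
    using column_le[OF TS Min_in_box[OF TS b(1)] Min_in_box[OF TS b']] by simp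
  moreover have "Min (T (Suc i, j)) \<le> Min (T (i', j))"
    using column_le[OF TS Min_in_box[OF TS b'] Min_in_box[OF TS b(2)]] b(3) by (cases "Suc i = i'") auto
  ultimately show ?thesis by simp
qed

lemma tableauI:
  assumes S: "\<And>b. b \<in> boxes \<Longrightarrow> S b \<in> {1..n}"
    and row: "\<And>i j j'. (i, j) \<in> boxes \<Longrightarrow> (i, j') \<in> boxes \<Longrightarrow> j < j' \<Longrightarrow> S (i, j) \<le> S (i, j')"
    and col: "\<And>i i' j. (i, j) \<in> boxes \<Longrightarrow> (i', j) \<in> boxes \<Longrightarrow> i < i' \<Longrightarrow> S (i, j) < S (i', j)"
  shows "(\<lambda>b. if b \<in> boxes then {S b} else {}) \<in> tableaux n"
proof -
  let ?T = "\<lambda>b. if b \<in> boxes then {S b} else {}"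
  have "?T \<in> fillings"
    unfolding SVRPP_iff using S row col[THEN less_imp_le] by (auto simp: Ball_def)
  then have "?T \<in> SVRPP_upto n nu (\<lambda>_. 0)" using S by (auto simp: SVRPP_upto_def)
  moreover have "ceq nu (\<lambda>_. 0) ?T = (\<lambda>_. 0)"
  proof
    fix i
    have "{j. (i, j) \<in> boxes \<and> (i + 1, j) \<in> boxes \<and> Max (?T (i, j)) = Min (?T (i + 1, j))} = {}"
      using col[of i _ "i + 1"] by force
    then show "ceq nu (\<lambda>_. 0) ?T i = 0" unfolding ceq_def by (simp only: card.empty)
  qed
  moreover have "ex nu (\<lambda>_. 0) ?T = (\<lambda>_. 0)"
    by (rule ext) (simp add: ex_def)
  ultimately show ?thesis by (simp add: level_def)
qed

lemma ircont_tableau: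
  assumes T: "T \<in> tableaux n"
  shows "content T v = card {b \<in> boxes. Min (T b) = v}"
proof -
  have "{j. \<exists>i. (i, j) \<in> boxes \<and> v \<in> T (i, j)} = snd ` {b \<in> boxes. Min (T b) = v}"
  proof (intro equalityI subsetI)
    fix j assume "j \<in> {j. \<exists>i. (i, j) \<in> boxes \<and> v \<in> T (i, j)}"
    then obtain i where i: "(i, j) \<in> boxes" "v \<in> T (i, j)" by blast
    then have "Min (T (i, j)) = v" using tableau_singleton[OF T i(1)] by (metis singletonD)
    then show "j \<in> snd ` {b \<in> boxes. Min (T b) = v}" using i by force
  next
    fix j assume "j \<in> snd ` {b \<in> boxes. Min (T b) = v}"
    then obtain i where i: "(i, j) \<in> boxes" "Min (T (i, j)) = v" by force
    then have "v \<in> T (i, j)" using tableau_singleton[OF T i(1)] by (metis singletonI)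
    then show "j \<in> {j. \<exists>i. (i, j) \<in> boxes \<and> v \<in> T (i, j)}" using i by blast
  qed
  moreover have "inj_on snd {b \<in> boxes. Min (T b) = v}"
  proof (rule inj_onI)
    fix a b assume ab: "a \<in> {b \<in> boxes. Min (T b) = v}" "b \<in> {b \<in> boxes. Min (T b) = v}" "snd a = snd b"
    obtain i j i' where a: "a = (i, j)" "b = (i', j)" using ab(3) by (metis prod.collapse)
    show "a = b"
      using tableau_column_strict[OF T, of i j i'] tableau_column_strict[OF T, of i' j i] ab a
      by (cases i i' rule: linorder_cases) auto
  qed
  ultimately show ?thesis unfolding ircont_def by (simp add: card_image)
qed

lemma multi_power_ircont_tableau:
  assumes T: "T \<in> tableaux n"
  shows "multi_power XVar (content T) = (\<Prod>b\<in>boxes. var (XVar (Min (T b))))"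
proof -
  let ?S = "\<lambda>b. Min (T b)"
  have fin: "finite boxes" by (rule finite_skew_boxes[OF skew])
  have "multi_power XVar (content T) = (\<Prod>k\<in>?S ` boxes. var (XVar k) ^ content T k)"
    unfolding multi_power_def
  proof (rule Prod_any.expand_superset)
    show "finite (?S ` boxes)" using fin by simp
    show "{k. var (XVar k) ^ content T k \<noteq> 1} \<subseteq> ?S ` boxes"
    proof
      fix k assume k: "k \<in> {k. var (XVar k) ^ content T k \<noteq> 1}"
      show "k \<in> ?S ` boxes"
      proof (rule ccontr)
        assume "k \<notin> ?S ` boxes"
        then have "{b \<in> boxes. ?S b = k} = {}" by blast
        then have "content T k = 0" unfolding ircont_tableau[OF T] by (simp only: card.empty)
        with k show False by simp
      qed
    qed
  qed
  also have "\<dots> = (\<Prod>k\<in>?S ` boxes. \<Prod>b\<in>{b \<in> boxes. ?S b = k}. var (XVar (?S b)))"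
    by (rule prod.cong[OF refl]) (simp add: ircont_tableau[OF T])
  also have "\<dots> = (\<Prod>b\<in>boxes. var (XVar (?S b)))"
    by (rule prod.image_gen[OF fin, symmetric])
  finally show ?thesis .
qed

lemma schur_poly_eq: "schur_poly n nu = (\<Sum>T\<in>tableaux n. multi_power XVar (content T))"
  unfolding schur_poly_def
proof (rule sum.reindex_bij_witness[where i = "\<lambda>T b. if b \<in> boxes then Min (T b) else 0"
    and j = "\<lambda>S b. if b \<in> boxes then {S b} else {}"])
  fix S assume "S \<in> SSYT_upto n nu"
  then have S: "\<And>b. b \<notin> boxes \<Longrightarrow> S b = 0" "\<And>b. b \<in> boxes \<Longrightarrow> S b \<in> {1..n}"
    "\<And>i j j'. (i, j) \<in> boxes \<Longrightarrow> (i, j') \<in> boxes \<Longrightarrow> j < j' \<Longrightarrow> S (i, j) \<le> S (i, j')"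
    "\<And>i i' j. (i, j) \<in> boxes \<Longrightarrow> (i', j) \<in> boxes \<Longrightarrow> i < i' \<Longrightarrow> S (i, j) < S (i', j)"
    by (auto simp: SSYT_upto_def boxes_eq)
  show "(\<lambda>b. if b \<in> boxes then Min (if b \<in> boxes then {S b} else {}) else 0) = S"
    using S(1) by auto
  show T: "(\<lambda>b. if b \<in> boxes then {S b} else {}) \<in> tableaux n" by (rule tableauI[where S = S, OF S(2-4)])
  show "multi_power XVar (content (\<lambda>b. if b \<in> boxes then {S b} else {})) =
      (\<Prod>b\<in>young_diagram nu. var (XVar (S b)))"
    unfolding multi_power_ircont_tableau[OF T] boxes_eq[symmetric] by (rule prod.cong) auto
next
  fix T assume T: "T \<in> tableaux n"
  then have TS: "T \<in> fillings" and Tn: "\<And>b. b \<in> boxes \<Longrightarrow> T b \<subseteq> {1..n}"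
    by (simp_all add: level_def SVRPP_upto_def)
  show "(\<lambda>b. if b \<in> boxes then {if b \<in> boxes then Min (T b) else 0} else {}) = T"
  proof
    fix b
    show "(if b \<in> boxes then {if b \<in> boxes then Min (T b) else 0} else {}) = T b"
    proof (cases "b \<in> boxes")
      case True
      then show ?thesis by (simp only: if_True tableau_singleton[OF T True, symmetric])
    next
      case False
      then show ?thesis using box_empty[OF TS] by simp
    qed
  qed
  show "(\<lambda>b. if b \<in> boxes then Min (T b) else 0) \<in> SSYT_upto n nu"
    unfolding SSYT_upto_def boxes_eq[symmetric]
  proof (intro CollectI conjI allI ballI impI)
    fix b assume b: "b \<in> boxes"
    show "(if b \<in> boxes then Min (T b) else 0) \<in> {1..n}" using Min_in_box[OF TS b] Tn[OF b] b by (simp add: subset_iff)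
  next
    fix i j j' assume "(i, j) \<in> boxes \<and> (i, j') \<in> boxes \<and> j < j'"
    then show "(if (i, j) \<in> boxes then Min (T (i, j)) else 0) \<le> (if (i, j') \<in> boxes then Min (T (i, j')) else 0)"
      using row_le[OF TS Min_in_box[OF TS] Min_in_box[OF TS]] by simp
  next
    fix i i' j assume "(i, j) \<in> boxes \<and> (i', j) \<in> boxes \<and> i < i'"
    then show "(if (i, j) \<in> boxes then Min (T (i, j)) else 0) < (if (i', j) \<in> boxes then Min (T (i', j)) else 0)"
      using tableau_column_strict[OF T] by simp
  qed simp
qed

lemma row_word_tableau:
  assumes T: "T \<in> tableaux n" and i: "1 \<le> i"
  shows "row_letters T i = map (\<lambda>j. Min (T (i, j))) [1..<Suc (nu i)]"
proof -
  have cols: "row_cols nu (\<lambda>_. 0) i = [1..<Suc (nu i)]" by (simp add: row_cols_def)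
  have b: "(i, j) \<in> boxes" if "j \<in> set [1..<Suc (nu i)]" for j using that i by (auto simp: mem_boxes)
  have "T (i, j) - {Min (T (i, j))} = {}" if "j \<in> set [1..<Suc (nu i)]" for j
    using tableau_singleton[OF T b[OF that]] by (metis Diff_cancel)
  then have "rev (sorted_list_of_set (T (i, j) - {Min (T (i, j))})) = []" if "j \<in> set [1..<Suc (nu i)]" for j
    using that by (simp only:) simp
  then have "nonpivots T i = []"
    unfolding nonpivots_def cols pivot_def concat_eq_Nil_conv by (auto simp del: upt_Suc)
  moreover have "kept T i j" if "j \<in> set [1..<Suc (nu i)]" for j
    unfolding kept_def pivot_def
  proof
    assume a: "(i - 1, j) \<in> boxes \<and> Min (T (i, j)) = Max (T (i - 1, j))"
    have "Max (T (i - 1, j)) = Min (T (i - 1, j))"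
      using tableau_singleton[OF T, of "(i - 1, j)"] a by (metis Max_singleton)
    with tableau_column_strict[OF T, of "i - 1" j i] a b[OF that] i show False by simp
  qed
  then have "filter (kept T i) [1..<Suc (nu i)] = [1..<Suc (nu i)]" by (simp only: filter_id_conv) blast
  ultimately show ?thesis unfolding row_word_eq pivots_def cols pivot_def by simp
qed

lemma below_suffix: "i \<le> N \<Longrightarrow> \<exists>h. below T N = h @ below T i"
proof (induction N)
  case (Suc N)
  show ?case
  proof (cases "i = Suc N")
    case False
    with Suc obtain h where "below T N = h @ below T i" by auto
    then show ?thesis by (intro exI[of _ "row_letters T (Suc N) @ h"]) simp
  qed simp
qed simp

definition superstandard :: "box \<Rightarrow> nat set" where
  "superstandard = (\<lambda>b. if b \<in> boxes then {fst b} else {})"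

text \<open>The suffix that begins with the last entry of row \<open>i\<close> continues with the
  rows above, which by induction contain no \<open>i\<close>. So the lattice condition keeps this
  entry from exceeding \<open>i\<close>, while column strictness keeps all entries of the row from
  being smaller.\<close>

lemma reverse_lattice_tableau:
  assumes T: "T \<in> tableaux n" and L: "lattice (reading T)"
  shows "T = superstandard"
proof -
  note TS = tableau_filling[OF T]
  have main: "\<forall>j. (i, j) \<in> boxes \<longrightarrow> Min (T (i, j)) = i" for i
  proof (induction i rule: less_induct)
    case (less i)
    show ?case
    proof (intro allI impI)
      fix j assume b: "(i, j) \<in> boxes"
      then obtain r where r: "i = Suc r" by (cases i) (auto simp: mem_boxes)
      have last: "(i, nu i) \<in> boxes" using b by (simp add: mem_boxes)
      let ?x = "Min (T (i, nu i))"
      have i_le: "i \<le> Min (T (i, j))"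
      proof (cases "r = 0")
        case True
        then show ?thesis using box_positive[OF TS Min_in_box[OF TS b]] r by simp
      next
        case False
        then have b': "(r, j) \<in> boxes" using b r lam_antimono[of r i] by (simp add: mem_boxes)
        then have "Min (T (r, j)) = r" using less[of r] r by simp
        then show ?thesis using tableau_column_strict[OF T b' b] r by simp
      qed
      have x_le: "?x \<le> i"
      proof (rule ccontr)
        assume "\<not> ?x \<le> i"
        then have lt: "i < ?x" by simp
        have "i \<le> num_rows nu" using lam_eq_0[of i] b by (force simp: mem_boxes)
        then obtain h where "reading T = h @ below T i"
          unfolding reading_word_eq using below_suffix by blast
        moreover have "row_letters T i = map (\<lambda>j. Min (T (i, j))) [1..<nu i] @ [?x]"
        proof -
          have "[1..<Suc (nu i)] = [1..<nu i] @ [nu i]" using b by (simp add: mem_boxes)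
          then show ?thesis using row_word_tableau[OF T, of i] b by (simp add: mem_boxes)
        qed
        ultimately have "reading T = (h @ map (\<lambda>j. Min (T (i, j))) [1..<nu i]) @ (?x # below T r)"
          using r by simp
        then have "lattice (?x # below T r)" using L reverse_lattice_word_suffix by metis
        from this[unfolded reverse_lattice_word_def, rule_format, of i ?x 0]
        have "count_list (?x # below T r) ?x \<le> count_list (?x # below T r) i" using lt r by simp
        moreover have "count_list (below T s) i = 0" if "s \<le> r" for s
          using that
        proof (induction s)
          case (Suc s)
          have "i \<notin> set (row_letters T (Suc s))"
            using less[of "Suc s"] Suc.prems r row_word_tableau[OF T, of "Suc s"]
            by (auto simp: mem_boxes simp del: upt_Suc)
          then show ?case using Suc by (simp add: count_list_0_iff)
        qed simp
        ultimately show False using lt by simp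
      qed
      have "Min (T (i, j)) \<le> ?x"
        using row_le[OF TS Min_in_box[OF TS b] Min_in_box[OF TS last]] b
        by (cases "j = nu i") (auto simp: mem_boxes)
      with i_le x_le show "Min (T (i, j)) = i" by simp
    qed
  qed
  show ?thesis
  proof
    fix b
    show "T b = superstandard b"
    proof (cases "b \<in> boxes")
      case True
      then show ?thesis
        using tableau_singleton[OF T True] main[of "fst b"] unfolding superstandard_def
        by (metis prod.collapse)
    next
      case False
      then show ?thesis using box_empty[OF TS] by (simp add: superstandard_def)
    qed
  qed
qed

lemma superstandard_tableau:
  assumes "\<And>i. nu i \<noteq> 0 \<Longrightarrow> i \<le> n"
  shows "superstandard \<in> tableaux n"
  unfolding superstandard_def
proof (rule tableauI)
  fix b assume "b \<in> boxes"
  then show "fst b \<in> {1..n}" using assms[of "fst b"] by (cases b) (auto simp: mem_boxes)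
qed simp_all

lemma superstandard_properties:
  assumes n: "\<And>i. nu i \<noteq> 0 \<Longrightarrow> i \<le> n"
  shows "content superstandard = nu"
    "lattice (reading superstandard)"
proof -
  note T = superstandard_tableau[OF n]
  show irc: "content superstandard = nu"
  proof
    fix v
    have "{j. \<exists>i. (i, j) \<in> boxes \<and> v \<in> superstandard (i, j)} = (if v = 0 then {} else {1..nu v})"
      by (auto simp: superstandard_def mem_boxes)
    moreover have "nu 0 = 0" using partition by (simp add: is_partition_def weak_composition_def)
    ultimately show "content superstandard v = nu v" by (simp add: ircont_def)
  qed
  have row: "row_letters superstandard (Suc i) = replicate (nu (Suc i)) (Suc i)" for i
  proof -
    have "map (\<lambda>j. Min (superstandard (Suc i, j))) [1..<Suc (nu (Suc i))] = map (\<lambda>_. Suc i) [1..<Suc (nu (Suc i))]"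
      by (rule map_cong) (auto simp: superstandard_def mem_boxes)
    then show ?thesis using row_word_tableau[OF T, of "Suc i"]
      by (simp add: map_replicate_const del: upt_Suc)
  qed
  have rep: "count_list (replicate m c) d = (if c = d then m else 0)" for m and c d :: nat
    by (induction m) auto
  have count: "count_list (below superstandard i) a = (if 1 \<le> a \<and> a \<le> i then nu a else 0)" for i a
    by (induction i) (auto simp: row rep)
  have "hgt k y \<le> 0" if "1 \<le> k" "below superstandard i = x @ y" for k i x y
    using that(2)
  proof (induction i arbitrary: x)
    case (Suc i)
    from Suc.prems consider c where "row_letters superstandard (Suc i) = x @ c" "y = c @ below superstandard i"
      | c where "below superstandard i = c @ y"
      by (auto simp: append_eq_append_conv2)
    then show ?case
    proof cases
      case 1
      then have c: "c = drop (length x) (replicate (nu (Suc i)) (Suc i))" using row by simp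
      have "nu (Suc k) \<le> nu k" using lam_antimono[of k "Suc k"] that(1) by simp
      then show ?thesis using that(1) unfolding 1(2) c by (cases "k = i") (auto simp: hgt_def rep count)
    next
      case 2
      then show ?thesis by (rule Suc.IH)
    qed
  qed simp
  then show "lattice (reading superstandard)"
    unfolding reverse_lattice_word_iff reading_word_eq by blast
qed

lemma card_reverse_lattice_tableaux:
  assumes n: "\<And>i. nu i \<noteq> 0 \<Longrightarrow> i \<le> n"
  shows "card {T \<in> tableaux n. content T = \<kappa> \<and> lattice (reading T)} =
    (if \<kappa> = nu then 1 else 0)"
proof -
  define X where "X = {T \<in> tableaux n. content T = \<kappa> \<and>
    lattice (reading T)}"
  have "X \<subseteq> {superstandard}"
    unfolding X_def using reverse_lattice_tableau by blast
  moreover have "superstandard \<in> X \<longleftrightarrow> nu = \<kappa>"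
    unfolding X_def using superstandard_tableau[OF n] superstandard_properties[OF n] by simp
  ultimately have "X = (if \<kappa> = nu then {superstandard} else {})" by auto
  then have "card X = (if \<kappa> = nu then 1 else 0)" by simp
  then show ?thesis by (simp only: X_def)
qed

end

section \<open>The Schur expansion\<close>

definition fiber_count :: "('b \<Rightarrow> nat list) \<Rightarrow> 'b set \<Rightarrow> nat list \<Rightarrow> int" where
  "fiber_count r X w = int (card {T \<in> X. r T = w})"

text \<open>This passes between sums over fillings and sums over words, where the cancellation takes
  place.\<close>

lemma sum_fiber_count:
  fixes G :: "nat list \<Rightarrow> 'a :: comm_ring_1"
  assumes "finite X" "finite W" "r ` X \<subseteq> W"
  shows "(\<Sum>w\<in>W. of_int (fiber_count r X w) * G w) = (\<Sum>T\<in>X. G (r T))"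
proof -
  have "(\<Sum>T\<in>X. G (r T)) = (\<Sum>w\<in>W. \<Sum>T\<in>{T \<in> X. r T = w}. G (r T))"
    using sum.group[OF assms, of "\<lambda>T. G (r T)"] by simp
  also have "\<dots> = (\<Sum>w\<in>W. of_int (fiber_count r X w) * G w)"
    by (rule sum.cong[OF refl]) (simp add: fiber_count_def)
  finally show ?thesis by simp
qed

context skew_shape
begin

lemma sum_level_eq_schur:
  "(\<Sum>T\<in>level n \<gamma> \<theta>. multi_power XVar (content T)) =
   (\<Sum>T | T \<in> level n \<gamma> \<theta> \<and> lattice (reading T). schur_poly n (content T))"
proof -
  define X where "X = level n \<gamma> \<theta>"
  define H where "H = {T. T \<in> X \<and> lattice (reading T)}"
  define sh where "sh = content"
  define Y where "Y = (\<lambda>\<kappa>. skew_shape.level \<kappa> (\<lambda>_. 0) n (\<lambda>_. 0) (\<lambda>_. 0))"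
  define R where "R = reading"
  define R0 where "R0 = (\<lambda>\<kappa>. reading_word \<kappa> (\<lambda>_. 0))"
  define F where "F = (\<lambda>T. fiber_count (R0 (sh T)) (Y (sh T)))"
  \<comment> \<open>Each lattice filling \<open>T\<close> is opposed by all tableaux of shape
    \<open>sh T\<close>. Exactly one of these has a lattice word, and its content is that of
    \<open>T\<close>; so the values of \<open>N\<close> at lattice words of a given content sum to
    0.\<close>
  define N where "N = (\<lambda>w. fiber_count R X w - (\<Sum>T\<in>H. F T w))"
  define W where "W = R ` X \<union> (\<Union>T\<in>H. R0 (sh T) ` Y (sh T))"
  have part: "is_partition (sh T)" and bound: "\<And>i. sh T i \<noteq> 0 \<Longrightarrow> i \<le> n" if "T \<in> H" for T
    using is_partition_ircont[of T n] that by (simp_all add: H_def X_def sh_def level_def)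
  have sk: "skew_shape (sh T) (\<lambda>_. 0)" if "T \<in> H" for T using skew_shape_straight[OF part[OF that]] .
  have st: "straight_shape (sh T)" if "T \<in> H" for T using part[OF that] by unfold_locales
  have count: "count_list (R T) = sh T" if "T \<in> X" for T
    using count_reading_word[of T] that by (simp add: X_def level_def SVRPP_upto_def R_def sh_def)
  have count0: "count_list (R0 (sh T) S) = ircont (sh T) (\<lambda>_. 0) S" if "T \<in> H" "S \<in> Y (sh T)" for T S
    using skew_shape.count_reading_word[OF sk[OF that(1)], of S] that(2)
    by (simp add: Y_def skew_shape.level_def[OF sk[OF that(1)]] SVRPP_upto_def R0_def)
  have finX: "finite X" by (simp add: X_def finite_level)
  then have finH: "finite H" by (simp add: H_def)
  have finY: "finite (Y (sh T))" if "T \<in> H" for T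
    unfolding Y_def by (rule skew_shape.finite_level[OF sk[OF that]])
  have finW: "finite W" using finX finH finY by (simp add: W_def)
  \<comment> \<open>Stated for any commutative ring, since it is applied to integers for the lattice
    words and to polynomials for the weights.\<close>
  have total: "(\<Sum>w\<in>W. of_int (N w) * G w) = (\<Sum>T\<in>X. G (R T)) - (\<Sum>T\<in>H. \<Sum>S\<in>Y (sh T). G (R0 (sh T) S))"
    for G :: "nat list \<Rightarrow> 'a :: comm_ring_1"
  proof -
    have "(\<Sum>w\<in>W. of_int (N w) * G w) = (\<Sum>w\<in>W. of_int (fiber_count R X w) * G w) -
        (\<Sum>w\<in>W. \<Sum>T\<in>H. of_int (F T w) * G w)"
      by (simp add: N_def left_diff_distrib sum_subtractf sum_distrib_right)
    also have "(\<Sum>w\<in>W. \<Sum>T\<in>H. of_int (F T w) * G w) =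
        (\<Sum>T\<in>H. \<Sum>w\<in>W. of_int (F T w) * G w)"
      by (rule sum.swap)
    also have "\<dots> = (\<Sum>T\<in>H. \<Sum>S\<in>Y (sh T). G (R0 (sh T) S))"
      unfolding F_def by (intro sum.cong refl sum_fiber_count finY finW) (auto simp: W_def)
    also have "(\<Sum>w\<in>W. of_int (fiber_count R X w) * G w) = (\<Sum>T\<in>X. G (R T))"
      by (rule sum_fiber_count[OF finX finW]) (simp add: W_def)
    finally show ?thesis .
  qed
  have support: "w \<in> W" if "N w \<noteq> 0" for w
  proof (rule ccontr)
    assume w: "w \<notin> W"
    then have "{T \<in> X. R T = w} = {}" by (auto simp: W_def)
    then have "fiber_count R X w = 0" unfolding fiber_count_def by (simp only: card.empty of_nat_0)
    moreover have "F T w = 0" if "T \<in> H" for T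
    proof -
      have "{S \<in> Y (sh T). R0 (sh T) S = w} = {}" using w that by (auto simp: W_def)
      then show ?thesis unfolding F_def fiber_count_def by (simp only: card.empty of_nat_0)
    qed
    ultimately show False using that by (simp add: N_def)
  qed
  have letters: "set w \<subseteq> {1..n}" if "w \<in> W" for w
  proof -
    from that consider T where "T \<in> X" "w = R T" | T S where "T \<in> H" "S \<in> Y (sh T)" "w = R0 (sh T) S"
      unfolding W_def by blast
    then show ?thesis
    proof cases
      case 1
      then show ?thesis using set_reading_word[of T n] by (simp add: X_def level_def R_def)
    next
      case 2
      then show ?thesis using skew_shape.set_reading_word[OF sk[OF 2(1)], of S n]
        by (simp add: Y_def skew_shape.level_def[OF sk[OF 2(1)]] R0_def)
    qed
  qed
  interpret C: crystal_invariant n N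
  proof
    show "finite {w. N w \<noteq> 0}" using support by (intro finite_subset[OF _ finW]) blast
    show "set w \<subseteq> {1..n}" if "N w \<noteq> 0" for w by (rule letters[OF support[OF that]])
    fix k w w' assume k: "1 \<le> k" "Suc k \<le> n" and w: "raises k w w'"
    have "fiber_count R X w = fiber_count R X w'"
      unfolding fiber_count_def X_def R_def using card_fiber_raises[OF k w] by simp
    moreover have "F T w = F T w'" if "T \<in> H" for T
      unfolding F_def fiber_count_def Y_def R0_def using skew_shape.card_fiber_raises[OF sk[OF that] k w] by simp
    ultimately show "N w = N w'" by (simp add: N_def)
  qed
  have zero: "(\<Sum>w | N w \<noteq> 0 \<and> count_list w = \<kappa> \<and> lattice w. N w) = 0" for \<kappa>
  proof -
    let ?P = "\<lambda>w. count_list w = \<kappa> \<and> lattice w"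
    have "(\<Sum>w | N w \<noteq> 0 \<and> ?P w. N w) = (\<Sum>w\<in>{w \<in> W. ?P w}. N w)"
      by (rule sum.mono_neutral_left) (use finW support in auto)
    also have "\<dots> = (\<Sum>w\<in>W. of_int (N w) * (if ?P w then 1 else 0))"
      by (simp add: sum.inter_filter[OF finW] if_distrib cong: if_cong)
    also have "\<dots> = (\<Sum>T\<in>X. if ?P (R T) then 1 else 0) -
        (\<Sum>T\<in>H. \<Sum>S\<in>Y (sh T). if ?P (R0 (sh T) S) then 1 else 0)"
      by (rule total)
    also have "(\<Sum>T\<in>X. if ?P (R T) then 1 else 0) = int (card {T \<in> X. ?P (R T)})"
      by (simp add: sum.inter_filter[OF finX, symmetric])
    also have "{T \<in> X. ?P (R T)} = {T \<in> H. sh T = \<kappa>}"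
      using count by (auto simp: H_def R_def)
    also have "(\<Sum>T\<in>H. \<Sum>S\<in>Y (sh T). if ?P (R0 (sh T) S) then 1 else 0) = (\<Sum>T\<in>H. if sh T = \<kappa> then 1 else (0 :: int))"
    proof (rule sum.cong[OF refl])
      fix T assume T: "T \<in> H"
      have "(\<Sum>S\<in>Y (sh T). if ?P (R0 (sh T) S) then 1 else 0) = int (card {S \<in> Y (sh T). ?P (R0 (sh T) S)})"
        by (simp add: sum.inter_filter[OF finY[OF T], symmetric])
      also have "{S \<in> Y (sh T). ?P (R0 (sh T) S)} = {S \<in> Y (sh T). ircont (sh T) (\<lambda>_. 0) S = \<kappa> \<and> lattice (R0 (sh T) S)}"
        using count0[OF T] by auto
      also have "card \<dots> = (if \<kappa> = sh T then 1 else 0)"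
        unfolding Y_def R0_def
        by (rule straight_shape.card_reverse_lattice_tableaux[OF st[OF T] bound[OF T]])
      finally show "(\<Sum>S\<in>Y (sh T). if ?P (R0 (sh T) S) then 1 else 0) = (if sh T = \<kappa> then 1 else (0 :: int))"
        by auto
    qed
    also have "\<dots> = int (card {T \<in> H. sh T = \<kappa>})"
      by (simp add: sum.inter_filter[OF finH, symmetric])
    finally show ?thesis by simp
  qed
  have "0 = (\<Sum>w | N w \<noteq> 0. of_int (N w) * multi_power XVar (count_list w))"
    using C.weighted_sum_zero[OF zero, of "multi_power XVar"] by simp
  also have "\<dots> = (\<Sum>w\<in>W. of_int (N w) * multi_power XVar (count_list w))"
    by (rule sum.mono_neutral_left) (use finW support in auto)
  also have "\<dots> = (\<Sum>T\<in>X. multi_power XVar (count_list (R T))) -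
      (\<Sum>T\<in>H. \<Sum>S\<in>Y (sh T). multi_power XVar (count_list (R0 (sh T) S)))"
    by (rule total)
  also have "(\<Sum>T\<in>X. multi_power XVar (count_list (R T))) = (\<Sum>T\<in>X. multi_power XVar (sh T))"
    by (rule sum.cong) (simp_all add: count)
  also have "(\<Sum>T\<in>H. \<Sum>S\<in>Y (sh T). multi_power XVar (count_list (R0 (sh T) S))) = (\<Sum>T\<in>H. schur_poly n (sh T))"
  proof (rule sum.cong[OF refl])
    fix T assume T: "T \<in> H"
    show "(\<Sum>S\<in>Y (sh T). multi_power XVar (count_list (R0 (sh T) S))) = schur_poly n (sh T)"
      unfolding straight_shape.schur_poly_eq[OF st[OF T]] Y_def[symmetric]
      by (rule sum.cong) (simp_all add: count0[OF T] Y_def)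
  qed
  finally show ?thesis by (simp add: X_def H_def sh_def)
qed

text \<open>The content of a lattice filling is a partition, so the restriction of
  \<open>\<nu>\<close> loses nothing, and the lattice fillings can be grouped by content.\<close>

lemma sum_schur_eq:
  "(\<Sum>\<nu>. (of_nat (H_coeff lam mu n \<nu> \<gamma> \<theta>) * schur_poly n \<nu> when is_partition \<nu>)) =
   (\<Sum>T\<in>level n \<gamma> \<theta>. multi_power XVar (content T))"
proof -
  define H where "H = {T. T \<in> level n \<gamma> \<theta> \<and> lattice (reading T)}"
  have fin: "finite H" unfolding H_def using finite_level by simp
  have coeff: "H_coeff lam mu n \<nu> \<gamma> \<theta> = card {T \<in> H. content T = \<nu>}" for \<nu>
    unfolding H_coeff_def H_def level_def by (rule arg_cong[where f = card]) auto
  have part: "is_partition \<nu>" if "\<nu> \<in> content ` H" for \<nu>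
    using that is_partition_ircont[of _ n] by (auto simp: H_def level_def)
  have "(\<Sum>\<nu>. (of_nat (H_coeff lam mu n \<nu> \<gamma> \<theta>) * schur_poly n \<nu> when is_partition \<nu>)) =
      (\<Sum>\<nu>\<in>content ` H. (of_nat (H_coeff lam mu n \<nu> \<gamma> \<theta>) * schur_poly n \<nu> when is_partition \<nu>))"
  proof (rule Sum_any.expand_superset)
    show "{\<nu>. (of_nat (H_coeff lam mu n \<nu> \<gamma> \<theta>) * schur_poly n \<nu> when is_partition \<nu>) \<noteq> 0} \<subseteq> content ` H"
    proof
      fix \<nu> assume a: "\<nu> \<in> {\<nu>. (of_nat (H_coeff lam mu n \<nu> \<gamma> \<theta>) * schur_poly n \<nu> when is_partition \<nu>) \<noteq> 0}"
      show "\<nu> \<in> content ` H"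
      proof (rule ccontr)
        assume "\<nu> \<notin> content ` H"
        then have "{T \<in> H. content T = \<nu>} = {}" by blast
        then have "H_coeff lam mu n \<nu> \<gamma> \<theta> = 0" unfolding coeff by (simp only: card.empty)
        with a show False by simp
      qed
    qed
  qed (use fin in simp)
  also have "\<dots> = (\<Sum>\<nu>\<in>content ` H. \<Sum>T\<in>{T \<in> H. content T = \<nu>}. schur_poly n (content T))"
    by (rule sum.cong[OF refl]) (simp add: part coeff)
  also have "\<dots> = (\<Sum>T\<in>H. schur_poly n (content T))"
    by (rule sum.image_gen[OF fin, symmetric])
  finally show ?thesis unfolding sum_level_eq_schur H_def .
qed

lemma hybrid_grothendieck_eq:
  "hybrid_grothendieck n lam mu =
    (\<Sum>\<gamma>. \<Sum>\<theta>.
       (multi_power TVar \<gamma> * multi_power WVar \<theta> *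
          (\<Sum>\<nu>. (of_nat (H_coeff lam mu n \<nu> \<gamma> \<theta>) * schur_poly n \<nu> when is_partition \<nu>))
        when weak_composition \<gamma> \<and> weak_composition \<theta>))"
proof -
  define V where "V = SVRPP_upto n lam mu"
  let ?c = "ceq lam mu" and ?e = "ex lam mu"
  have fin: "finite V" unfolding V_def by (rule finite_SVRPP_upto[OF skew])
  define t where "t = (\<lambda>\<gamma> \<theta>. \<Sum>T\<in>{T \<in> V. ?c T = \<gamma> \<and> ?e T = \<theta>}. svrpp_weight lam mu T)"
  have summand: "(multi_power TVar \<gamma> * multi_power WVar \<theta> *
          (\<Sum>\<nu>. (of_nat (H_coeff lam mu n \<nu> \<gamma> \<theta>) * schur_poly n \<nu> when is_partition \<nu>))
        when weak_composition \<gamma> \<and> weak_composition \<theta>) = t \<gamma> \<theta>" for \<gamma> \<theta>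
  proof -
    have lev: "level n \<gamma> \<theta> = {T \<in> V. ?c T = \<gamma> \<and> ?e T = \<theta>}" by (simp add: level_def V_def)
    show ?thesis
    proof (cases "weak_composition \<gamma> \<and> weak_composition \<theta>")
      case True
      have "t \<gamma> \<theta> = (\<Sum>T\<in>level n \<gamma> \<theta>. multi_power TVar \<gamma> * multi_power WVar \<theta> * multi_power XVar (content T))"
        unfolding t_def lev by (rule sum.cong) (auto simp: svrpp_weight_def mult_ac)
      with True show ?thesis unfolding sum_schur_eq by (simp add: sum_distrib_left)
    next
      case False
      have "{T \<in> V. ?c T = \<gamma> \<and> ?e T = \<theta>} = {}"
        using False weak_composition_ceq[OF skew] weak_composition_ex[OF skew] by blast
      then have "t \<gamma> \<theta> = 0" unfolding t_def by (simp only: sum.empty)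
      with False show ?thesis by simp
    qed
  qed
  \<comment> \<open>\<open>Sum_any\<close> defaults to 0 on infinite support; both outer sums are
    therefore confined to the finitely many statistics that occur in \<open>V\<close>.\<close>
  have t0: "t \<gamma> \<theta> = 0" if "\<gamma> \<notin> ?c ` V \<or> \<theta> \<notin> ?e ` V" for \<gamma> \<theta>
  proof -
    have "{T \<in> V. ?c T = \<gamma> \<and> ?e T = \<theta>} = {}" using that by blast
    then show ?thesis unfolding t_def by (simp only: sum.empty)
  qed
  have inner: "(\<Sum>\<theta>. t \<gamma> \<theta>) = (\<Sum>\<theta>\<in>?e ` V. t \<gamma> \<theta>)" for \<gamma>
    by (rule Sum_any.expand_superset) (use fin t0 in auto)
  have "(\<Sum>\<gamma>. \<Sum>\<theta>. t \<gamma> \<theta>) = (\<Sum>\<gamma>\<in>?c ` V. \<Sum>\<theta>. t \<gamma> \<theta>)"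
  proof (rule Sum_any.expand_superset)
    show "{\<gamma>. (\<Sum>\<theta>. t \<gamma> \<theta>) \<noteq> 0} \<subseteq> ?c ` V"
    proof
      fix \<gamma> assume a: "\<gamma> \<in> {\<gamma>. (\<Sum>\<theta>. t \<gamma> \<theta>) \<noteq> 0}"
      show "\<gamma> \<in> ?c ` V"
      proof (rule ccontr)
        assume "\<gamma> \<notin> ?c ` V"
        then have "t \<gamma> \<theta> = 0" for \<theta> using t0 by blast
        with a show False by simp
      qed
    qed
  qed (use fin in simp)
  also have "\<dots> = (\<Sum>\<gamma>\<in>?c ` V. \<Sum>T\<in>{T \<in> V. ?c T = \<gamma>}. svrpp_weight lam mu T)"
  proof (rule sum.cong[OF refl])
    fix \<gamma>
    have "(\<Sum>T\<in>{T \<in> V. ?c T = \<gamma>}. svrpp_weight lam mu T) =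
        (\<Sum>\<theta>\<in>?e ` V. \<Sum>T\<in>{T \<in> {T \<in> V. ?c T = \<gamma>}. ?e T = \<theta>}. svrpp_weight lam mu T)"
      by (rule sum.group[symmetric]) (use fin in auto)
    also have "\<dots> = (\<Sum>\<theta>\<in>?e ` V. t \<gamma> \<theta>)" by (simp add: t_def)
    finally show "(\<Sum>\<theta>. t \<gamma> \<theta>) = (\<Sum>T\<in>{T \<in> V. ?c T = \<gamma>}. svrpp_weight lam mu T)"
      unfolding inner by simp
  qed
  also have "\<dots> = (\<Sum>T\<in>V. svrpp_weight lam mu T)"
    by (rule sum.image_gen[OF fin, symmetric])
  finally show ?thesis unfolding summand hybrid_grothendieck_def V_def by simp
qed

end

theorem theorem1p3:
  fixes lam mu :: "nat \<Rightarrow> nat" and n :: nat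
  assumes "is_skew_shape lam mu" and "1 \<le> n"
  shows "hybrid_grothendieck n lam mu =
    (\<Sum>\<gamma>. \<Sum>\<theta>.
       (multi_power TVar \<gamma> * multi_power WVar \<theta> *
          (\<Sum>\<nu>. (of_nat (H_coeff lam mu n \<nu> \<gamma> \<theta>) * schur_poly n \<nu> when is_partition \<nu>))
        when weak_composition \<gamma> \<and> weak_composition \<theta>))"
  using assms(1) by (intro skew_shape.hybrid_grothendieck_eq skew_shape.intro)

end
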